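(* Let $\mathfrak g$ be a Kac-Moody Lie algebra, let $A$ be a finitely generated commutative associative unital $\mathbb C$-algebra, and let $\widetilde{\mathfrak g}=\mathfrak g'\otimes A\oplus\mathfrak h''$ and $\widetilde{\mathfrak h}=\mathfrak h'\otimes A\oplus\mathfrak h''$. Let $I$ be a cofinite ideal of $A$ and let $\psi:\widetilde{\mathfrak h}\to\mathbb C$ be a linear map such that $\psi|_{\mathfrak h'\otimes I}=0$ and $\psi|_{\mathfrak h}=\lambda$ is dominant integral. Let $\{I_\alpha,\ \alpha\in\Delta^+\}$ be a family of cofinite ideals of $A$ with $I_\alpha\subseteq I$ for all $\alpha\in\Delta^+$ such that (1) $\alpha\le\beta$ implies $I_\beta\subseteq I_\alpha$ for $\alpha,\beta\in\Delta^+$; (2) $I_\alpha I_\beta\subseteq I_{\alpha+\beta}$ whenever $\alpha,\beta,\alpha+\beta\in\Delta^+$. Then the $\widetilde{\mathfrak g}$-module $M(\psi,\{I_\alpha,\ \alpha\in\Delta^+\})$ has finite-dimensional weight spaces with respect to $\mathfrak h$.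
   Context: Setting. $\mathfrak g$ is a Kac-Moody Lie algebra over $\mathbb C$ with Cartan subalgebra $\mathfrak h$, triangular decomposition $\mathfrak g=N^-\oplus\mathfrak h\oplus N^+$, simple roots $\alpha_1,\dots,\alpha_l$, simple coroots $\alpha_1^\vee,\dots,\alpha_l^\vee$, and set of positive roots $\Delta^+$. $Q_+=\bigoplus_{i=1}^l\mathbb Z_{\ge0}\alpha_i$, and for $\alpha,\beta\in\Delta^+$ we write $\alpha\le\beta$ if $\beta-\alpha\in Q_+$. Put $\mathfrak g'=[\mathfrak g,\mathfrak g]$, $\mathfrak h'=\mathfrak g'\cap\mathfrak h$, and fix a subspace $\mathfrak h''$ with $\mathfrak h=\mathfrak h'\oplus\mathfrak h''$. $A$ is a finitely generated commutative associative unital $\mathbb C$-algebra. An ideal $I$ of $A$ is cofinite if $\dim_{\mathbb C}A/I<\infty$. A weight $\lambda\in\mathfrak h^*$ is dominant integral if $\lambda(\alpha_i^\vee)\in\mathbb Z_{\ge0}$ for all $i$. The Lie algebra $\widetilde{\mathfrak g}=\mathfrak g'\otimes A\oplus\mathfrak h''$ has bracket $[X\otimes a,Y\otimes b]=[X,Y]\otimes ab$, $[h,X\otimes a]=[h,X]\otimes a$, $[h,h_1]=0$ for $X,Y\in\mathfrak g'$, $a,b\in A$, $h,h_1\in\mathfrak h''$. Put $\widetilde{\mathfrak h}=\mathfrak h'\otimes A\oplus\mathfrak h''$ and $\widetilde N^{\pm}=N^{\pm}\otimes A$, so $\widetilde{\mathfrak g}=\widetilde N^+\oplus\widetilde{\mathfrak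 h}\oplus\widetilde N^-$. We identify $\mathfrak h=\mathfrak h'\otimes 1\oplus\mathfrak h''\subset\widetilde{\mathfrak h}$. Verma module. For a linear map $\psi:\widetilde{\mathfrak h}\to\mathbb C$, $M(\psi)=U(\widetilde{\mathfrak g})\otimes_{U(\widetilde N^+\oplus\widetilde{\mathfrak h})}\mathbb C$, where $\widetilde N^+$ acts on $\mathbb C$ by $0$ and $\widetilde{\mathfrak h}$ acts by $\psi$; $v$ denotes its highest weight vector $1\otimes1$. The module $M(\psi,\{I_\alpha,\ \alpha\in\Delta^+\})$ is the (universal) highest weight module of highest weight $\psi$ with highest weight vector $v$ satisfying $(X_{-\beta}\otimes I_\beta)v=0$ for all $\beta\in\Delta^+$ and all root vectors $X_{-\beta}$ of root $-\beta$; that is, the quotient of $M(\psi)$ by the submodule generated by all $(X_{-\beta}\otimes a)v$ with $\beta\in\Delta^+$, $a\in I_\beta$. *)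

theory Defs
  imports
    "Jordan_Normal_Form.DL_Rank"
    "HOL-Algebra.QuotRing"
    "HOL-Algebra.Ideal_Product"
    "HOL-Algebra.Generated_Rings"
    "HOL-Library.Poly_Mapping"
    "HOL-Library.Function_Algebras"
begin

section \<open>Complex vector spaces\<close>

text \<open>
  A complex vector space is a module record over \<^term>\<open>class_ring :: complex ring\<close>. The fields
  \<open>mult\<close> and \<open>one\<close> of such a record are meaningful only when the space is an algebra.
\<close>

abbreviation cvectorspace :: "(complex, 'v, 'm) module_scheme \<Rightarrow> bool" where
  "cvectorspace V \<equiv> vectorspace (class_ring :: complex ring) V"

abbreviation csubspace :: "'v set \<Rightarrow> (complex, 'v, 'm) module_scheme \<Rightarrow> bool" where
  "csubspace W V \<equiv> VectorSpace.subspace (class_ring :: complex ring) W V"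

abbreviation cspan :: "(complex, 'v, 'm) module_scheme \<Rightarrow> 'v set \<Rightarrow> 'v set" where
  "cspan V S \<equiv> LinearCombinations.module.span (class_ring :: complex ring) V S"

abbreviation cfin_dim :: "(complex, 'v, 'm) module_scheme \<Rightarrow> bool" where
  "cfin_dim V \<equiv> vectorspace.fin_dim (class_ring :: complex ring) V"

definition complex_space :: "(complex, complex) module" where
  "complex_space =
    \<lparr>carrier = UNIV, mult = (*), one = 1, zero = 0, add = (+), smult = (*)\<rparr>"

definition linear_forms :: "(complex, 'v, 'm) module_scheme \<Rightarrow> ('v \<Rightarrow> complex) set" where
  "linear_forms V = LinearCombinations.module_hom class_ring V complex_space"

text \<open>
  The quotient of a vector space by a subspace, or of an algebra by a two-sided ideal.
  If \<open>f\<close> is a linear endomorphism of \<open>V\<close> preserving \<open>W\<close>, the induced map on \<open>V/W\<close> sends a coset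
  \<open>X\<close> to \<open>W + f(X)\<close>; scalar multiplication is an instance of this. (The set \<open>f(X)\<close> alone need not
  be a coset, e.g. for \<open>f = 0\<close>.)
\<close>

definition induced_map ::
    "(complex, 'v, 'm) module_scheme \<Rightarrow> 'v set \<Rightarrow> ('v \<Rightarrow> 'v) \<Rightarrow> 'v set \<Rightarrow> 'v set" where
  "induced_map V W f X = W <+>\<^bsub>V\<^esub> (f ` X)"

definition quot_space ::
    "(complex, 'v, 'm) module_scheme \<Rightarrow> 'v set \<Rightarrow> (complex, 'v set) module" where
  "quot_space V W =
    ring.extend (V Quot W) (module.fields (\<lambda>c. induced_map V W (\<lambda>x. c \<odot>\<^bsub>V\<^esub> x)))"

abbreviation gen :: "'s \<Rightarrow> 's \<Rightarrow>\<^sub>0 complex" where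
  "gen s \<equiv> Poly_Mapping.single s 1"

definition free_space :: "'s set \<Rightarrow> (complex, 's \<Rightarrow>\<^sub>0 complex) module" where
  "free_space S =
    \<lparr>carrier = {p. Poly_Mapping.keys p \<subseteq> S}, mult = (\<lambda>p q. 0), one = 0, zero = 0, add = (+),
     smult = (\<lambda>c. Poly_Mapping.map ((*) c))\<rparr>"

text \<open>The linear extension of a map given on the basis of a free space.\<close>

definition lin_ext ::
    "('s \<Rightarrow> ('t \<Rightarrow>\<^sub>0 complex)) \<Rightarrow> ('s \<Rightarrow>\<^sub>0 complex) \<Rightarrow> ('t \<Rightarrow>\<^sub>0 complex)" where
  "lin_ext f p =
    (\<Sum>s\<in>Poly_Mapping.keys p. Poly_Mapping.map ((*) (Poly_Mapping.lookup p s)) (f s))"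

definition tensor_rels ::
    "(complex, 'v, 'm) module_scheme \<Rightarrow> (complex, 'w, 'n) module_scheme
      \<Rightarrow> ('v \<times> 'w \<Rightarrow>\<^sub>0 complex) set" where
  "tensor_rels V W =
    {gen (x \<oplus>\<^bsub>V\<^esub> x', y) - gen (x, y) - gen (x', y) |x x' y.
       x \<in> carrier V \<and> x' \<in> carrier V \<and> y \<in> carrier W}
    \<union> {gen (x, y \<oplus>\<^bsub>W\<^esub> y') - gen (x, y) - gen (x, y') |x y y'.
       x \<in> carrier V \<and> y \<in> carrier W \<and> y' \<in> carrier W}
    \<union> {gen (c \<odot>\<^bsub>V\<^esub> x, y) - Poly_Mapping.single (x, y) c |c x y.
       x \<in> carrier V \<and> y \<in> carrier W}
    \<union> {gen (x, c \<odot>\<^bsub>W\<^esub> y) - Poly_Mapping.single (x, y) c |c x y.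
       x \<in> carrier V \<and> y \<in> carrier W}"

abbreviation tensor_free ::
    "(complex, 'v, 'm) module_scheme \<Rightarrow> (complex, 'w, 'n) module_scheme
      \<Rightarrow> (complex, 'v \<times> 'w \<Rightarrow>\<^sub>0 complex) module" where
  "tensor_free V W \<equiv> free_space (carrier V \<times> carrier W)"

definition tensor_ker ::
    "(complex, 'v, 'm) module_scheme \<Rightarrow> (complex, 'w, 'n) module_scheme
      \<Rightarrow> ('v \<times> 'w \<Rightarrow>\<^sub>0 complex) set" where
  "tensor_ker V W = cspan (tensor_free V W) (tensor_rels V W)"

definition tensor_space ::
    "(complex, 'v, 'm) module_scheme \<Rightarrow> (complex, 'w, 'n) module_scheme
      \<Rightarrow> (complex, ('v \<times> 'w \<Rightarrow>\<^sub>0 complex) set) module" where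
  "tensor_space V W = quot_space (tensor_free V W) (tensor_ker V W)"

definition tensor ::
    "(complex, 'v, 'm) module_scheme \<Rightarrow> (complex, 'w, 'n) module_scheme
      \<Rightarrow> 'v \<Rightarrow> 'w \<Rightarrow> ('v \<times> 'w \<Rightarrow>\<^sub>0 complex) set" where
  "tensor V W x y = tensor_ker V W +>\<^bsub>tensor_free V W\<^esub> gen (x, y)"


section \<open>Lie algebras and their representations\<close>

record 'x lie_alg = "(complex, 'x) module" +
  bracket :: "'x \<Rightarrow> 'x \<Rightarrow> 'x"

locale lie_algebra = vectorspace "class_ring :: complex ring" L
  for L :: "('x, 'm) lie_alg_scheme" (structure) +
  assumes bracket_closed: "\<lbrakk>x \<in> carrier L; y \<in> carrier L\<rbrakk> \<Longrightarrow> bracket L x y \<in> carrier L"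
    and bracket_add_left: "\<lbrakk>x \<in> carrier L; y \<in> carrier L; z \<in> carrier L\<rbrakk>
      \<Longrightarrow> bracket L (x \<oplus> y) z = bracket L x z \<oplus> bracket L y z"
    and bracket_add_right: "\<lbrakk>x \<in> carrier L; y \<in> carrier L; z \<in> carrier L\<rbrakk>
      \<Longrightarrow> bracket L x (y \<oplus> z) = bracket L x y \<oplus> bracket L x z"
    and bracket_smult_left: "\<lbrakk>x \<in> carrier L; y \<in> carrier L\<rbrakk>
      \<Longrightarrow> bracket L (c \<odot> x) y = c \<odot> bracket L x y"
    and bracket_smult_right: "\<lbrakk>x \<in> carrier L; y \<in> carrier L\<rbrakk>
      \<Longrightarrow> bracket L x (c \<odot> y) = c \<odot> bracket L x y"
    and bracket_self: "x \<in> carrier L \<Longrightarrow> bracket L x x = \<zero>"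
    and jacobi: "\<lbrakk>x \<in> carrier L; y \<in> carrier L; z \<in> carrier L\<rbrakk>
      \<Longrightarrow> bracket L x (bracket L y z) \<oplus> bracket L y (bracket L z x)
            \<oplus> bracket L z (bracket L x y) = \<zero>"

definition lie_subalgebra :: "('x, 'm) lie_alg_scheme \<Rightarrow> 'x set \<Rightarrow> bool" where
  "lie_subalgebra L S \<longleftrightarrow> csubspace S L \<and> (\<forall>x\<in>S. \<forall>y\<in>S. bracket L x y \<in> S)"

definition lie_ideal :: "('x, 'm) lie_alg_scheme \<Rightarrow> 'x set \<Rightarrow> bool" where
  "lie_ideal L J \<longleftrightarrow> csubspace J L \<and> (\<forall>x\<in>carrier L. \<forall>y\<in>J. bracket L x y \<in> J)"

definition derived :: "('x, 'm) lie_alg_scheme \<Rightarrow> 'x set" where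
  "derived L = cspan L {bracket L x y |x y. x \<in> carrier L \<and> y \<in> carrier L}"

text \<open>The tensor algebra is realised as the free associative algebra on the set \<open>S\<close> of letters,
  with words as a basis; the linear relations among letters are imposed in \<open>univ_rels\<close>.\<close>

definition free_assoc :: "'x set \<Rightarrow> (complex, 'x list \<Rightarrow>\<^sub>0 complex) module" where
  "free_assoc S = (free_space (lists S))
    \<lparr>mult := (\<lambda>p q. lin_ext (\<lambda>u. lin_ext (\<lambda>w. gen (u @ w)) q) p), one := gen []\<rparr>"

definition univ_rels :: "('x, 'm) lie_alg_scheme \<Rightarrow> ('x list \<Rightarrow>\<^sub>0 complex) set" where
  "univ_rels L =
    {gen [x \<oplus>\<^bsub>L\<^esub> y] - gen [x] - gen [y] |x y. x \<in> carrier L \<and> y \<in> carrier L}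
    \<union> {gen [c \<odot>\<^bsub>L\<^esub> x] - Poly_Mapping.single [x] c |c x. x \<in> carrier L}
    \<union> {gen [x, y] - gen [y, x] - gen [bracket L x y] |x y. x \<in> carrier L \<and> y \<in> carrier L}"

definition univ_ideal :: "('x, 'm) lie_alg_scheme \<Rightarrow> ('x list \<Rightarrow>\<^sub>0 complex) set" where
  "univ_ideal L = genideal (free_assoc (carrier L)) (univ_rels L)"

definition univ_env ::
    "('x, 'm) lie_alg_scheme \<Rightarrow> (complex, ('x list \<Rightarrow>\<^sub>0 complex) set) module" where
  "univ_env L = quot_space (free_assoc (carrier L)) (univ_ideal L)"

definition univ_class ::
    "('x, 'm) lie_alg_scheme \<Rightarrow> ('x list \<Rightarrow>\<^sub>0 complex) \<Rightarrow> ('x list \<Rightarrow>\<^sub>0 complex) set" where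
  "univ_class L p = univ_ideal L +>\<^bsub>free_assoc (carrier L)\<^esub> p"

record ('x, 'v) lie_rep = "(complex, 'v) module" +
  act :: "'x \<Rightarrow> 'v \<Rightarrow> 'v"

definition lie_submodule ::
    "('x, 'm) lie_alg_scheme \<Rightarrow> ('x, 'v, 'n) lie_rep_scheme \<Rightarrow> 'v set \<Rightarrow> bool" where
  "lie_submodule L M N \<longleftrightarrow> csubspace N M \<and> (\<forall>x\<in>carrier L. \<forall>m\<in>N. act M x m \<in> N)"

definition quot_rep ::
    "('x, 'v, 'n) lie_rep_scheme \<Rightarrow> 'v set \<Rightarrow> ('x, 'v set) lie_rep" where
  "quot_rep M N =
    module.extend (quot_space M N) (lie_rep.fields (\<lambda>x. induced_map M N (act M x)))"

text \<open>
  For a Lie subalgebra \<open>B\<close> of \<open>L\<close> and a one-dimensional representation \<open>\<chi>\<close> of \<open>B\<close>, the module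
  \<open>induced_rep L B \<chi>\<close> is \<open>U(L) \<otimes> \<complex>\<close>, tensored over \<open>U(B)\<close>: the free space on pairs \<open>(u, c)\<close> modulo
  bilinearity and \<open>(u b, c) = (u, b c)\<close> for \<open>b\<close> in \<open>U(B)\<close>. Here \<open>b\<close> runs over the classes of
  the elements \<open>p\<close> of the free associative algebra on \<open>B\<close>, and such a class acts on \<open>\<complex>\<close> by
  \<open>char_eval \<chi> p\<close>.
\<close>

definition char_eval :: "('x \<Rightarrow> complex) \<Rightarrow> ('x list \<Rightarrow>\<^sub>0 complex) \<Rightarrow> complex" where
  "char_eval \<chi> p =
    (\<Sum>w\<in>Poly_Mapping.keys p. Poly_Mapping.lookup p w * prod_list (map \<chi> w))"

definition induced_ker ::
    "('x, 'm) lie_alg_scheme \<Rightarrow> 'x set \<Rightarrow> ('x \<Rightarrow> complex)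
      \<Rightarrow> (('x list \<Rightarrow>\<^sub>0 complex) set \<times> complex \<Rightarrow>\<^sub>0 complex) set" where
  "induced_ker L B \<chi> = cspan (tensor_free (univ_env L) complex_space)
    (tensor_rels (univ_env L) complex_space
     \<union> {gen (u \<otimes>\<^bsub>univ_env L\<^esub> univ_class L p, c) - gen (u, char_eval \<chi> p * c) |u p c.
          u \<in> carrier (univ_env L) \<and> p \<in> carrier (free_assoc B)})"

definition induced_rep ::
    "('x, 'm) lie_alg_scheme \<Rightarrow> 'x set \<Rightarrow> ('x \<Rightarrow> complex)
      \<Rightarrow> ('x, (('x list \<Rightarrow>\<^sub>0 complex) set \<times> complex \<Rightarrow>\<^sub>0 complex) set) lie_rep" where
  "induced_rep L B \<chi> =
    module.extend (quot_space (tensor_free (univ_env L) complex_space) (induced_ker L B \<chi>))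
      (lie_rep.fields (\<lambda>x.
        induced_map (tensor_free (univ_env L) complex_space) (induced_ker L B \<chi>)
          (lin_ext (\<lambda>(u, c). gen (univ_class L (gen [x]) \<otimes>\<^bsub>univ_env L\<^esub> u, c)))))"

definition induced_vec ::
    "('x, 'm) lie_alg_scheme \<Rightarrow> 'x set \<Rightarrow> ('x \<Rightarrow> complex)
      \<Rightarrow> (('x list \<Rightarrow>\<^sub>0 complex) set \<times> complex \<Rightarrow>\<^sub>0 complex) set" where
  "induced_vec L B \<chi> =
    induced_ker L B \<chi> +>\<^bsub>tensor_free (univ_env L) complex_space\<^esub> gen (\<one>\<^bsub>univ_env L\<^esub>, 1)"


section \<open>Kac-Moody algebras\<close>

definition gen_cartan_matrix :: "int mat \<Rightarrow> bool" where
  "gen_cartan_matrix C \<longleftrightarrow> C \<in> carrier_mat (dim_row C) (dim_row C)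
    \<and> (\<forall>i<dim_row C. C $$ (i, i) = 2)
    \<and> (\<forall>i<dim_row C. \<forall>j<dim_row C. i \<noteq> j \<longrightarrow> C $$ (i, j) \<le> 0)
    \<and> (\<forall>i<dim_row C. \<forall>j<dim_row C. C $$ (i, j) = 0 \<longrightarrow> C $$ (j, i) = 0)"

text \<open>
  Elements of the dual of the Cartan subalgebra \<open>h\<close> are represented by functions on the whole type
  which vanish outside \<open>h\<close>, so that sums, differences and equality of weights can be taken in the
  function type.
\<close>

definition cartan_dual :: "('g, 'm) lie_alg_scheme \<Rightarrow> 'g set \<Rightarrow> ('g \<Rightarrow> complex) set" where
  "cartan_dual g h =
    {\<phi>. \<phi> \<in> linear_forms (g\<lparr>carrier := h\<rparr>) \<and> (\<forall>x. x \<notin> h \<longrightarrow> \<phi> x = 0)}"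

text \<open>
  The Kac-Moody algebra of the generalised Cartan matrix \<open>C\<close>: \<open>h\<close>, \<open>\<alpha>\<close> and \<open>\<alpha>v\<close> form a realisation of
  \<open>C\<close> (simple roots \<open>\<alpha> i\<close>, simple coroots \<open>\<alpha>v i\<close>, \<open>i < dim_row C\<close>), \<open>g\<close> is generated by \<open>h\<close> and the
  Chevalley generators \<open>e i\<close>, \<open>f i\<close> subject to the usual relations, and all ideals meeting \<open>h\<close>
  trivially have been factored out.
\<close>

locale kac_moody = lie_algebra g
  for g :: "('g, 'm) lie_alg_scheme" (structure) +
  fixes h :: "'g set" and C :: "int mat"
    and e f \<alpha>v :: "nat \<Rightarrow> 'g" and \<alpha> :: "nat \<Rightarrow> 'g \<Rightarrow> complex"
  assumes gcm: "gen_cartan_matrix C"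
    and cartan_subspace: "csubspace h g"
    and cartan_fin_dim: "cfin_dim (g\<lparr>carrier := h\<rparr>)"
    and cartan_dim:
      "vectorspace.dim (class_ring :: complex ring) (g\<lparr>carrier := h\<rparr>)
        + vec_space.rank (dim_row C) (map_mat (of_int :: int \<Rightarrow> complex) C) = 2 * dim_row C"
    and coroot_in: "i < dim_row C \<Longrightarrow> \<alpha>v i \<in> h"
    and root_in: "i < dim_row C \<Longrightarrow> \<alpha> i \<in> cartan_dual g h"
    and coroot_indep:
      "\<lbrakk>(\<Oplus>i\<in>{..<dim_row C}. c i \<odot> \<alpha>v i) = \<zero>; i < dim_row C\<rbrakk> \<Longrightarrow> c i = 0"
    and root_indep:
      "\<lbrakk>\<forall>x\<in>h. (\<Sum>i<dim_row C. c i * \<alpha> i x) = 0; i < dim_row C\<rbrakk> \<Longrightarrow> c i = 0"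
    and root_coroot: "\<lbrakk>i < dim_row C; j < dim_row C\<rbrakk> \<Longrightarrow> \<alpha> j (\<alpha>v i) = of_int (C $$ (i, j))"
    and e_in: "i < dim_row C \<Longrightarrow> e i \<in> carrier g"
    and f_in: "i < dim_row C \<Longrightarrow> f i \<in> carrier g"
    and bracket_cartan: "\<lbrakk>x \<in> h; y \<in> h\<rbrakk> \<Longrightarrow> bracket g x y = \<zero>"
    and bracket_e_f: "\<lbrakk>i < dim_row C; j < dim_row C\<rbrakk>
      \<Longrightarrow> bracket g (e i) (f j) = (if i = j then \<alpha>v i else \<zero>)"
    and bracket_cartan_e: "\<lbrakk>x \<in> h; i < dim_row C\<rbrakk> \<Longrightarrow> bracket g x (e i) = \<alpha> i x \<odot> e i"
    and bracket_cartan_f: "\<lbrakk>x \<in> h; i < dim_row C\<rbrakk> \<Longrightarrow> bracket g x (f i) = (- (\<alpha> i x)) \<odot> f i"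
    and generated:
      "\<lbrakk>lie_subalgebra g S; h \<union> e ` {..<dim_row C} \<union> f ` {..<dim_row C} \<subseteq> S\<rbrakk>
        \<Longrightarrow> S = carrier g"
    and ideal_trivial: "\<lbrakk>lie_ideal g J; J \<inter> h = {\<zero>}\<rbrakk> \<Longrightarrow> J = {\<zero>}"

definition root_space ::
    "('g, 'm) lie_alg_scheme \<Rightarrow> 'g set \<Rightarrow> ('g \<Rightarrow> complex) \<Rightarrow> 'g set" where
  "root_space g h \<beta> = {x \<in> carrier g. \<forall>y\<in>h. bracket g y x = \<beta> y \<odot>\<^bsub>g\<^esub> x}"

definition Q_plus :: "nat \<Rightarrow> (nat \<Rightarrow> 'g \<Rightarrow> complex) \<Rightarrow> ('g \<Rightarrow> complex) set" where
  "Q_plus l \<alpha> = {\<beta>. \<exists>n :: nat \<Rightarrow> nat. \<beta> = (\<lambda>x. \<Sum>i<l. of_nat (n i) * \<alpha> i x)}"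

definition pos_roots ::
    "('g, 'm) lie_alg_scheme \<Rightarrow> 'g set \<Rightarrow> nat \<Rightarrow> (nat \<Rightarrow> 'g \<Rightarrow> complex)
      \<Rightarrow> ('g \<Rightarrow> complex) set" where
  "pos_roots g h l \<alpha> =
    {\<beta> \<in> Q_plus l \<alpha>. \<beta> \<noteq> 0 \<and> root_space g h \<beta> \<noteq> {\<zero>\<^bsub>g\<^esub>}}"

definition nilp_plus ::
    "('g, 'm) lie_alg_scheme \<Rightarrow> 'g set \<Rightarrow> nat \<Rightarrow> (nat \<Rightarrow> 'g \<Rightarrow> complex) \<Rightarrow> 'g set" where
  "nilp_plus g h l \<alpha> = cspan g (\<Union>\<beta>\<in>pos_roots g h l \<alpha>. root_space g h \<beta>)"

definition cartan' :: "('g, 'm) lie_alg_scheme \<Rightarrow> 'g set \<Rightarrow> 'g set" where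
  "cartan' g h = derived g \<inter> h"

definition cartan_complement ::
    "('g, 'm) lie_alg_scheme \<Rightarrow> 'g set \<Rightarrow> 'g set \<Rightarrow> bool" where
  "cartan_complement g h h'' \<longleftrightarrow> csubspace h'' g \<and> cartan' g h \<inter> h'' = {\<zero>\<^bsub>g\<^esub>}
    \<and> cartan' g h <+>\<^bsub>g\<^esub> h'' = h"

definition dominant_integral :: "nat \<Rightarrow> (nat \<Rightarrow> 'g) \<Rightarrow> ('g \<Rightarrow> complex) \<Rightarrow> bool" where
  "dominant_integral l \<alpha>v \<mu> \<longleftrightarrow> (\<forall>i<l. \<mu> (\<alpha>v i) \<in> \<nat>)"


section \<open>The algebra \<open>g' \<otimes> A \<oplus> h''\<close>\<close>

definition fin_gen_algebra :: "(complex, 'a, 'm) module_scheme \<Rightarrow> bool" where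
  "fin_gen_algebra A \<longleftrightarrow> (\<exists>S. finite S \<and> S \<subseteq> carrier A
    \<and> generate_ring A (range (\<lambda>c. c \<odot>\<^bsub>A\<^esub> \<one>\<^bsub>A\<^esub>) \<union> S) = carrier A)"

definition cofinite_ideal :: "(complex, 'a, 'm) module_scheme \<Rightarrow> 'a set \<Rightarrow> bool" where
  "cofinite_ideal A I \<longleftrightarrow> ideal I A \<and> cfin_dim (quot_space A I)"

type_synonym ('g, 'a) current = "('g \<times> 'a \<Rightarrow>\<^sub>0 complex) set"

abbreviation derived_alg :: "('g, 'm) lie_alg_scheme \<Rightarrow> ('g, 'm) lie_alg_scheme" where
  "derived_alg g \<equiv> g\<lparr>carrier := derived g\<rparr>"

definition current_space ::
    "('g, 'm) lie_alg_scheme \<Rightarrow> (complex, 'a, 'n) module_scheme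
      \<Rightarrow> (complex, ('g, 'a) current) module" where
  "current_space g A = tensor_space (derived_alg g) A"

text \<open>The bracket \<open>[X \<otimes> a, Y \<otimes> b] = [X, Y] \<otimes> ab\<close> on \<open>g' \<otimes> A\<close> and the action
  \<open>d \<cdot> (X \<otimes> a) = [d, X] \<otimes> a\<close> of \<open>d \<in> h''\<close>, both induced from the free space on \<open>g' \<times> A\<close>.\<close>

definition current_bracket ::
    "('g, 'm) lie_alg_scheme \<Rightarrow> (complex, 'a, 'n) module_scheme
      \<Rightarrow> ('g, 'a) current \<Rightarrow> ('g, 'a) current \<Rightarrow> ('g, 'a) current" where
  "current_bracket g A P Q = tensor_ker (derived_alg g) A <+>\<^bsub>tensor_free (derived_alg g) A\<^esub>
    {lin_ext (\<lambda>(x, a). lin_ext (\<lambda>(y, b). gen (bracket g x y, a \<otimes>\<^bsub>A\<^esub> b)) q) p |p q.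
       p \<in> P \<and> q \<in> Q}"

definition current_deriv ::
    "('g, 'm) lie_alg_scheme \<Rightarrow> (complex, 'a, 'n) module_scheme
      \<Rightarrow> 'g \<Rightarrow> ('g, 'a) current \<Rightarrow> ('g, 'a) current" where
  "current_deriv g A d =
    induced_map (tensor_free (derived_alg g) A) (tensor_ker (derived_alg g) A)
      (lin_ext (\<lambda>(x, a). gen (bracket g d x, a)))"

definition g_tilde ::
    "('g, 'm) lie_alg_scheme \<Rightarrow> (complex, 'a, 'n) module_scheme \<Rightarrow> 'g set
      \<Rightarrow> (('g, 'a) current \<times> 'g) lie_alg" where
  "g_tilde g A h'' =
    module.extend (direct_sum (current_space g A) (g\<lparr>carrier := h''\<rparr>))
      (lie_alg.fields (\<lambda>(P, d) (Q, d').
        (current_bracket g A P Q \<oplus>\<^bsub>current_space g A\<^esub> current_deriv g A d Q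
           \<ominus>\<^bsub>current_space g A\<^esub> current_deriv g A d' P, \<zero>\<^bsub>g\<^esub>)))"

definition pure ::
    "('g, 'm) lie_alg_scheme \<Rightarrow> (complex, 'a, 'n) module_scheme
      \<Rightarrow> 'g \<Rightarrow> 'a \<Rightarrow> ('g, 'a) current \<times> 'g" where
  "pure g A x a = (tensor (derived_alg g) A x a, \<zero>\<^bsub>g\<^esub>)"

text \<open>The subspace \<open>S \<otimes> J\<close> of \<open>g' \<otimes> A\<close>, for subspaces \<open>S\<close> of \<open>g'\<close> and \<open>J\<close> of \<open>A\<close>.\<close>

definition current_sub ::
    "('g, 'm) lie_alg_scheme \<Rightarrow> (complex, 'a, 'n) module_scheme
      \<Rightarrow> 'g set \<Rightarrow> 'a set \<Rightarrow> ('g, 'a) current set" where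
  "current_sub g A S J =
    cspan (current_space g A) {tensor (derived_alg g) A x a |x a. x \<in> S \<and> a \<in> J}"

definition h_tilde ::
    "('g, 'm) lie_alg_scheme \<Rightarrow> (complex, 'a, 'n) module_scheme \<Rightarrow> 'g set \<Rightarrow> 'g set
      \<Rightarrow> (('g, 'a) current \<times> 'g) set" where
  "h_tilde g A h h'' = current_sub g A (cartan' g h) (carrier A) \<times> h''"

definition nilp_plus_tilde ::
    "('g, 'm) lie_alg_scheme \<Rightarrow> (complex, 'a, 'n) module_scheme \<Rightarrow> 'g set
      \<Rightarrow> nat \<Rightarrow> (nat \<Rightarrow> 'g \<Rightarrow> complex) \<Rightarrow> (('g, 'a) current \<times> 'g) set" where
  "nilp_plus_tilde g A h l \<alpha> =
    current_sub g A (nilp_plus g h l \<alpha>) (carrier A) \<times> {\<zero>\<^bsub>g\<^esub>}"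

text \<open>The identification of \<open>h = h' \<oplus> h''\<close> with the subspace \<open>h' \<otimes> 1 \<oplus> h''\<close>.\<close>

definition cartan_emb ::
    "('g, 'm) lie_alg_scheme \<Rightarrow> (complex, 'a, 'n) module_scheme \<Rightarrow> 'g set \<Rightarrow> 'g set
      \<Rightarrow> 'g \<Rightarrow> ('g, 'a) current \<times> 'g" where
  "cartan_emb g A h h'' x =
    (THE z. \<exists>y\<in>cartan' g h. \<exists>d\<in>h''. x = y \<oplus>\<^bsub>g\<^esub> d
       \<and> z = (tensor (derived_alg g) A y \<one>\<^bsub>A\<^esub>, d))"


section \<open>Verma modules and their quotients\<close>

definition borel_tilde ::
    "('g, 'm) lie_alg_scheme \<Rightarrow> (complex, 'a, 'n) module_scheme \<Rightarrow> 'g set \<Rightarrow> 'g set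
      \<Rightarrow> nat \<Rightarrow> (nat \<Rightarrow> 'g \<Rightarrow> complex) \<Rightarrow> (('g, 'a) current \<times> 'g) set" where
  "borel_tilde g A h h'' l \<alpha> =
    nilp_plus_tilde g A h l \<alpha> <+>\<^bsub>g_tilde g A h''\<^esub> h_tilde g A h h''"

text \<open>The extension of \<open>\<psi>\<close> by zero along the decomposition of \<open>borel_tilde\<close>.\<close>

definition borel_char ::
    "('g, 'm) lie_alg_scheme \<Rightarrow> (complex, 'a, 'n) module_scheme \<Rightarrow> 'g set \<Rightarrow> 'g set
      \<Rightarrow> nat \<Rightarrow> (nat \<Rightarrow> 'g \<Rightarrow> complex) \<Rightarrow> (('g, 'a) current \<times> 'g \<Rightarrow> complex)
      \<Rightarrow> ('g, 'a) current \<times> 'g \<Rightarrow> complex" where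
  "borel_char g A h h'' l \<alpha> \<psi> z =
    \<psi> (THE t. t \<in> h_tilde g A h h''
      \<and> (\<exists>n\<in>nilp_plus_tilde g A h l \<alpha>. z = n \<oplus>\<^bsub>g_tilde g A h''\<^esub> t))"

type_synonym ('g, 'a) verma_vec =
  "(((('g, 'a) current \<times> 'g) list \<Rightarrow>\<^sub>0 complex) set \<times> complex \<Rightarrow>\<^sub>0 complex) set"

definition verma ::
    "('g, 'm) lie_alg_scheme \<Rightarrow> (complex, 'a, 'n) module_scheme \<Rightarrow> 'g set \<Rightarrow> 'g set
      \<Rightarrow> nat \<Rightarrow> (nat \<Rightarrow> 'g \<Rightarrow> complex) \<Rightarrow> (('g, 'a) current \<times> 'g \<Rightarrow> complex)
      \<Rightarrow> (('g, 'a) current \<times> 'g, ('g, 'a) verma_vec) lie_rep" where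
  "verma g A h h'' l \<alpha> \<psi> =
    induced_rep (g_tilde g A h'') (borel_tilde g A h h'' l \<alpha>) (borel_char g A h h'' l \<alpha> \<psi>)"

definition verma_hwv ::
    "('g, 'm) lie_alg_scheme \<Rightarrow> (complex, 'a, 'n) module_scheme \<Rightarrow> 'g set \<Rightarrow> 'g set
      \<Rightarrow> nat \<Rightarrow> (nat \<Rightarrow> 'g \<Rightarrow> complex) \<Rightarrow> (('g, 'a) current \<times> 'g \<Rightarrow> complex)
      \<Rightarrow> ('g, 'a) verma_vec" where
  "verma_hwv g A h h'' l \<alpha> \<psi> =
    induced_vec (g_tilde g A h'') (borel_tilde g A h h'' l \<alpha>) (borel_char g A h h'' l \<alpha> \<psi>)"

definition verma_submodule ::
    "('g, 'm) lie_alg_scheme \<Rightarrow> (complex, 'a, 'n) module_scheme \<Rightarrow> 'g set \<Rightarrow> 'g set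
      \<Rightarrow> nat \<Rightarrow> (nat \<Rightarrow> 'g \<Rightarrow> complex) \<Rightarrow> (('g, 'a) current \<times> 'g \<Rightarrow> complex)
      \<Rightarrow> (('g \<Rightarrow> complex) \<Rightarrow> 'a set) \<Rightarrow> ('g, 'a) verma_vec set" where
  "verma_submodule g A h h'' l \<alpha> \<psi> I =
    lie_submodule (g_tilde g A h'') (verma g A h h'' l \<alpha> \<psi>) hull
      {act (verma g A h h'' l \<alpha> \<psi>) (pure g A X a) (verma_hwv g A h h'' l \<alpha> \<psi>) |\<beta> X a.
        \<beta> \<in> pos_roots g h l \<alpha> \<and> X \<in> root_space g h (- \<beta>) \<and> a \<in> I \<beta>}"

definition verma_quotient ::
    "('g, 'm) lie_alg_scheme \<Rightarrow> (complex, 'a, 'n) module_scheme \<Rightarrow> 'g set \<Rightarrow> 'g set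
      \<Rightarrow> nat \<Rightarrow> (nat \<Rightarrow> 'g \<Rightarrow> complex) \<Rightarrow> (('g, 'a) current \<times> 'g \<Rightarrow> complex)
      \<Rightarrow> (('g \<Rightarrow> complex) \<Rightarrow> 'a set)
      \<Rightarrow> (('g, 'a) current \<times> 'g, ('g, 'a) verma_vec set) lie_rep" where
  "verma_quotient g A h h'' l \<alpha> \<psi> I =
    quot_rep (verma g A h h'' l \<alpha> \<psi>) (verma_submodule g A h h'' l \<alpha> \<psi> I)"

text \<open>Weight spaces with respect to \<open>h\<close>, acting through \<open>\<iota>\<close>.\<close>

definition weight_space ::
    "('x, 'v, 'n) lie_rep_scheme \<Rightarrow> ('g \<Rightarrow> 'x) \<Rightarrow> 'g set \<Rightarrow> ('g \<Rightarrow> complex) \<Rightarrow> 'v set" where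
  "weight_space M \<iota> h \<mu> = {m \<in> carrier M. \<forall>x\<in>h. act M (\<iota> x) m = \<mu> x \<odot>\<^bsub>M\<^esub> m}"

end

theory Submission
  imports Defs "HOL-Library.Multiset"
begin

text \<open>
  The quotient module is spanned by monomials \<open>(X\<^sub>1 \<otimes> a\<^sub>1) \<dots> (X\<^sub>r \<otimes> a\<^sub>r) v\<close> in which \<open>X\<^sub>i\<close> is a root vector
  for a negative root \<open>-\<beta>\<^sub>i\<close>; the weight of such a monomial is determined by its degree, the sum of
  the \<open>\<beta>\<^sub>i\<close>, which in turn it determines because the simple roots are independent. If \<open>a\<close> lies in
  \<open>I\<^sub>\<gamma>\<close> for all positive roots \<open>\<gamma> \<le> \<beta> + \<eta>\<close>, then \<open>X\<^sub>-\<^sub>\<beta> \<otimes> a\<close> kills all monomials of degree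
  \<open>\<eta>\<close>: moving it to the right past \<open>Y \<otimes> b\<close> produces \<open>[X\<^sub>-\<^sub>\<beta>, Y] \<otimes> ab\<close>, which is of the same kind. As
  only finitely many \<open>\<gamma>\<close> occur, these \<open>a\<close> form a cofinite ideal, so the space of monomials of a given
  degree is finite-dimensional by induction on the degree.

  The defining relations only involve \<open>X\<^sub>-\<^sub>\<beta>\<close> with \<open>\<beta>\<close> a positive root, so one also needs that
  \<open>\<beta>\<close> is a root whenever \<open>-\<beta>\<close> is; this uses that \<open>g\<close> has no ideal meeting \<open>h\<close> trivially.
\<close>

section \<open>Complex vector spaces\<close>

text \<open>Only upper bounds on dimensions are required, so the argument rests on spanning sets
  alone: the letters of a monomial stay unordered, and neither a PBW basis nor freeness of the Verma
  module enters. The obstacle is that every letter carries a coefficient from A, which may be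
  infinite-dimensional, so that finitely many degrees alone bound nothing. For this reason the total
  degree is fixed before a letter is split off: the intersection of the ideals attached to all
  nonzero parts of that degree is one cofinite ideal that works for every way of splitting it into a
  first letter and a rest, and a coefficient of the first letter matters only modulo this ideal.
  Degrees are multisets of indices of simple roots rather than weights. The piece of N^- of a given
  degree is spanned by iterated brackets of the \<open>f i\<close> with prescribed content, so its
  finite dimension comes from counting words. The dimension count itself is carried out in the
  abstract locale \<open>graded_cyclic\<close>, apart from the construction of the Lie algebra and
  the module.\<close>

locale cspace = vectorspace "class_ring :: complex ring" V
  for V :: "(complex, 'v, 'm) module_scheme" (structure)
begin

lemma scale_closed [simp, intro]: "x \<in> carrier V \<Longrightarrow> c \<odot> x \<in> carrier V"
  using smult_closed[of c x] by simp

lemma scale_add_left: "x \<in> carrier V \<Longrightarrow> (a + b) \<odot> x = a \<odot> x \<oplus> b \<odot> x"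
  using smult_l_distr[of a b x] by simp

lemma scale_add_right: "\<lbrakk>x \<in> carrier V; y \<in> carrier V\<rbrakk> \<Longrightarrow> c \<odot> (x \<oplus> y) = c \<odot> x \<oplus> c \<odot> y"
  using smult_r_distr[of c x y] by simp

lemma scale_scale: "x \<in> carrier V \<Longrightarrow> a \<odot> (b \<odot> x) = (a * b) \<odot> x"
  using smult_assoc1[of a b x] by simp

lemma scale_one [simp]: "x \<in> carrier V \<Longrightarrow> 1 \<odot> x = x"
  using smult_one[of x] by simp

lemma scale_zero_left [simp]: "x \<in> carrier V \<Longrightarrow> 0 \<odot> x = \<zero>"
  using smult_l_null[of x] by simp

lemma scale_zero_right [simp]: "c \<odot> \<zero> = \<zero>"
  using smult_r_null[of c] by simp

lemma neg_eq_scale: "x \<in> carrier V \<Longrightarrow> \<ominus> x = (-1) \<odot> x"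
  using scale_add_left[of x "-1" 1] by (auto intro: minus_equality)

lemma neg_zero [simp]: "\<ominus> \<zero> = \<zero>"
  by (simp add: neg_eq_scale)

lemma scale_neg_left: "x \<in> carrier V \<Longrightarrow> (- c) \<odot> x = \<ominus> (c \<odot> x)"
  by (simp add: neg_eq_scale scale_scale)

lemma scale_neg_right: "x \<in> carrier V \<Longrightarrow> c \<odot> (\<ominus> x) = \<ominus> (c \<odot> x)"
  by (simp add: neg_eq_scale scale_scale)

lemma csub_iff: "csubspace W V \<longleftrightarrow> W \<subseteq> carrier V \<and> \<zero> \<in> W \<and> (\<forall>x\<in>W. \<forall>y\<in>W. x \<oplus> y \<in> W)
   \<and> (\<forall>c. \<forall>x\<in>W. c \<odot> x \<in> W)"
  unfolding VectorSpace.subspace_def LinearCombinations.submodule_def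
  using vectorspace_axioms module_axioms by auto

lemma csubI: "\<lbrakk>W \<subseteq> carrier V; \<zero> \<in> W; \<And>x y. x \<in> W \<Longrightarrow> y \<in> W \<Longrightarrow> x \<oplus> y \<in> W;
   \<And>c x. x \<in> W \<Longrightarrow> c \<odot> x \<in> W\<rbrakk> \<Longrightarrow> csubspace W V"
  by (auto simp: csub_iff)

lemma csub_carrier: "csubspace W V \<Longrightarrow> x \<in> W \<Longrightarrow> x \<in> carrier V"
  and csub_zero: "csubspace W V \<Longrightarrow> \<zero> \<in> W"
  and csub_add: "csubspace W V \<Longrightarrow> x \<in> W \<Longrightarrow> y \<in> W \<Longrightarrow> x \<oplus> y \<in> W"
  and csub_smult: "csubspace W V \<Longrightarrow> x \<in> W \<Longrightarrow> c \<odot> x \<in> W"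
  by (auto simp: csub_iff)

lemma csub_neg: "csubspace W V \<Longrightarrow> x \<in> W \<Longrightarrow> \<ominus> x \<in> W"
  using csub_smult[of W x "-1"] csub_carrier neg_eq_scale by auto

lemma csub_minus: "csubspace W V \<Longrightarrow> x \<in> W \<Longrightarrow> y \<in> W \<Longrightarrow> x \<ominus> y \<in> W"
  by (simp add: a_minus_def csub_neg csub_add csub_carrier)

lemma csub_self: "csubspace (carrier V) V"
  by (rule csubI) auto

lemma csub_Int: "csubspace W V \<Longrightarrow> csubspace U V \<Longrightarrow> csubspace (W \<inter> U) V"
  by (auto simp: csub_iff)

lemma csub_zero_space: "csubspace {\<zero>} V"
  by (rule csubI) auto

lemma span_sub: "S \<subseteq> carrier V \<Longrightarrow> csubspace (span S) V"
  by (rule span_is_subspace)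

lemma span_least: "csubspace W V \<Longrightarrow> S \<subseteq> W \<Longrightarrow> span S \<subseteq> W"
  by (rule span_is_subset) (auto simp: VectorSpace.subspace_def)

lemma span_superset: "S \<subseteq> carrier V \<Longrightarrow> x \<in> S \<Longrightarrow> x \<in> span S"
  using in_own_span by auto

lemma span_in_carrier: "S \<subseteq> carrier V \<Longrightarrow> x \<in> span S \<Longrightarrow> x \<in> carrier V"
  using span_is_subset2 by auto

lemma span_least_mem: "csubspace W V \<Longrightarrow> S \<subseteq> W \<Longrightarrow> x \<in> span S \<Longrightarrow> x \<in> W"
  using span_least by auto

lemma minus_add_cancel: "x \<in> carrier V \<Longrightarrow> y \<in> carrier V \<Longrightarrow> (x \<ominus> y) \<oplus> y = x"
  by (simp add: a_minus_def a_assoc l_neg)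

lemma add_minus_cancel: "x \<in> carrier V \<Longrightarrow> y \<in> carrier V \<Longrightarrow> (x \<oplus> y) \<ominus> y = x"
  by (simp add: a_minus_def a_assoc r_neg)

lemma minus_add_cancel_left: "x \<in> carrier V \<Longrightarrow> y \<in> carrier V \<Longrightarrow> y \<oplus> (x \<ominus> y) = x"
  using minus_add_cancel[of x y] by (simp add: a_comm)

lemma minus_add_add:
  assumes "x \<in> carrier V" "y \<in> carrier V" "w \<in> carrier V"
  shows "(x \<oplus> w) \<ominus> (y \<oplus> w) = x \<ominus> y"
proof -
  have "(x \<oplus> w) \<ominus> (y \<oplus> w) = (x \<ominus> y) \<oplus> (w \<oplus> \<ominus> w)"
    using assms by (simp only: a_minus_def minus_add a_ac a_closed a_inv_closed)
  then show ?thesis using assms by (simp add: r_neg)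
qed

lemma zero_in: "\<zero> \<in> carrier V"
  by simp

lemma minus_zero_right: "x \<in> carrier V \<Longrightarrow> x \<ominus> \<zero> = x"
  using add_minus_cancel[of x "\<zero>"] by simp

lemma eq_of_minus_zero: "x \<in> carrier V \<Longrightarrow> y \<in> carrier V \<Longrightarrow> x \<ominus> y = \<zero> \<Longrightarrow> x = y"
  using minus_add_cancel[of x y] by simp

lemma span_insert_subspace:
  assumes "csubspace J V" "b \<in> carrier V" "x \<in> span (insert b J)"
  obtains c j where "j \<in> J" "x = c \<odot> b \<oplus> j"
proof -
  let ?S = "{c \<odot> b \<oplus> j |c j. j \<in> J}"
  note [simp] = csub_carrier[OF assms(1)]
  have "csubspace ?S V"
  proof (rule csubI)
    show "?S \<subseteq> carrier V" using assms by auto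
    show "\<zero> \<in> ?S" using assms csub_zero[OF assms(1)]
      by (auto intro!: exI[of _ 0] exI[of _ "\<zero>"])
  next
    fix x y assume "x \<in> ?S" "y \<in> ?S"
    then obtain c j d k where "x = c \<odot> b \<oplus> j" "j \<in> J" "y = d \<odot> b \<oplus> k" "k \<in> J" by auto
    moreover from this have "x \<oplus> y = (c + d) \<odot> b \<oplus> (j \<oplus> k)" using assms(2)
      by (simp add: scale_add_left a_ac)
    ultimately show "x \<oplus> y \<in> ?S" using csub_add[OF assms(1)] by blast
  next
    fix c x assume "x \<in> ?S"
    then obtain d j where "x = d \<odot> b \<oplus> j" "j \<in> J" by auto
    moreover from this have "c \<odot> x = (c * d) \<odot> b \<oplus> c \<odot> j" using assms(2)
      by (simp add: scale_add_right scale_scale)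
    ultimately show "c \<odot> x \<in> ?S" using csub_smult[OF assms(1)] by blast
  qed
  moreover have "insert b J \<subseteq> ?S"
  proof
    fix x assume "x \<in> insert b J"
    then have "x = 1 \<odot> b \<oplus> \<zero> \<and> x = b \<or> x = 0 \<odot> b \<oplus> x \<and> x \<in> J" using assms(2) by auto
    then show "x \<in> ?S" using csub_zero[OF assms(1)] by blast
  qed
  ultimately have "x \<in> ?S" using span_least_mem assms(3) by blast
  then show ?thesis using that by auto
qed

text \<open>W / (W \<inter> J) embeds in V / J, here without forming quotients. The induction
  absorbs b into J, which is why J varies; since span(b, J) / J is at most a line, passing back from
  span(b, J) to J costs at most one further vector w of W.\<close>

lemma finite_relative_span:
  assumes "finite B" "B \<subseteq> carrier V" "csubspace J V" "csubspace W V" "W \<subseteq> span (B \<union> J)"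
  shows "\<exists>B'. finite B' \<and> B' \<subseteq> W \<and> W \<subseteq> span (B' \<union> (W \<inter> J))"
  using assms
proof (induction B arbitrary: J rule: finite_induct)
  case empty
  then have "W \<subseteq> J" using span_least[of J J] by auto
  then have "W \<inter> J = W" by auto
  then show ?case using in_own_span[of W] empty csub_carrier by (intro exI[of _ "{}"]) auto
next
  case (insert b B)
  let ?J = "span (insert b J)"
  have c: "insert b J \<subseteq> carrier V" using insert csub_carrier by auto
  have bV: "b \<in> carrier V" and BV: "B \<subseteq> carrier V" using insert by auto
  have J': "csubspace ?J V" using c by (rule span_sub)
  have JJ: "insert b J \<subseteq> ?J" using c by (rule in_own_span)
  have c2: "B \<union> ?J \<subseteq> carrier V" using BV span_in_carrier[OF c] by auto
  have "insert b B \<union> J \<subseteq> span (B \<union> ?J)" using JJ in_own_span[OF c2] by auto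
  then have "W \<subseteq> span (B \<union> ?J)" using span_least[OF span_sub[OF c2]] insert.prems by blast
  then obtain B' where B': "finite B'" "B' \<subseteq> W" "W \<subseteq> span (B' \<union> (W \<inter> ?J))"
    using insert.IH[OF BV J'] insert.prems by auto
  have WV: "W \<subseteq> carrier V" using insert csub_carrier by auto
  show ?case
  proof (cases "W \<inter> ?J \<subseteq> J")
    case True
    then have "W \<inter> ?J = W \<inter> J" using JJ by auto
    then show ?thesis using B' by auto
  next
    case False
    then obtain w where w: "w \<in> W" "w \<in> ?J" "w \<notin> J" by auto
    obtain c j where cj: "j \<in> J" "w = c \<odot> b \<oplus> j"
      using span_insert_subspace[OF insert.prems(2) bV w(2)] by blast
    have jV: "j \<in> carrier V" using cj insert.prems csub_carrier by auto
    have "c \<noteq> 0" using cj w bV jV by auto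
    let ?B = "insert w B'"
    have c3: "?B \<union> (W \<inter> J) \<subseteq> carrier V" using w B' WV by auto
    note sp = span_sub[OF c3]
    have "x \<in> span (?B \<union> (W \<inter> J))" if x: "x \<in> W" "x \<in> ?J" for x
    proof -
      obtain d k where dk: "k \<in> J" "x = d \<odot> b \<oplus> k"
        using span_insert_subspace[OF insert.prems(2) bV x(2)] by blast
      have kV: "k \<in> carrier V" using dk insert.prems csub_carrier by auto
      \<comment> \<open>The factor d / c cancels the b-component of x against that of w, so y lies
        in both W and J. That c is nonzero comes from w being outside J.\<close>
      define y where "y = x \<oplus> (- (d / c)) \<odot> w"
      have wV: "w \<in> carrier V" and xV: "x \<in> carrier V" using x w WV by auto
      have "y = (d + - (d / c) * c) \<odot> b \<oplus> (k \<oplus> (- (d / c)) \<odot> j)"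
        using bV jV kV unfolding y_def cj dk(2) scale_add_left[OF bV] by (simp add: scale_add_right scale_scale a_ac)
      also have "\<dots> \<in> J" using \<open>c \<noteq> 0\<close> dk cj bV jV kV insert.prems csub_add csub_smult by simp
      finally have "y \<in> J" .
      moreover have "y \<in> W" unfolding y_def using x w insert.prems csub_add csub_smult by simp
      ultimately have y: "y \<in> span (?B \<union> (W \<inter> J))" using span_superset[OF c3] by auto
      have "w \<in> span (?B \<union> (W \<inter> J))" using span_superset[OF c3] by auto
      from csub_add[OF sp y csub_smult[OF sp this, of "d / c"]]
      have "y \<oplus> (d / c) \<odot> w \<in> span (?B \<union> (W \<inter> J))" .
      moreover have "y \<oplus> (d / c) \<odot> w = x"
        using wV xV scale_add_left[OF wV, of "- (d / c)" "d / c"] by (simp add: y_def a_assoc)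
      ultimately show ?thesis by simp
    qed
    then have "B' \<union> (W \<inter> ?J) \<subseteq> span (?B \<union> (W \<inter> J))" using span_superset[OF c3] by auto
    then have "W \<subseteq> span (?B \<union> (W \<inter> J))" using B'(3) span_least[OF sp] by blast
    then show ?thesis using B' w by (intro exI[of _ ?B]) auto
  qed
qed

text \<open>The case J = 0 of the relative statement.\<close>

lemma finite_span_subspace:
  assumes "finite B" "B \<subseteq> carrier V" "csubspace W V" "W \<subseteq> span B"
  shows "\<exists>B'. finite B' \<and> B' \<subseteq> W \<and> W = span B'"
proof -
  have "B \<union> {\<zero>} \<subseteq> carrier V" using assms by auto
  then have "W \<subseteq> span (B \<union> {\<zero>})"
    using assms span_least[OF span_sub] in_own_span by (meson order_trans Un_subset_iff)
  from finite_relative_span[OF assms(1,2) csub_zero_space assms(3) this]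
  obtain B' where B': "finite B'" "B' \<subseteq> W" "W \<subseteq> span (B' \<union> (W \<inter> {\<zero>}))" by auto
  have c: "B' \<subseteq> carrier V" using B' assms csub_carrier by auto
  have "B' \<union> (W \<inter> {\<zero>}) \<subseteq> span B'"
    using span_superset[OF c] csub_zero[OF span_sub[OF c]] by auto
  then have "span (B' \<union> (W \<inter> {\<zero>})) \<subseteq> span B'"
    by (rule span_least[OF span_sub[OF c]])
  then show ?thesis using B' span_least[OF assms(3) B'(2)] by (intro exI[of _ B']) auto
qed

text \<open>\<open>cfin_dim\<close> of a subspace asks for a finite spanning set inside it, whereas
  the dimension count produces one in the ambient module; this lemma bridges the two.\<close>

lemma cfin_dim_subspaceI:
  assumes "finite B" "B \<subseteq> carrier V" "csubspace W V" "W \<subseteq> span B"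
  shows "cfin_dim (V\<lparr>carrier := W\<rparr>)"
proof -
  obtain B' where B': "finite B'" "B' \<subseteq> W" "W = span B'"
    using finite_span_subspace[OF assms] by auto
  interpret W: vectorspace "class_ring :: complex ring" "V\<lparr>carrier := W\<rparr>"
    using assms(3) by (rule subspace_is_vs)
  have "W.span B' = W" using B' span_li_not_depend(1)[of B' W] assms(3) by (simp add: VectorSpace.subspace_def)
  then show ?thesis unfolding W.fin_dim_def using B' by auto
qed

lemma cfin_dimE:
  assumes "cfin_dim V"
  obtains B where "finite B" "B \<subseteq> carrier V" "span B = carrier V"
  using assms unfolding fin_dim_def by auto

end

lemma cspaceI: "cvectorspace V \<Longrightarrow> cspace V"
  by (simp add: cspace_def)

lemma cspace_vs: "cspace V \<Longrightarrow> cvectorspace V"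
  by (simp add: cspace_def)

text \<open>No clause for negatives: distributivity makes \<open>(-1) \<odot> x\<close> a negative
  of x.\<close>

lemma cspace_intro:
  fixes V (structure)
  assumes "\<And>x y. \<lbrakk>x \<in> carrier V; y \<in> carrier V\<rbrakk> \<Longrightarrow> x \<oplus> y \<in> carrier V"
    and "\<zero> \<in> carrier V"
    and "\<And>x y z. \<lbrakk>x \<in> carrier V; y \<in> carrier V; z \<in> carrier V\<rbrakk> \<Longrightarrow> (x \<oplus> y) \<oplus> z = x \<oplus> (y \<oplus> z)"
    and "\<And>x y. \<lbrakk>x \<in> carrier V; y \<in> carrier V\<rbrakk> \<Longrightarrow> x \<oplus> y = y \<oplus> x"
    and "\<And>x. x \<in> carrier V \<Longrightarrow> \<zero> \<oplus> x = x"
    and "\<And>c x. x \<in> carrier V \<Longrightarrow> c \<odot> x \<in> carrier V"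
    and "\<And>a b x. x \<in> carrier V \<Longrightarrow> (a + b) \<odot> x = a \<odot> x \<oplus> b \<odot> x"
    and "\<And>c x y. \<lbrakk>x \<in> carrier V; y \<in> carrier V\<rbrakk> \<Longrightarrow> c \<odot> (x \<oplus> y) = c \<odot> x \<oplus> c \<odot> y"
    and "\<And>a b x. x \<in> carrier V \<Longrightarrow> (a * b) \<odot> x = a \<odot> (b \<odot> x)"
    and "\<And>x. x \<in> carrier V \<Longrightarrow> 1 \<odot> x = x"
    and "\<And>x. x \<in> carrier V \<Longrightarrow> 0 \<odot> x = \<zero>"
  shows "cspace V"
proof -
  have neg: "\<exists>y\<in>carrier V. y \<oplus> x = \<zero>" if "x \<in> carrier V" for x
    using assms(7)[of x "-1" 1] assms(6,10,11) that by (intro bexI[of _ "(-1) \<odot> x"]) auto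
  have "abelian_group V"
    using assms neg by (intro abelian_groupI) auto
  then have "Module.module (class_ring :: complex ring) V"
    using assms by (intro moduleI class_cring.is_cring) auto
  then show ?thesis
    by (simp add: cspace_def vectorspace_def class_field)
qed

section \<open>Linear maps between complex vector spaces\<close>

lemma module_homI:
  fixes V W
  assumes "\<And>x. x \<in> carrier V \<Longrightarrow> f x \<in> carrier W"
    and "\<And>x y. \<lbrakk>x \<in> carrier V; y \<in> carrier V\<rbrakk> \<Longrightarrow> f (x \<oplus>\<^bsub>V\<^esub> y) = f x \<oplus>\<^bsub>W\<^esub> f y"
    and "\<And>c x. x \<in> carrier V \<Longrightarrow> f (c \<odot>\<^bsub>V\<^esub> x) = c \<odot>\<^bsub>W\<^esub> f x"
  shows "f \<in> LinearCombinations.module_hom (class_ring :: complex ring) V W"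
  using assms by (auto simp: LinearCombinations.module_hom_def)

locale clinear = V: cspace V + W: cspace W
  for V :: "(complex, 'v, 'm) module_scheme" and W :: "(complex, 'w, 'n) module_scheme" +
  fixes f
  assumes hom: "f \<in> LinearCombinations.module_hom (class_ring :: complex ring) V W"
begin

lemma closed: "x \<in> carrier V \<Longrightarrow> f x \<in> carrier W"
  and add: "\<lbrakk>x \<in> carrier V; y \<in> carrier V\<rbrakk> \<Longrightarrow> f (x \<oplus>\<^bsub>V\<^esub> y) = f x \<oplus>\<^bsub>W\<^esub> f y"
  and smult: "x \<in> carrier V \<Longrightarrow> f (c \<odot>\<^bsub>V\<^esub> x) = c \<odot>\<^bsub>W\<^esub> f x"
  using hom by (auto simp: LinearCombinations.module_hom_def)

lemma zero: "f \<zero>\<^bsub>V\<^esub> = \<zero>\<^bsub>W\<^esub>"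
  using smult[of "\<zero>\<^bsub>V\<^esub>" 0] closed by simp

lemma neg: "x \<in> carrier V \<Longrightarrow> f (\<ominus>\<^bsub>V\<^esub> x) = \<ominus>\<^bsub>W\<^esub> f x"
  by (simp add: V.neg_eq_scale W.neg_eq_scale smult closed)

lemma vimage_sub: "csubspace S W \<Longrightarrow> csubspace {x \<in> carrier V. f x \<in> S} V"
  by (rule V.csubI) (auto simp: add smult zero W.csub_zero W.csub_add W.csub_smult)

lemma image_sub: "csubspace S V \<Longrightarrow> csubspace (f ` S) W"
proof (rule W.csubI)
  assume S: "csubspace S V"
  note c = V.csub_carrier[OF S]
  show "f ` S \<subseteq> carrier W" using c closed by blast
  show "\<zero>\<^bsub>W\<^esub> \<in> f ` S" using V.csub_zero[OF S] zero by force
  show "x \<oplus>\<^bsub>W\<^esub> y \<in> f ` S" if "x \<in> f ` S" "y \<in> f ` S" for x y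
    using that V.csub_add[OF S] by (force simp: c simp flip: add)
  show "a \<odot>\<^bsub>W\<^esub> x \<in> f ` S" if "x \<in> f ` S" for a x
    using that V.csub_smult[OF S] by (force simp: c simp flip: smult)
qed

lemma span_vimage:
  assumes "csubspace S W" "B \<subseteq> carrier V" "\<And>b. b \<in> B \<Longrightarrow> f b \<in> S" "x \<in> V.span B"
  shows "f x \<in> S"
  using V.span_least_mem[OF vimage_sub[OF assms(1)], of B x] assms by auto

lemma eq_on_span:
  assumes "clinear V W f'" "B \<subseteq> carrier V" "\<And>b. b \<in> B \<Longrightarrow> f b = f' b" "x \<in> V.span B"
  shows "f x = f' x"
proof -
  interpret f': clinear V W f' by fact
  have "csubspace {x \<in> carrier V. f x = f' x} V"
    by (rule V.csubI) (auto simp: add smult zero f'.add f'.smult f'.zero)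
  then show ?thesis using V.span_least_mem[of "{x \<in> carrier V. f x = f' x}" B x] assms by auto
qed

end

lemma clinearI:
  assumes "cspace V" "cspace W" "\<And>x. x \<in> carrier V \<Longrightarrow> f x \<in> carrier W"
    and "\<And>x y. \<lbrakk>x \<in> carrier V; y \<in> carrier V\<rbrakk> \<Longrightarrow> f (x \<oplus>\<^bsub>V\<^esub> y) = f x \<oplus>\<^bsub>W\<^esub> f y"
    and "\<And>c x. x \<in> carrier V \<Longrightarrow> f (c \<odot>\<^bsub>V\<^esub> x) = c \<odot>\<^bsub>W\<^esub> f x"
  shows "clinear V W f"
  using assms by (simp add: clinear_def clinear_axioms_def module_homI)

context cspace
begin

lemma span_induct_closure:
  assumes "x \<in> span B" "B \<subseteq> carrier V" "\<And>b. b \<in> B \<Longrightarrow> P b" "P \<zero>"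
    "\<And>x y. \<lbrakk>x \<in> carrier V; y \<in> carrier V; P x; P y\<rbrakk> \<Longrightarrow> P (x \<oplus> y)"
    "\<And>c x. \<lbrakk>x \<in> carrier V; P x\<rbrakk> \<Longrightarrow> P (c \<odot> x)"
  shows "P x"
proof -
  have "csubspace {x \<in> carrier V. P x} V" by (rule csubI) (use assms in auto)
  then show ?thesis using span_least_mem[of "{x \<in> carrier V. P x}" B x] assms by auto
qed

section \<open>Quotient spaces\<close>

lemma csub_abelian_subgroup: "csubspace W V \<Longrightarrow> abelian_subgroup W V"
proof (rule abelian_subgroupI3)
  assume W: "csubspace W V"
  show "additive_subgroup W V"
    by (rule additive_subgroupI, rule add.subgroupI)
       (use W csub_carrier csub_zero csub_neg csub_add in \<open>auto simp: a_inv_def[symmetric]\<close>)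
qed (rule abelian_group_axioms)

context
  fixes W assumes W: "csubspace W V"
begin

interpretation abelian_subgroup W V using W by (rule csub_abelian_subgroup)

lemma coset_mem: "y \<in> W +> x \<longleftrightarrow> (\<exists>w\<in>W. y = w \<oplus> x)"
  by (auto simp: a_r_coset_def')

lemma coset_eq_iff: "\<lbrakk>x \<in> carrier V; y \<in> carrier V\<rbrakk> \<Longrightarrow> W +> x = W +> y \<longleftrightarrow> x \<ominus> y \<in> W"
proof
  assume *: "x \<in> carrier V" "y \<in> carrier V"
  { assume "W +> x = W +> y"
    then have "x \<in> W +> y" using * a_rcos_self by auto
    then obtain w where "w \<in> W" "x = w \<oplus> y" by (auto simp: coset_mem)
    then show "x \<ominus> y \<in> W" using * by (simp add: add_minus_cancel) }
  { assume "x \<ominus> y \<in> W"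
    then have "x \<in> W +> y" using * minus_add_cancel by (force simp: coset_mem)
    then show "W +> x = W +> y" using * a_repr_independence a_subgroup by metis }
qed

lemma coset_zero: "W +> \<zero> = W"
  using a_subset by simp

lemma coset_eq_self_iff: "x \<in> carrier V \<Longrightarrow> W +> x = W \<longleftrightarrow> x \<in> W"
  using coset_eq_iff[of x "\<zero>"] coset_zero zero_in minus_zero_right[of x] by simp

lemma induced_map_coset:
  assumes "x \<in> carrier V" "\<And>x. x \<in> carrier V \<Longrightarrow> f x \<in> carrier V"
    "\<And>x y. \<lbrakk>x \<in> carrier V; y \<in> carrier V\<rbrakk> \<Longrightarrow> f (x \<oplus> y) = f x \<oplus> f y" "\<And>w. w \<in> W \<Longrightarrow> f w \<in> W"
  shows "induced_map V W f (W +> x) = W +> f x"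
proof -
  have f0: "f \<zero> = \<zero>" using assms(2)[of "\<zero>"] assms(3)[of "\<zero>" "\<zero>"]
    by (metis add.r_cancel_one' l_zero zero_in)
  have im: "z \<in> induced_map V W f (W +> x) \<longleftrightarrow> (\<exists>w\<in>W. \<exists>w'\<in>W. z = w \<oplus> f (w' \<oplus> x))" for z
    unfolding induced_map_def set_add_def' by (auto simp: coset_mem Bex_def)
  have f_add: "f (w' \<oplus> x) = f w' \<oplus> f x" if "w' \<in> W" for w'
    using assms that a_Hcarr by simp
  show ?thesis
  proof (intro equalityI subsetI)
    fix z assume "z \<in> induced_map V W f (W +> x)"
    then obtain w w' where "z = (w \<oplus> f w') \<oplus> f x" "w \<in> W" "w' \<in> W"
      using assms a_Hcarr f_add unfolding im by (metis a_assoc)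
    then show "z \<in> W +> f x" unfolding coset_mem using assms csub_add[OF W] by blast
  next
    fix z assume "z \<in> W +> f x"
    then obtain w where "z = w \<oplus> f (\<zero> \<oplus> x)" "w \<in> W" using assms by (auto simp: coset_mem)
    then show "z \<in> induced_map V W f (W +> x)"
      unfolding im using csub_zero[OF W] by blast
  qed
qed

lemma quot_carrier: "carrier (quot_space V W) = (\<lambda>x. W +> x) ` carrier V"
  by (auto simp: quot_space_def ring.extend_def FactRing_def A_RCOSETS_def')

lemma quot_in: "x \<in> carrier V \<Longrightarrow> W +> x \<in> carrier (quot_space V W)"
  by (simp add: quot_carrier)

lemma quot_add: "\<lbrakk>x \<in> carrier V; y \<in> carrier V\<rbrakk>
    \<Longrightarrow> (W +> x) \<oplus>\<^bsub>quot_space V W\<^esub> (W +> y) = W +> (x \<oplus> y)"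
  using a_rcos_sum by (simp add: quot_space_def ring.extend_def FactRing_def)

lemma quot_zero: "\<zero>\<^bsub>quot_space V W\<^esub> = W"
  by (simp add: quot_space_def ring.extend_def FactRing_def)

lemma quot_smult: "x \<in> carrier V \<Longrightarrow> c \<odot>\<^bsub>quot_space V W\<^esub> (W +> x) = W +> (c \<odot> x)"
  using induced_map_coset[of x "\<lambda>x. c \<odot> x"] csub_smult[OF W]
  by (simp add: quot_space_def ring.extend_def module.fields_def scale_add_right)

lemma quot_cspace: "cspace (quot_space V W)"
proof (rule cspace_intro)
  show "\<zero>\<^bsub>quot_space V W\<^esub> \<in> carrier (quot_space V W)"
    using quot_in[OF zero_in] coset_zero quot_zero by simp
  show "\<zero>\<^bsub>quot_space V W\<^esub> \<oplus>\<^bsub>quot_space V W\<^esub> x = x" if "x \<in> carrier (quot_space V W)" for x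
    using that quot_add[OF zero_in] by (auto simp: quot_carrier quot_zero coset_zero)
qed (auto simp: quot_carrier quot_add quot_smult quot_zero coset_zero scale_add_left scale_add_right scale_scale a_ac)

lemma quot_clinear: "clinear V (quot_space V W) (\<lambda>x. W +> x)"
  by (rule clinearI) (auto simp: quot_cspace quot_in quot_add quot_smult cspace_axioms)

text \<open>F has to be linear only modulo W. Typical F send an element to a formal generator of a
  free space, as in the maps x to x \<otimes> y and L to U(L), and W contains the defining
  relations.\<close>

lemma quot_clinearI:
  assumes X: "cspace X" and F: "\<And>x. x \<in> carrier X \<Longrightarrow> F x \<in> carrier V"
    and add: "\<And>x y. \<lbrakk>x \<in> carrier X; y \<in> carrier X\<rbrakk> \<Longrightarrow> F (x \<oplus>\<^bsub>X\<^esub> y) \<ominus> (F x \<oplus> F y) \<in> W"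
    and smult: "\<And>c x. x \<in> carrier X \<Longrightarrow> F (c \<odot>\<^bsub>X\<^esub> x) \<ominus> c \<odot> F x \<in> W"
  shows "clinear X (quot_space V W) (\<lambda>x. W +> F x)"
proof (rule clinearI[OF X quot_cspace])
  interpret X: cspace X by (rule X)
  fix x y c assume x: "x \<in> carrier X"
  show "W +> F x \<in> carrier (quot_space V W)" by (rule quot_in[OF F[OF x]])
  show "W +> F (x \<oplus>\<^bsub>X\<^esub> y) = (W +> F x) \<oplus>\<^bsub>quot_space V W\<^esub> (W +> F y)" if y: "y \<in> carrier X"
    using coset_eq_iff[of "F (x \<oplus>\<^bsub>X\<^esub> y)" "F x \<oplus> F y"] add[OF x y] F x y by (simp add: quot_add)
  show "W +> F (c \<odot>\<^bsub>X\<^esub> x) = c \<odot>\<^bsub>quot_space V W\<^esub> (W +> F x)"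
    using coset_eq_iff[of "F (c \<odot>\<^bsub>X\<^esub> x)" "c \<odot> F x"] smult[OF x] F x by (simp add: quot_smult)
qed

lemma induced_map_clinear:
  assumes f: "clinear V V f" and W': "\<And>w. w \<in> W \<Longrightarrow> f w \<in> W"
  shows "clinear (quot_space V W) (quot_space V W) (induced_map V W f)"
proof -
  interpret f: clinear V V f by (rule f)
  have co: "induced_map V W f (W +> x) = W +> f x" if "x \<in> carrier V" for x
    by (rule induced_map_coset[OF that f.closed f.add W'])
  show ?thesis
    by (rule clinearI[OF quot_cspace quot_cspace])
      (auto simp: quot_carrier quot_add quot_smult co f.closed f.add f.smult)
qed

lemma quot_cases: assumes "X \<in> carrier (quot_space V W)"
  obtains x where "x \<in> carrier V" "X = W +> x"
  using assms by (auto simp: quot_carrier)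

text \<open>Representatives of a finite spanning set of V / W span V together with W. Cofiniteness
  is used in this form from here on.\<close>

lemma cofinite_subspace:
  assumes "cfin_dim (quot_space V W)"
  obtains B where "finite B" "B \<subseteq> carrier V" "span (B \<union> W) = carrier V"
proof -
  interpret Q: cspace "quot_space V W" by (rule quot_cspace)
  interpret q: clinear V "quot_space V W" "\<lambda>x. W +> x" by (rule quot_clinear)
  obtain X where X: "finite X" "X \<subseteq> carrier (quot_space V W)" "Q.span X = carrier (quot_space V W)"
    using Q.cfin_dimE[OF assms] by auto
  then obtain B where B: "B \<subseteq> carrier V" "finite B" "X = (\<lambda>x. W +> x) ` B"
    by (metis finite_subset_image quot_carrier)
  have c: "B \<union> W \<subseteq> carrier V" using B W csub_carrier by auto
  let ?S = "span (B \<union> W)"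
  have S: "csubspace ?S V" using c by (rule span_sub)
  have WS: "W \<subseteq> ?S" using span_superset[OF c] by auto
  have "X \<subseteq> (\<lambda>x. W +> x) ` ?S" using B span_superset[OF c] by auto
  then have "Q.span X \<subseteq> (\<lambda>x. W +> x) ` ?S" by (rule Q.span_least[OF q.image_sub[OF S]])
  then have "x \<in> ?S" if x: "x \<in> carrier V" for x
  proof -
    have "W +> x \<in> (\<lambda>x. W +> x) ` ?S" using X quot_in[OF x] \<open>Q.span X \<subseteq> _\<close> by auto
    then obtain y where y: "y \<in> ?S" "W +> x = W +> y" by auto
    then have yV: "y \<in> carrier V" using csub_carrier[OF S] by auto
    then have "x \<ominus> y \<in> ?S" using y x coset_eq_iff WS by auto
    then show ?thesis using csub_add[OF S _ y(1)] minus_add_cancel[OF x yV] by metis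
  qed
  then show ?thesis using that[of B] B csub_carrier[OF S] by auto
qed

end

end

lemma clinear_comp:
  assumes "clinear V W f" "clinear U V g"
  shows "clinear U W (\<lambda>x. f (g x))"
proof -
  interpret f: clinear V W f by fact
  interpret g: clinear U V g by fact
  show ?thesis
    by (rule clinearI) (auto simp: f.add g.add f.smult g.smult f.closed g.closed
      f.W.cspace_axioms g.V.cspace_axioms)
qed

lemma (in cspace) clinear_id: "clinear V V (\<lambda>x. x)"
  by (rule clinearI) (auto simp: cspace_axioms)

lemma (in cspace) clinear_lincomb:
  assumes "clinear U V f" "clinear U V g"
  shows "clinear U V (\<lambda>x. a \<odot> f x \<oplus> b \<odot> g x)"
proof -
  interpret f: clinear U V f by fact
  interpret g: clinear U V g by fact
  show ?thesis
    by (rule clinearI) (auto simp: f.add g.add f.smult g.smult f.closed g.closed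
      f.V.cspace_axioms cspace_axioms scale_add_right scale_scale a_ac mult.commute)
qed

section \<open>Weight vectors\<close>

context cspace
begin

text \<open>A spanning vector whose weight differs from \<mu> at some x is killed by an affine
  function of \<open>D x\<close> that fixes all vectors of weight \<mu>; for sums such operators are
  composed. An operator obtained for m sends m into the desired span, and it fixes m. Different
  indices may share a weight.\<close>

lemma weight_decomposition:
  fixes U :: "'i \<Rightarrow> 'v set"
  assumes D: "\<And>x. x \<in> h \<Longrightarrow> clinear V V (D x)"
    and U: "\<And>i. i \<in> S \<Longrightarrow> U i \<subseteq> carrier V"
    and wt: "\<And>i x u. \<lbrakk>i \<in> S; x \<in> h; u \<in> U i\<rbrakk> \<Longrightarrow> D x u = wt i x \<odot> u"
    and m: "m \<in> span (\<Union>i\<in>S. U i)"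
    and \<mu>: "\<And>x. x \<in> h \<Longrightarrow> D x m = \<mu> x \<odot> m"
  shows "m \<in> span (\<Union>i\<in>{i \<in> S. \<forall>x\<in>h. wt i x = \<mu> x}. U i)"
proof -
  let ?U = "\<Union>i\<in>S. U i" and ?T = "span (\<Union>i\<in>{i \<in> S. \<forall>x\<in>h. wt i x = \<mu> x}. U i)"
  let ?ok = "\<lambda>P. clinear V V P \<and> (\<forall>w\<in>carrier V. (\<forall>x\<in>h. D x w = \<mu> x \<odot> w) \<longrightarrow> P w = w)
    \<and> (\<forall>i\<in>S. \<forall>u\<in>U i. \<exists>c. P u = c \<odot> u)"
  have UV: "?U \<subseteq> carrier V" and TV: "(\<Union>i\<in>{i \<in> S. \<forall>x\<in>h. wt i x = \<mu> x}. U i) \<subseteq> carrier V"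
    using U by auto
  note T = span_sub[OF TV]
  have id: "?ok (\<lambda>x. x)"
  proof (intro conjI ballI)
    fix i u assume "i \<in> S" "u \<in> U i"
    then have "u \<in> carrier V" using U by blast
    then have "u = 1 \<odot> u" by simp
    then show "\<exists>c. u = c \<odot> u" by blast
  qed (use clinear_id in auto)
  have T_stable: "P t \<in> ?T" if okP: "?ok P" and t: "t \<in> ?T" for P t
  proof -
    interpret P: clinear V V P using okP by auto
    show ?thesis
    proof (rule P.span_vimage[OF T TV _ t])
      fix u assume u: "u \<in> (\<Union>i\<in>{i \<in> S. \<forall>x\<in>h. wt i x = \<mu> x}. U i)"
      then obtain i where "i \<in> S" "u \<in> U i" by blast
      then obtain c where "P u = c \<odot> u" using okP by blast
      then show "P u \<in> ?T" using span_superset[OF TV u] csub_smult[OF T] by simp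
    qed
  qed
  have commute: "P (Q u) = Q (P u)" if P: "?ok P" and Q: "?ok Q" and u: "u \<in> span ?U" for P Q u
  proof -
    interpret P: clinear V V P using P by auto
    interpret Q: clinear V V Q using Q by auto
    interpret PQ: clinear V V "\<lambda>x. P (Q x)"
      by (rule clinear_comp) (rule P.clinear_axioms Q.clinear_axioms)+
    show ?thesis
    proof (rule PQ.eq_on_span[OF _ UV _ u])
      show "clinear V V (\<lambda>x. Q (P x))"
        by (rule clinear_comp) (rule P.clinear_axioms Q.clinear_axioms)+
      fix b assume "b \<in> ?U"
      then obtain i where i: "i \<in> S" "b \<in> U i" by blast
      obtain c where "P b = c \<odot> b" using P i by blast
      moreover obtain d where "Q b = d \<odot> b" using Q i by blast
      moreover have "b \<in> carrier V" using i U by blast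
      ultimately show "P (Q b) = Q (P b)" by (simp add: P.smult Q.smult scale_scale mult.commute)
    qed
  qed
  \<comment> \<open>Membership in \<open>span ?U\<close> is carried through the induction because
    \<open>commute\<close> holds only there.\<close>
  have "m \<in> span ?U \<and> (\<exists>P. ?ok P \<and> P m \<in> ?T)"
  proof (rule span_induct_closure[OF m UV])
    fix b assume b: "b \<in> ?U"
    then obtain i where i: "i \<in> S" "b \<in> U i" by auto
    have bV: "b \<in> carrier V" using b UV by auto
    show "b \<in> span ?U \<and> (\<exists>P. ?ok P \<and> P b \<in> ?T)"
    proof (intro conjI)
      show "\<exists>P. ?ok P \<and> P b \<in> ?T"
      proof (cases "\<forall>x\<in>h. wt i x = \<mu> x")
        case True
        then have "b \<in> ?T" using i by (intro span_superset[OF TV]) auto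
        then show ?thesis using id by blast
      next
        case False
        then obtain x where x: "x \<in> h" "wt i x \<noteq> \<mu> x" by auto
        \<comment> \<open>The operator is (D x - wt i x) / (\<mu> x - wt i x): it is 1 on weight
          \<mu> and 0 on b.\<close>
        define d where "d = inverse (\<mu> x - wt i x)"
        let ?P = "\<lambda>w. d \<odot> D x w \<oplus> (- d * wt i x) \<odot> w"
        interpret Dx: clinear V V "D x" using D x by auto
        have lin: "clinear V V ?P" by (rule clinear_lincomb[OF D[OF x(1)] clinear_id])
        have fix_mu: "?P w = w" if "w \<in> carrier V" "\<forall>x\<in>h. D x w = \<mu> x \<odot> w" for w
        proof -
          have "?P w = (d * \<mu> x + - d * wt i x) \<odot> w" 
            using that x scale_add_left[of w "d * \<mu> x" "- d * wt i x"] by (simp add: scale_scale)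
          also have "d * \<mu> x + - d * wt i x = d * (\<mu> x - wt i x)" by (simp add: algebra_simps)
          also have "\<dots> = 1" using x by (simp add: d_def)
          finally show ?thesis using that by simp
        qed
        have scal: "?P u = (d * wt j x + - d * wt i x) \<odot> u" if "j \<in> S" "u \<in> U j" for j u
        proof -
          have "u \<in> carrier V" using that U by auto
          then show ?thesis unfolding wt[OF that(1) x(1) that(2)]
            using scale_add_left[of u "d * wt j x" "- d * wt i x"] by (simp add: scale_scale)
        qed
        have "?P b = \<zero>" using scal[OF i] bV by simp
        then have "?P b \<in> ?T" using csub_zero[OF T] by simp
        then show ?thesis using lin fix_mu scal by (intro exI[of _ ?P]) blast
      qed
    qed (use span_superset[OF UV b] in auto)
  next
    show "\<zero> \<in> span ?U \<and> (\<exists>P. ?ok P \<and> P \<zero> \<in> ?T)"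
      using id csub_zero[OF T] csub_zero[OF span_sub[OF UV]] by blast
  next
    fix x y assume xy: "x \<in> carrier V" "y \<in> carrier V"
      "x \<in> span ?U \<and> (\<exists>P. ?ok P \<and> P x \<in> ?T)" "y \<in> span ?U \<and> (\<exists>P. ?ok P \<and> P y \<in> ?T)"
    then obtain P Q where P: "?ok P" "P x \<in> ?T" and Q: "?ok Q" "Q y \<in> ?T" by auto
    interpret P: clinear V V P using P by auto
    interpret Q: clinear V V Q using Q by auto
    let ?R = "\<lambda>x. P (Q x)"
    have R: "clinear V V ?R" by (rule clinear_comp) (rule P.clinear_axioms Q.clinear_axioms)+
    have "?R u = u" if "u \<in> carrier V" "\<forall>x\<in>h. D x u = \<mu> x \<odot> u" for u
      using P(1) Q(1) that by metis
    moreover have "\<exists>c. ?R u = c \<odot> u" if i: "i \<in> S" "u \<in> U i" for i u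
    proof -
      have "u \<in> carrier V" using i U by auto
      moreover obtain c where "P u = c \<odot> u" using P(1) i by blast
      moreover obtain d where "Q u = d \<odot> u" using Q(1) i by blast
      ultimately have "?R u = (d * c) \<odot> u" by (simp add: P.smult scale_scale)
      then show ?thesis by blast
    qed
    moreover have RT: "?R (x \<oplus> y) \<in> ?T"
    proof -
      have "?R (x \<oplus> y) = Q (P x) \<oplus> P (Q y)"
        using xy commute[OF P(1) Q(1)] by (simp add: P.add Q.add Q.closed)
      then show ?thesis
        using csub_add[OF T T_stable[OF Q(1) P(2)] T_stable[OF P(1) Q(2)]] by simp
    qed
    ultimately have "\<exists>P. ?ok P \<and> P (x \<oplus> y) \<in> ?T" using R by (intro exI[of _ ?R]) blast
    then show "x \<oplus> y \<in> span ?U \<and> (\<exists>P. ?ok P \<and> P (x \<oplus> y) \<in> ?T)"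
      using xy csub_add[OF span_sub[OF UV]] by blast
  next
    fix c x assume x: "x \<in> carrier V" "x \<in> span ?U \<and> (\<exists>P. ?ok P \<and> P x \<in> ?T)"
    then obtain P where P: "?ok P" "P x \<in> ?T" by auto
    interpret P: clinear V V P using P by auto
    have "P (c \<odot> x) \<in> ?T" using P x csub_smult[OF T] by (simp add: P.smult)
    then show "c \<odot> x \<in> span ?U \<and> (\<exists>P. ?ok P \<and> P (c \<odot> x) \<in> ?T)"
      using P x csub_smult[OF span_sub[OF UV]] by blast
  qed
  then obtain P where P: "?ok P" "P m \<in> ?T" by blast
  then have "P m = m" using \<mu> span_in_carrier[OF UV m] by blast
  then show ?thesis using P(2) by simp
qed

section \<open>Cofinite subspaces and their finite intersections\<close>

lemma cofinite_Int:
  assumes "csubspace I V" "csubspace J V"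
    and "finite B" "B \<subseteq> carrier V" "span (B \<union> I) = carrier V"
    and "finite C" "C \<subseteq> carrier V" "span (C \<union> J) = carrier V"
  shows "\<exists>E. finite E \<and> E \<subseteq> carrier V \<and> span (E \<union> (I \<inter> J)) = carrier V"
proof -
  have IV: "I \<subseteq> carrier V" using assms(1) csub_carrier by auto
  \<comment> \<open>I / (I \<inter> J) embeds in V / J, so I is finitely spanned over the
    intersection; V in turn is finitely spanned over I.\<close>
  obtain B' where B': "finite B'" "B' \<subseteq> I" "I \<subseteq> span (B' \<union> (I \<inter> J))"
    using finite_relative_span[OF assms(6,7) assms(2) assms(1)] assms(8) IV by auto
  have c: "(B \<union> B') \<union> (I \<inter> J) \<subseteq> carrier V" using B' IV assms by auto
  have c': "B' \<union> (I \<inter> J) \<subseteq> carrier V" using c by auto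
  have "span (B' \<union> (I \<inter> J)) \<subseteq> span ((B \<union> B') \<union> (I \<inter> J))"
    by (rule span_is_monotone) auto
  then have "B \<union> I \<subseteq> span ((B \<union> B') \<union> (I \<inter> J))"
    using B' span_superset[OF c] by auto
  then have "carrier V \<subseteq> span ((B \<union> B') \<union> (I \<inter> J))"
    using span_least[OF span_sub[OF c], of "B \<union> I"] assms(5) by simp
  then have "span ((B \<union> B') \<union> (I \<inter> J)) = carrier V" using span_is_subset2[OF c] by auto
  then show ?thesis using B' assms IV by (intro exI[of _ "B \<union> B'"]) auto
qed

text \<open>The comprehension over \<open>carrier V\<close> yields V for empty K, where an
  intersection over K would be the whole type.\<close>

lemma cofinite_INT:
  assumes "finite K"
    and "\<And>k. k \<in> K \<Longrightarrow> csubspace (J k) V"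
    and "\<And>k. k \<in> K \<Longrightarrow> \<exists>B. finite B \<and> B \<subseteq> carrier V \<and> span (B \<union> J k) = carrier V"
  shows "csubspace {a \<in> carrier V. \<forall>k\<in>K. a \<in> J k} V \<and>
    (\<exists>B. finite B \<and> B \<subseteq> carrier V \<and> span (B \<union> {a \<in> carrier V. \<forall>k\<in>K. a \<in> J k}) = carrier V)"
  using assms
proof (induction K rule: finite_induct)
  case empty
  have "span (carrier V) = carrier V"
    using span_is_subset2[of "carrier V"] in_own_span[of "carrier V"] by auto
  then have "finite {} \<and> {} \<subseteq> carrier V \<and> span ({} \<union> carrier V) = carrier V" by simp
  moreover have "{a \<in> carrier V. \<forall>k\<in>{}. a \<in> J k} = carrier V" by simp
  ultimately show ?case using csub_self by metis
next
  case (insert k K)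
  have eq: "{a \<in> carrier V. \<forall>k\<in>insert k K. a \<in> J k} = J k \<inter> {a \<in> carrier V. \<forall>k\<in>K. a \<in> J k}"
    using csub_carrier[OF insert.prems(1)[of k]] by auto
  have IH: "csubspace {a \<in> carrier V. \<forall>k\<in>K. a \<in> J k} V"
    "\<exists>B. finite B \<and> B \<subseteq> carrier V \<and> span (B \<union> {a \<in> carrier V. \<forall>k\<in>K. a \<in> J k}) = carrier V"
    using insert.IH insert.prems by auto
  have k: "csubspace (J k) V" "\<exists>B. finite B \<and> B \<subseteq> carrier V \<and> span (B \<union> J k) = carrier V"
    using insert.prems by auto
  show ?case unfolding eq
    using csub_Int[OF k(1) IH(1)] cofinite_Int[OF k(1) IH(1)] k(2) IH(2) by blast
qed

end

section \<open>Representations\<close>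

text \<open>\<open>act_bracket\<close> is the commutator identity in the form x y = y x + [x, y], in
  which operators are moved to the right through monomials.\<close>

locale lrep = L: cspace L + M: cspace M
  for L :: "('x, 'm) lie_alg_scheme" and M :: "('x, 'v, 'n) lie_rep_scheme" +
  assumes bracket_in: "\<lbrakk>x \<in> carrier L; y \<in> carrier L\<rbrakk> \<Longrightarrow> bracket L x y \<in> carrier L"
    and act_in: "\<lbrakk>x \<in> carrier L; m \<in> carrier M\<rbrakk> \<Longrightarrow> act M x m \<in> carrier M"
    and act_add: "\<lbrakk>x \<in> carrier L; m \<in> carrier M; n \<in> carrier M\<rbrakk>
      \<Longrightarrow> act M x (m \<oplus>\<^bsub>M\<^esub> n) = act M x m \<oplus>\<^bsub>M\<^esub> act M x n"
    and act_smult: "\<lbrakk>x \<in> carrier L; m \<in> carrier M\<rbrakk>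
      \<Longrightarrow> act M x (c \<odot>\<^bsub>M\<^esub> m) = c \<odot>\<^bsub>M\<^esub> act M x m"
    and act_add_left: "\<lbrakk>x \<in> carrier L; y \<in> carrier L; m \<in> carrier M\<rbrakk>
      \<Longrightarrow> act M (x \<oplus>\<^bsub>L\<^esub> y) m = act M x m \<oplus>\<^bsub>M\<^esub> act M y m"
    and act_smult_left: "\<lbrakk>x \<in> carrier L; m \<in> carrier M\<rbrakk>
      \<Longrightarrow> act M (c \<odot>\<^bsub>L\<^esub> x) m = c \<odot>\<^bsub>M\<^esub> act M x m"
    and act_bracket: "\<lbrakk>x \<in> carrier L; y \<in> carrier L; m \<in> carrier M\<rbrakk>
      \<Longrightarrow> act M x (act M y m) = act M y (act M x m) \<oplus>\<^bsub>M\<^esub> act M (bracket L x y) m"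
begin

lemma act_linear: "x \<in> carrier L \<Longrightarrow> clinear M M (act M x)"
  by (rule clinearI) (auto simp: M.cspace_axioms act_in act_add act_smult)

lemma act_linear_left: "m \<in> carrier M \<Longrightarrow> clinear L M (\<lambda>x. act M x m)"
  by (rule clinearI) (auto simp: L.cspace_axioms M.cspace_axioms act_in act_add_left act_smult_left)

lemma act_zero: "x \<in> carrier L \<Longrightarrow> act M x \<zero>\<^bsub>M\<^esub> = \<zero>\<^bsub>M\<^esub>"
  using clinear.zero[OF act_linear] .

end

section \<open>Weight spaces of a graded cyclic module\<close>

lemma finite_subset_mset: "finite {p. p \<subseteq># (n :: 'b multiset)}"
proof -
  have "finite {p. size p \<le> size n \<and> set_mset p \<subseteq> set_mset n}"
  proof -
    have "{p. size p \<le> size n \<and> set_mset p \<subseteq> set_mset n}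
      \<subseteq> mset ` {xs. set xs \<subseteq> set_mset n \<and> length xs \<le> size n}"
    proof
      fix p assume p: "p \<in> {p. size p \<le> size n \<and> set_mset p \<subseteq> set_mset n}"
      obtain xs where "p = mset xs" by (metis ex_mset)
      then show "p \<in> mset ` {xs. set xs \<subseteq> set_mset n \<and> length xs \<le> size n}" using p by auto
    qed
    then show ?thesis by (rule finite_subset) (simp add: finite_lists_length_le)
  qed
  then show ?thesis
    by (rule finite_subset[rotated]) (auto simp: size_mset_mono dest: set_mset_mono)
qed

text \<open>Intended reading: \<open>Gn n\<close> is the piece of N^- of degree -n,
  \<open>T x a\<close> is x \<otimes> a, B is the Borel subalgebra, \<open>J n\<close> the ideal
  attached to the degree n, and \<open>H\<close> embeds the Cartan subalgebra. Multisets as degrees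
  have finitely many parts and a size to induct on; \<open>Ix_add\<close> closes the degrees under
  sums and parts.\<close>

locale graded_cyclic = lrep L M + G: cspace G + A: cspace A
  for L :: "('x, 'm) lie_alg_scheme" and M :: "('x, 'v, 'n) lie_rep_scheme"
    and G :: "('g, 'k) lie_alg_scheme" and A :: "(complex, 'a, 'o) module_scheme" +
  fixes Ix :: "nat multiset set" and Gn :: "nat multiset \<Rightarrow> 'g set" and T :: "'g \<Rightarrow> 'a \<Rightarrow> 'x"
    and J :: "nat multiset \<Rightarrow> 'a set" and v :: 'v and B :: "'x set"
    and h :: "'h set" and H :: "'h \<Rightarrow> 'x" and lam :: "'h \<Rightarrow> complex"
    and wt :: "nat multiset \<Rightarrow> 'h \<Rightarrow> complex"
  assumes Ix_add: "m + n \<in> Ix \<longleftrightarrow> m \<in> Ix \<and> n \<in> Ix"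
    and Gn_fin: "n \<in> Ix \<Longrightarrow> \<exists>E. finite E \<and> E \<subseteq> Gn n \<and> Gn n \<subseteq> G.span E"
    and Gn_sub: "n \<in> Ix \<Longrightarrow> csubspace (Gn n) G"
    and T_in: "\<lbrakk>n \<in> Ix; x \<in> Gn n; a \<in> carrier A\<rbrakk> \<Longrightarrow> T x a \<in> carrier L"
    and T_left: "\<lbrakk>n \<in> Ix; a \<in> carrier A\<rbrakk> \<Longrightarrow> clinear (G\<lparr>carrier := Gn n\<rparr>) L (\<lambda>x. T x a)"
    and T_right: "\<lbrakk>n \<in> Ix; x \<in> Gn n\<rbrakk> \<Longrightarrow> clinear A L (T x)"
    and A_mult: "\<lbrakk>a \<in> carrier A; b \<in> carrier A\<rbrakk> \<Longrightarrow> a \<otimes>\<^bsub>A\<^esub> b \<in> carrier A"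
    and T_bracket: "\<lbrakk>m \<in> Ix; n \<in> Ix; x \<in> Gn m; y \<in> Gn n; a \<in> carrier A; b \<in> carrier A\<rbrakk>
      \<Longrightarrow> \<exists>z\<in>Gn (m + n). bracket L (T x a) (T y b) = T z (a \<otimes>\<^bsub>A\<^esub> b)"
    and v_in: "v \<in> carrier M"
    and cyclic: "\<lbrakk>csubspace N M; v \<in> N; \<And>x m. x \<in> carrier L \<Longrightarrow> m \<in> N \<Longrightarrow> act M x m \<in> N\<rbrakk>
      \<Longrightarrow> carrier M \<subseteq> N"
    and B_carrier: "B \<subseteq> carrier L"
    and L_span: "carrier L \<subseteq> L.span (B \<union> {T x a |x a n. n \<in> Ix - {{#}} \<and> x \<in> Gn n \<and> a \<in> carrier A})"
    and B_v: "z \<in> B \<Longrightarrow> \<exists>c. act M z v = c \<odot>\<^bsub>M\<^esub> v"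
    and J_sub: "n \<in> Ix - {{#}} \<Longrightarrow> csubspace (J n) A"
    and J_cofin: "n \<in> Ix - {{#}} \<Longrightarrow> \<exists>E. finite E \<and> E \<subseteq> carrier A \<and> A.span (E \<union> J n) = carrier A"
    and J_ideal: "\<lbrakk>n \<in> Ix - {{#}}; a \<in> J n; b \<in> carrier A\<rbrakk> \<Longrightarrow> a \<otimes>\<^bsub>A\<^esub> b \<in> J n"
    and J_v: "\<lbrakk>n \<in> Ix - {{#}}; x \<in> Gn n; a \<in> J n\<rbrakk> \<Longrightarrow> act M (T x a) v = \<zero>\<^bsub>M\<^esub>"
    and H_in: "t \<in> h \<Longrightarrow> H t \<in> carrier L"
    and H_v: "t \<in> h \<Longrightarrow> act M (H t) v = lam t \<odot>\<^bsub>M\<^esub> v"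
    and H_T: "\<lbrakk>t \<in> h; n \<in> Ix; y \<in> Gn n; a \<in> carrier A\<rbrakk>
      \<Longrightarrow> bracket L (H t) (T y a) = (- wt n t) \<odot>\<^bsub>L\<^esub> T y a"
    and wt_add: "\<lbrakk>t \<in> h; m \<in> Ix; n \<in> Ix\<rbrakk> \<Longrightarrow> wt (m + n) t = wt m t + wt n t"
    and wt_empty: "t \<in> h \<Longrightarrow> wt {#} t = 0"
    and wt_inj: "\<lbrakk>m \<in> Ix; n \<in> Ix; \<And>t. t \<in> h \<Longrightarrow> wt m t = wt n t\<rbrakk> \<Longrightarrow> m = n"
    and Ix_empty: "{#} \<in> Ix"
begin

abbreviation "generators \<equiv> B \<union> {T x a |x a n. n \<in> Ix - {{#}} \<and> x \<in> Gn n \<and> a \<in> carrier A}"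

text \<open>Letters come in any order and have nonempty degree. The degree is a relation because one
  vector, such as zero, can arise in several degrees.\<close>

inductive monomial :: "nat multiset \<Rightarrow> 'v \<Rightarrow> bool" where
  base: "monomial {#} v"
| step: "\<lbrakk>n \<in> Ix; n \<noteq> {#}; x \<in> Gn n; a \<in> carrier A; monomial k m\<rbrakk>
    \<Longrightarrow> monomial (n + k) (act M (T x a) m)"

abbreviation "monomials \<equiv> {m. \<exists>k. monomial k m}"

lemma Ix_subset: "n \<in> Ix \<Longrightarrow> p \<subseteq># n \<Longrightarrow> p \<in> Ix"
  using Ix_add by (metis subset_mset.add_diff_inverse)

lemma monomial_Ix: "monomial k m \<Longrightarrow> k \<in> Ix"
  by (induction rule: monomial.induct) (auto simp: Ix_add Ix_empty)

lemma monomial_in: "monomial k m \<Longrightarrow> m \<in> carrier M"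
  by (induction rule: monomial.induct) (auto simp: v_in act_in T_in)

lemma monomials_carrier: "monomials \<subseteq> carrier M"
  using monomial_in by auto

lemma act_Neg_monomials:
  assumes "n \<in> Ix" "n \<noteq> {#}" "x \<in> Gn n" "a \<in> carrier A" "w \<in> M.span monomials"
  shows "act M (T x a) w \<in> M.span monomials"
  using clinear.span_vimage[OF act_linear[OF T_in[OF assms(1,3,4)]] M.span_sub[OF monomials_carrier]
    monomials_carrier _ assms(5)] M.span_superset[OF monomials_carrier] step[OF assms(1-4)]
  by blast

lemma act_v_monomials: "z \<in> carrier L \<Longrightarrow> act M z v \<in> M.span monomials"
proof (rule clinear.span_vimage[OF act_linear_left[OF v_in] M.span_sub[OF monomials_carrier], of
      generators])
  note S = M.span_sub[OF monomials_carrier]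
  have v: "v \<in> M.span monomials"
    using M.span_superset[OF monomials_carrier] base by blast
  show "generators \<subseteq> carrier L"
    using B_carrier T_in by auto
  show "act M b v \<in> M.span monomials"
    if "b \<in> generators" for b
    using that
  proof
    assume "b \<in> B"
    then obtain c where "act M b v = c \<odot>\<^bsub>M\<^esub> v" using B_v by blast
    then show ?thesis using M.csub_smult[OF S v] by simp
  next
    assume "b \<in> {T x a |x a n. n \<in> Ix - {{#}} \<and> x \<in> Gn n \<and> a \<in> carrier A}"
    then obtain x a n where "b = T x a" "n \<in> Ix" "n \<noteq> {#}" "x \<in> Gn n" "a \<in> carrier A" by blast
    then show ?thesis using act_Neg_monomials v by simp
  qed
  show "z \<in> L.span (generators)"
    if "z \<in> carrier L" using that L_span by blast
qed

text \<open>Moving z past the first letter leaves that letter applied to z m' and the element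
  [z, T x a] applied to m', where m' is the shorter monomial. The second term is why the induction
  keeps z arbitrary.\<close>

lemma act_monomials: "monomial k m \<Longrightarrow> z \<in> carrier L \<Longrightarrow> act M z m \<in> M.span monomials"
proof (induction arbitrary: z rule: monomial.induct)
  case base
  then show ?case by (rule act_v_monomials)
next
  case (step n x a k m)
  have Tx: "T x a \<in> carrier L" using step T_in by blast
  have "act M z (act M (T x a) m) = act M (T x a) (act M z m) \<oplus>\<^bsub>M\<^esub> act M (bracket L z (T x a)) m"
    using act_bracket[OF step.prems Tx monomial_in] step by blast
  moreover have "act M (T x a) (act M z m) \<in> M.span monomials"
    using act_Neg_monomials step by blast
  moreover have "act M (bracket L z (T x a)) m \<in> M.span monomials"
    using step.IH bracket_in[OF step.prems Tx] by blast
  ultimately show ?case using M.csub_add[OF M.span_sub[OF monomials_carrier]] by simp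
qed

lemma monomials_span: "carrier M \<subseteq> M.span monomials"
proof (rule cyclic[OF M.span_sub[OF monomials_carrier]])
  show "v \<in> M.span monomials"
    using M.span_superset[OF monomials_carrier] base by blast
  fix x m assume x: "x \<in> carrier L" and m: "m \<in> M.span monomials"
  show "act M x m \<in> M.span monomials"
    by (rule clinear.span_vimage[OF act_linear[OF x] M.span_sub[OF monomials_carrier]
          monomials_carrier _ m]) (use act_monomials x in blast)
qed

lemma monomial_weight: "monomial k m \<Longrightarrow> x \<in> h \<Longrightarrow> act M (H x) m = (lam x - wt k x) \<odot>\<^bsub>M\<^esub> m"
proof (induction rule: monomial.induct)
  case base
  then show ?case by (simp add: H_v wt_empty)
next
  case (step n y a k m)
  have Ty: "T y a \<in> carrier L" using step T_in by blast
  have m: "m \<in> carrier M" using step monomial_in by blast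
  note Tm = act_in[OF Ty m]
  have "act M (H x) (act M (T y a) m)
    = act M (T y a) (act M (H x) m) \<oplus>\<^bsub>M\<^esub> act M (bracket L (H x) (T y a)) m"
    by (rule act_bracket[OF H_in[OF step.prems] Ty m])
  also have "\<dots> = (lam x - wt k x) \<odot>\<^bsub>M\<^esub> act M (T y a) m \<oplus>\<^bsub>M\<^esub> (- wt n x) \<odot>\<^bsub>M\<^esub> act M (T y a) m"
    using step Ty m by (simp add: H_T act_smult_left act_smult)
  also have "\<dots> = ((lam x - wt k x) + (- wt n x)) \<odot>\<^bsub>M\<^esub> act M (T y a) m"
    using M.scale_add_left[OF Tm, of "lam x - wt k x" "- wt n x"] by simp
  also have "(lam x - wt k x) + (- wt n x) = lam x - wt (n + k) x"
    using wt_add[OF step.prems, of n k] step monomial_Ix by auto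
  finally show ?case .
qed

text \<open>Commuting \<open>T x a\<close> to the right through a monomial replaces the degree of \<open>x\<close> by larger ones
  and \<open>a\<close> by multiples; all degrees that occur are bounded by the total degree.\<close>

lemma monomial_annihilated:
  assumes "monomial k m" "n \<in> Ix" "n \<noteq> {#}" "x \<in> Gn n" "a \<in> carrier A"
    and "\<And>p. p \<subseteq># n + k \<Longrightarrow> p \<noteq> {#} \<Longrightarrow> a \<in> J p"
  shows "act M (T x a) m = \<zero>\<^bsub>M\<^esub>"
  using assms
proof (induction arbitrary: n x a rule: monomial.induct)
  case base
  then show ?case using J_v[of n x a] by simp
next
  case (step q y b k m)
  have Tx: "T x a \<in> carrier L" and Ty: "T y b \<in> carrier L" using step T_in by blast+
  have m: "m \<in> carrier M" using step monomial_in by blast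
  obtain z where z: "z \<in> Gn (n + q)" "bracket L (T x a) (T y b) = T z (a \<otimes>\<^bsub>A\<^esub> b)"
    using T_bracket[of n q x y a b] step by blast
  have k: "k \<in> Ix" using step monomial_Ix by blast
  have 1: "act M (T x a) m = \<zero>\<^bsub>M\<^esub>"
  proof (rule step.IH[OF step.prems(1-4)])
    fix p assume p: "p \<subseteq># n + k" "p \<noteq> {#}"
    have "n + k \<subseteq># n + (q + k)" by simp
    then show "a \<in> J p" using step.prems(5) p subset_mset.order_trans by blast
  qed
  have 2: "act M (T z (a \<otimes>\<^bsub>A\<^esub> b)) m = \<zero>\<^bsub>M\<^esub>"
  proof (rule step.IH[OF _ _ z(1)])
    show "n + q \<in> Ix" "n + q \<noteq> {#}" using step Ix_add by auto
    show "a \<otimes>\<^bsub>A\<^esub> b \<in> carrier A" using step A_mult by blast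
    fix p assume p: "p \<subseteq># n + q + k" "p \<noteq> {#}"
    then have "a \<in> J p" using step.prems(5)[of p] by (simp add: add.assoc)
    moreover have "p \<in> Ix" using p Ix_subset[of "n + q + k" p] step k by (simp add: Ix_add)
    ultimately show "a \<otimes>\<^bsub>A\<^esub> b \<in> J p" using J_ideal p step by blast
  qed
  have "act M (T x a) (act M (T y b) m)
    = act M (T y b) (act M (T x a) m) \<oplus>\<^bsub>M\<^esub> act M (bracket L (T x a) (T y b)) m"
    by (rule act_bracket[OF Tx Ty m])
  also have "\<dots> = \<zero>\<^bsub>M\<^esub>" using 1 2 z act_zero[OF Ty] by simp
  finally show ?case .
qed

text \<open>The vector \<open>act M (T x a) m\<close> is linear in m, in x and in a separately. The
  three are replaced in this order: m by finitely many vectors from the induction hypothesis, x by a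
  finite spanning set of its piece, and a by finitely many coefficients modulo an ideal that
  annihilates.\<close>

lemma monomials_fin:
  assumes "n \<in> Ix"
  shows "\<exists>E. finite E \<and> E \<subseteq> carrier M \<and> {m. monomial n m} \<subseteq> M.span E"
  using assms
proof (induction n rule: measure_induct_rule[of size])
  case (less n)
  show ?case
  proof (cases "n = {#}")
    case True
    \<comment> \<open>Letters have nonempty degree, so v is the only monomial of empty
      degree.\<close>
    have "m = v" if "monomial {#} m" for m
      using that by (cases rule: monomial.cases) auto
    moreover have "v \<in> M.span {v}" using M.span_superset[of "{v}" v] v_in by auto
    ultimately show ?thesis using True v_in by (intro exI[of _ "{v}"]) auto
  next
    case False
    \<comment> \<open>\<open>P\<close> plays two roles: it contains the possible degrees of the
      first letter and all degrees whose ideals must contain a coefficient for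
      \<open>monomial_annihilated\<close> to apply. The total degree is n for every splitting, so
      one intersection over \<open>P\<close> serves all first letters.\<close>
    define P where "P = {p. p \<subseteq># n \<and> p \<noteq> {#}}"
    have finP: "finite P" unfolding P_def
      by (rule finite_subset[OF _ finite_subset_mset[of n]]) auto
    have PIx: "p \<in> Ix - {{#}}" if "p \<in> P" for p
      using that less.prems Ix_subset unfolding P_def by auto
    have "csubspace {a \<in> carrier A. \<forall>p\<in>P. a \<in> J p} A \<and>
      (\<exists>E. finite E \<and> E \<subseteq> carrier A \<and> A.span (E \<union> {a \<in> carrier A. \<forall>p\<in>P. a \<in> J p}) = carrier A)"
      by (rule A.cofinite_INT[OF finP]) (use PIx J_sub J_cofin in blast)+
    then obtain EA where EA: "finite EA" "EA \<subseteq> carrier A"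
      "A.span (EA \<union> {a \<in> carrier A. \<forall>p\<in>P. a \<in> J p}) = carrier A" by blast
    have "\<forall>p\<in>P. \<exists>E. finite E \<and> E \<subseteq> Gn p \<and> Gn p \<subseteq> G.span E" using Gn_fin PIx by blast
    from bchoice[OF this] obtain EG
      where "\<forall>p\<in>P. finite (EG p) \<and> EG p \<subseteq> Gn p \<and> Gn p \<subseteq> G.span (EG p)" ..
    then have EG: "\<And>p. p \<in> P \<Longrightarrow> finite (EG p)" "\<And>p. p \<in> P \<Longrightarrow> EG p \<subseteq> Gn p"
      "\<And>p. p \<in> P \<Longrightarrow> Gn p \<subseteq> G.span (EG p)" by simp_all
    have "\<forall>p\<in>P. \<exists>E. finite E \<and> E \<subseteq> carrier M \<and> {m. monomial (n - p) m} \<subseteq> M.span E"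
    proof
      fix p assume p: "p \<in> P"
      have "size (n - p) < size n"
        using p size_mset_mono[of p n] nonempty_has_size[of p] unfolding P_def
        by (auto simp: size_Diff_submset)
      moreover have "n - p \<in> Ix" using less.prems Ix_subset[of n "n - p"] by simp
      ultimately show "\<exists>E. finite E \<and> E \<subseteq> carrier M \<and> {m. monomial (n - p) m} \<subseteq> M.span E"
        by (rule less.IH)
    qed
    from bchoice[OF this] obtain EM where "\<forall>p\<in>P. finite (EM p) \<and> EM p \<subseteq> carrier M
      \<and> {m. monomial (n - p) m} \<subseteq> M.span (EM p)" ..
    then have EM: "\<And>p. p \<in> P \<Longrightarrow> finite (EM p)" "\<And>p. p \<in> P \<Longrightarrow> EM p \<subseteq> carrier M"
      "\<And>p. p \<in> P \<Longrightarrow> {m. monomial (n - p) m} \<subseteq> M.span (EM p)" by simp_all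
    define E where "E = (\<Union>p\<in>P. \<Union>x\<in>EG p. \<Union>a\<in>EA. (\<lambda>m. act M (T x a) m) ` EM p)"
    have finE: "finite E" unfolding E_def using finP EG EA EM by blast
    have EC: "E \<subseteq> carrier M"
    proof
      fix w assume "w \<in> E"
      then obtain p x a m where w: "p \<in> P" "x \<in> EG p" "a \<in> EA" "m \<in> EM p" "w = act M (T x a) m"
        unfolding E_def by blast
      then have "T x a \<in> carrier L" using T_in[of p x a] PIx EG EA by blast
      then show "w \<in> carrier M" using w act_in EM(2) by blast
    qed
    note S = M.span_sub[OF EC]
    have "w \<in> M.span E" if "monomial n w" for w
      using that
    proof (cases rule: monomial.cases)
      case base
      then show ?thesis using False by simp
    next
      case (step p x a k m)
      have p: "p \<in> P" using step unfolding P_def by auto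
      have pI: "p \<in> Ix" using step by simp
      have k: "k = n - p" using step by simp
      have mM: "m \<in> M.span (EM p)" using \<open>monomial k m\<close> unfolding k by (intro subsetD[OF EM(3)[OF p]]) simp
      have mC: "m \<in> carrier M" using step monomial_in by blast
      have 1: "act M (T x' a') m' \<in> M.span E" if "x' \<in> EG p" "a' \<in> EA" "m' \<in> EM p" for x' a' m'
        using that p M.span_superset[OF EC] unfolding E_def by blast
      have 2: "act M (T x' a') m \<in> M.span E" if x': "x' \<in> EG p" and a': "a' \<in> EA" for x' a'
      proof -
        have "T x' a' \<in> carrier L" using T_in[OF pI, of x' a'] x' a' EG(2)[OF p] EA by blast
        then show ?thesis
          using clinear.span_vimage[OF act_linear S EM(2)[OF p] _ mM] 1 x' a' by blast
      qed
      have 3: "act M (T x a') m \<in> M.span E" if a': "a' \<in> EA" for a'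
      proof -
        have aC: "a' \<in> carrier A" using a' EA by blast
        \<comment> \<open>\<open>T_left\<close> gives linearity on \<open>Gn p\<close> only, so the
          span of \<open>EG p\<close> has to be formed inside that subspace.\<close>
        interpret Gp: cspace "G\<lparr>carrier := Gn p\<rparr>"
          using G.subspace_is_vs[OF Gn_sub[OF pI]] by (rule cspaceI)
        have "clinear (G\<lparr>carrier := Gn p\<rparr>) M (\<lambda>x. act M (T x a') m)"
          by (rule clinear_comp[OF act_linear_left[OF mC] T_left[OF pI aC]])
        moreover have "x \<in> Gp.span (EG p)"
          using EG(2,3)[OF p] step G.span_li_not_depend(1)[of "EG p" "Gn p"] Gn_sub[OF pI]
          by (auto simp: VectorSpace.subspace_def)
        ultimately show ?thesis
          using clinear.span_vimage[of "G\<lparr>carrier := Gn p\<rparr>" M "\<lambda>x. act M (T x a') m", OF _ S, of "EG p" x]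
            2 a' EG(2)[OF p] by auto
      qed
      have lin: "clinear A M (\<lambda>a. act M (T x a) m)"
        using clinear_comp[OF act_linear_left[OF mC] T_right[OF pI]] step by blast
      have on: "act M (T x b) m \<in> M.span E" if b: "b \<in> EA \<union> {a \<in> carrier A. \<forall>p\<in>P. a \<in> J p}" for b
        using b
      proof
        assume "b \<in> {a \<in> carrier A. \<forall>p\<in>P. a \<in> J p}"
        then have "act M (T x b) m = \<zero>\<^bsub>M\<^esub>"
          using monomial_annihilated[of k m p x b] step unfolding P_def by auto
        then show ?thesis using M.csub_zero[OF S] by simp
      qed (rule 3)
      have sub: "EA \<union> {a \<in> carrier A. \<forall>p\<in>P. a \<in> J p} \<subseteq> carrier A" using EA by auto
      have "a \<in> A.span (EA \<union> {a \<in> carrier A. \<forall>p\<in>P. a \<in> J p})" using EA step by simp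
      from clinear.span_vimage[OF lin S sub on this] have "act M (T x a) m \<in> M.span E" .
      then show ?thesis using step by simp
    qed
    then show ?thesis using finE EC by blast
  qed
qed

text \<open>A weight determines the degree by \<open>wt_inj\<close>, so at most one degree
  contributes to weight \<mu>. If none does, the weight space lies in the span of the empty
  set.\<close>

theorem weight_space_fin:
  "\<exists>E. finite E \<and> E \<subseteq> carrier M \<and>
    {m \<in> carrier M. \<forall>x\<in>h. act M (H x) m = \<mu> x \<odot>\<^bsub>M\<^esub> m} \<subseteq> M.span E"
proof -
  let ?U = "\<lambda>k. {m. monomial k m}" and ?S = "{k \<in> Ix. \<forall>x\<in>h. lam x - wt k x = \<mu> x}"
  have dec: "m \<in> M.span (\<Union>k\<in>?S. ?U k)"
    if m: "m \<in> carrier M" "\<forall>x\<in>h. act M (H x) m = \<mu> x \<odot>\<^bsub>M\<^esub> m" for m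
  proof (rule M.weight_decomposition[where D="\<lambda>x. act M (H x)" and h=h and wt="\<lambda>k x. lam x - wt k x" and \<mu>=\<mu>])
    have "monomials = (\<Union>k\<in>Ix. ?U k)" using monomial_Ix by auto
    then show "m \<in> M.span (\<Union>k\<in>Ix. ?U k)" using monomials_span m by auto
  qed (use m act_linear H_in monomial_in monomial_weight in auto)
  show ?thesis
  proof (cases "?S = {}")
    case True
    then have "(\<Union>k\<in>?S. ?U k) = {}" by blast
    then show ?thesis using dec by (intro exI[of _ "{}"]) (auto simp del: Collect_empty_eq)
  next
    case False
    then obtain k where k: "k \<in> ?S" by blast
    have "k' = k" if "k' \<in> ?S" for k'
    proof (rule wt_inj)
      fix x assume "x \<in> h"
      then have "lam x - wt k' x = lam x - wt k x" using that k by simp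
      then show "wt k' x = wt k x" by simp
    qed (use that k in auto)
    then have S: "?S = {k}" using k by blast
    have "k \<in> Ix" using k by simp
    from monomials_fin[OF this] obtain E
      where E: "finite E" "E \<subseteq> carrier M" "?U k \<subseteq> M.span E" by (elim exE conjE)
    have "M.span (?U k) \<subseteq> M.span E" by (rule M.span_least[OF M.span_sub[OF E(2)] E(3)])
    moreover have "m \<in> M.span (?U k)"
      if "m \<in> carrier M" "\<forall>x\<in>h. act M (H x) m = \<mu> x \<odot>\<^bsub>M\<^esub> m" for m
      using dec[OF that] unfolding S by simp
    ultimately show ?thesis using E(1,2) by (intro exI[of _ E] conjI subsetI) auto
  qed
qed

end

section \<open>Free spaces and tensor products\<close>

text \<open>Being a vector space depends on four fields only, so it passes between records with
  different products or extensions, for instance from a quotient space to a representation on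
  it.\<close>

lemma cspace_cong:
  fixes V :: "(complex, 'v, 'm) module_scheme" and V' :: "(complex, 'v, 'n) module_scheme"
  assumes "cspace V" "carrier V' = carrier V" "add V' = add V" "zero V' = zero V" "smult V' = smult V"
  shows "cspace V'"
proof -
  interpret cspace V by fact
  show ?thesis
    by (rule cspace_intro) (simp_all add: assms(2-) a_ac scale_add_left scale_add_right scale_scale)
qed

section \<open>Finitely supported functions and linear extension\<close>

abbreviation supp :: "('s \<Rightarrow>\<^sub>0 complex) \<Rightarrow> 's set" where
  "supp \<equiv> Poly_Mapping.keys"

abbreviation sc :: "complex \<Rightarrow> ('s \<Rightarrow>\<^sub>0 complex) \<Rightarrow> 's \<Rightarrow>\<^sub>0 complex" where
  "sc c \<equiv> Poly_Mapping.map ((*) c)"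

lemma lookup_sc [simp]: "Poly_Mapping.lookup (sc c p) k = c * Poly_Mapping.lookup p k"
  by (simp add: Poly_Mapping.map.rep_eq when_def)

lemma sc_single [simp]: "sc c (Poly_Mapping.single s a) = Poly_Mapping.single s (c * a)"
  by (rule poly_mapping_eqI) (simp add: lookup_single when_def)

lemma sc_add: "sc c (p + q) = sc c p + sc c q"
  by (rule poly_mapping_eqI) (simp add: lookup_add algebra_simps)

lemma sc_add_left: "sc (a + b) p = sc a p + sc b p"
  by (rule poly_mapping_eqI) (simp add: lookup_add algebra_simps)

lemma sc_sc: "sc a (sc b p) = sc (a * b) p"
  by (rule poly_mapping_eqI) (simp add: algebra_simps)

lemma sc_one [simp]: "sc 1 p = p" and sc_zero [simp]: "sc 0 p = 0" and sc_zero_right [simp]: "sc c 0 = 0"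
  by (rule poly_mapping_eqI; simp)+

lemma sc_minus_one: "sc (- 1) p = - p"
  by (rule poly_mapping_eqI) simp

lemma sc_sum: "sc c (sum f S) = (\<Sum>s\<in>S. sc c (f s))"
  by (induction S rule: infinite_finite_induct) (simp_all add: sc_add)

lemma keys_sc: "supp (sc c p) \<subseteq> supp p"
  by (auto simp: in_keys_iff)

lemma keys_diff_subset:
  fixes p q :: "'s \<Rightarrow>\<^sub>0 complex"
  assumes "supp p \<subseteq> S" "supp q \<subseteq> S"
  shows "supp (p - q) \<subseteq> S"
proof
  fix k assume "k \<in> supp (p - q)"
  then have "k \<in> supp p \<or> k \<in> supp q"
    by (auto simp: in_keys_iff lookup_minus)
  then show "k \<in> S" using assms by auto
qed

lemma keys_add_subset: "supp p \<subseteq> S \<Longrightarrow> supp q \<subseteq> S \<Longrightarrow> supp (p + q) \<subseteq> S"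
  using keys_add[of p q] by blast

text \<open>Supports shrink under cancellation, so sums over different supports are compared over a
  common finite superset.\<close>

lemma lin_ext_superset:
  assumes "finite K" "supp p \<subseteq> K"
  shows "lin_ext f p = (\<Sum>s\<in>K. sc (Poly_Mapping.lookup p s) (f s))"
  unfolding lin_ext_def
  by (rule sum.mono_neutral_left) (use assms in \<open>auto simp: in_keys_iff\<close>)

lemma lin_ext_add: "lin_ext f (p + q) = lin_ext f p + lin_ext f q"
proof -
  let ?K = "supp p \<union> supp q"
  have "supp (p + q) \<subseteq> ?K" by (rule keys_add)
  then show ?thesis
    using lin_ext_superset[of ?K _ f] by (simp add: lookup_add sc_add_left sum.distrib)
qed

lemma lin_ext_sc: "lin_ext f (sc c p) = sc c (lin_ext f p)"
  using lin_ext_superset[OF _ keys_sc, of p f c] by (simp add: lin_ext_def sc_sum sc_sc)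

lemma lin_ext_zero [simp]: "lin_ext f 0 = 0"
  by (simp add: lin_ext_def)

lemma lin_ext_uminus: "lin_ext f (- p) = - lin_ext f p"
  using lin_ext_sc[of f "- 1" p] by (simp add: sc_minus_one)

lemma lin_ext_diff: "lin_ext f (p - q) = lin_ext f p - lin_ext f q"
  using lin_ext_add[of f p "- q"] by (simp add: lin_ext_uminus)

lemma lin_ext_single: "lin_ext f (Poly_Mapping.single s c) = sc c (f s)"
  by (simp add: lin_ext_def)

lemma lin_ext_gen [simp]: "lin_ext f (gen s) = f s"
  by (simp add: lin_ext_single)

lemma lin_ext_add_fun: "lin_ext (\<lambda>s. f s + g s) p = lin_ext f p + lin_ext g p"
  by (simp add: lin_ext_def sc_add sum.distrib)

lemma lin_ext_sc_fun: "lin_ext (\<lambda>s. sc c (f s)) p = sc c (lin_ext f p)"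
  by (simp add: lin_ext_def sc_sum sc_sc mult.commute)

lemma free_simps [simp]:
  "carrier (free_space S) = {p. supp p \<subseteq> S}"
  "\<zero>\<^bsub>free_space S\<^esub> = 0"
  "p \<oplus>\<^bsub>free_space S\<^esub> q = p + q"
  "c \<odot>\<^bsub>free_space S\<^esub> p = sc c p"
  by (simp_all add: free_space_def)

lemma free_cspace: "cspace (free_space S)"
proof (rule cspace_intro)
  show "x \<oplus>\<^bsub>free_space S\<^esub> y \<in> carrier (free_space S)"
    if "x \<in> carrier (free_space S)" "y \<in> carrier (free_space S)" for x y
    using that keys_add[of x y] by auto
  show "c \<odot>\<^bsub>free_space S\<^esub> x \<in> carrier (free_space S)" if "x \<in> carrier (free_space S)" for c x
    using that keys_sc[of c x] by auto
qed (simp_all add: sc_add sc_add_left sc_sc add.assoc add.commute)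

lemma free_minus: "p \<in> carrier (free_space S) \<Longrightarrow> q \<in> carrier (free_space S) \<Longrightarrow> p \<ominus>\<^bsub>free_space S\<^esub> q = p - q"
proof -
  assume a: "p \<in> carrier (free_space S)" "q \<in> carrier (free_space S)"
  interpret cspace "free_space S" by (rule free_cspace)
  show ?thesis using a neg_eq_scale[of q] by (simp add: a_minus_def sc_minus_one)
qed

lemma free_csub_add: "csubspace W (free_space S) \<Longrightarrow> p \<in> W \<Longrightarrow> q \<in> W \<Longrightarrow> p + q \<in> W"
  using cspace.csub_add[OF free_cspace, of W S p q] by simp

lemma keys_sum_subset: "(\<And>s. s \<in> K \<Longrightarrow> supp (f s) \<subseteq> S) \<Longrightarrow> supp (\<Sum>s\<in>K. f s) \<subseteq> S"
proof (induction K rule: infinite_finite_induct)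
  case (insert x F)
  then show ?case using keys_add[of "f x" "sum f F"] by fastforce
qed simp_all

lemma lin_ext_in:
  assumes "\<And>s. s \<in> S \<Longrightarrow> supp (f s) \<subseteq> T" "supp p \<subseteq> S"
  shows "supp (lin_ext f p) \<subseteq> T"
  unfolding lin_ext_def using assms keys_sc by (intro keys_sum_subset) fastforce

lemma lin_ext_clinear:
  assumes "\<And>s. s \<in> S \<Longrightarrow> supp (f s) \<subseteq> T"
  shows "clinear (free_space S) (free_space T) (lin_ext f)"
  by (rule clinearI) (use lin_ext_in[of S f T] assms free_cspace in \<open>auto simp: lin_ext_add lin_ext_sc\<close>)

lemma free_span: "carrier (free_space S) \<subseteq> cspan (free_space S) (gen ` S)"
proof
  interpret cspace "free_space S" by (rule free_cspace)
  fix p assume p: "p \<in> carrier (free_space S)"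
  have c: "gen ` S \<subseteq> carrier (free_space S)" by auto
  note W = span_sub[OF c]
  have "(\<Sum>s\<in>K. sc (Poly_Mapping.lookup p s) (gen s)) \<in> span (gen ` S)" if "finite K" "K \<subseteq> S" for K
    using that
  proof (induction K rule: finite_induct)
    case empty
    then show ?case using csub_zero[OF W] by simp
  next
    case (insert x F)
    have "gen x \<in> span (gen ` S)" using span_superset[OF c] insert by auto
    from csub_smult[OF W this, of "Poly_Mapping.lookup p x"]
    have "sc (Poly_Mapping.lookup p x) (gen x) \<in> span (gen ` S)" by simp
    then show ?case using insert free_csub_add[OF W] by simp
  qed
  moreover have "p = (\<Sum>s\<in>supp p. sc (Poly_Mapping.lookup p s) (gen s))"
  proof (rule poly_mapping_eqI)
    fix k
    have "(\<Sum>s\<in>supp p. Poly_Mapping.lookup p s when s = k)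
      = (if k \<in> supp p then Poly_Mapping.lookup p k else 0)"
      by (simp add: when_def)
    then show "Poly_Mapping.lookup p k =
      Poly_Mapping.lookup (\<Sum>s\<in>supp p. sc (Poly_Mapping.lookup p s) (gen s)) k"
      by (simp add: lookup_sum lookup_single in_keys_iff)
  qed
  ultimately show "p \<in> span (gen ` S)" using p by (metis (mono_tags, lifting) finite_keys free_simps(1) mem_Collect_eq)
qed

lemma free_induct:
  assumes "clinear (free_space S) V f" "csubspace W V" "\<And>s. s \<in> S \<Longrightarrow> f (gen s) \<in> W"
    "p \<in> carrier (free_space S)"
  shows "f p \<in> W"
  by (rule clinear.span_vimage[OF assms(1,2), of "gen ` S"]) (use assms free_span in auto)

lemma free_eq:
  assumes "clinear (free_space S) V f" "clinear (free_space S) V f'" "\<And>s. s \<in> S \<Longrightarrow> f (gen s) = f' (gen s)"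
    "p \<in> carrier (free_space S)"
  shows "f p = f' p"
  by (rule clinear.eq_on_span[OF assms(1,2), of "gen ` S"]) (use assms free_span in auto)

section \<open>Tensor products and larger quotients of the free space on pairs\<close>

context
  fixes V :: "(complex, 'v, 'm) module_scheme" and W :: "(complex, 'w, 'n) module_scheme"
  assumes V: "cspace V" and W: "cspace W"
begin

interpretation V: cspace V by (rule V)
interpretation W: cspace W by (rule W)

lemma tensor_rels_in: "tensor_rels V W \<subseteq> carrier (tensor_free V W)"
proof
  fix r assume "r \<in> tensor_rels V W"
  then have "supp r \<subseteq> carrier V \<times> carrier W"
    unfolding tensor_rels_def
    by (elim UnE CollectE exE conjE) (simp_all add: keys_diff_subset)
  then show "r \<in> carrier (tensor_free V W)" by simp
qed

lemma tensor_ker_sub: "csubspace (tensor_ker V W) (tensor_free V W)"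
  unfolding tensor_ker_def by (rule cspace.span_sub[OF free_cspace tensor_rels_in])

lemma tensor_rels_ker: "tensor_rels V W \<subseteq> tensor_ker V W"
  unfolding tensor_ker_def
  using cspace.span_superset[OF free_cspace tensor_rels_in] by blast

lemma tensor_cspace: "cspace (tensor_space V W)"
  unfolding tensor_space_def by (rule cspace.quot_cspace[OF free_cspace tensor_ker_sub])

context
  fixes K assumes K: "csubspace K (tensor_free V W)" and rels: "tensor_rels V W \<subseteq> K"
begin

text \<open>K is any subspace containing the bilinearity relations. Thus the same facts serve the
  tensor product and the induced module, whose kernel also contains the relations that move U(B)
  across the tensor sign.\<close>

abbreviation "quot_tensor x y \<equiv> K +>\<^bsub>tensor_free V W\<^esub> gen (x, y)"
abbreviation "quot_tensor_space \<equiv> quot_space (tensor_free V W) K"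

lemma quot_tensor_in: "x \<in> carrier V \<Longrightarrow> y \<in> carrier W \<Longrightarrow> quot_tensor x y \<in> carrier quot_tensor_space"
  by (rule cspace.quot_in[OF free_cspace K]) simp

lemma quot_tensor_linear: "clinear (tensor_free V W) quot_tensor_space (\<lambda>p. K +>\<^bsub>tensor_free V W\<^esub> p)"
  by (rule cspace.quot_clinear[OF free_cspace K])

lemma quot_tensor_cspace: "cspace quot_tensor_space"
  by (rule cspace.quot_cspace[OF free_cspace K])

lemma quot_tensor_eq:
  assumes "p \<in> carrier (tensor_free V W)" "q \<in> carrier (tensor_free V W)" "p - q \<in> K"
  shows "K +>\<^bsub>tensor_free V W\<^esub> p = K +>\<^bsub>tensor_free V W\<^esub> q"
  using cspace.coset_eq_iff[OF free_cspace K assms(1,2)] free_minus[OF assms(1,2)] assms(3)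
  by simp

lemma quot_tensor_left: "y \<in> carrier W \<Longrightarrow> clinear V quot_tensor_space (\<lambda>x. quot_tensor x y)"
proof (rule cspace.quot_clinearI[OF free_cspace K V])
  fix x x' c assume y: "y \<in> carrier W" and x: "x \<in> carrier V"
  show "gen (x \<oplus>\<^bsub>V\<^esub> x', y) \<ominus>\<^bsub>tensor_free V W\<^esub> (gen (x, y) \<oplus>\<^bsub>tensor_free V W\<^esub> gen (x', y)) \<in> K"
    if x': "x' \<in> carrier V"
  proof -
    have "gen (x \<oplus>\<^bsub>V\<^esub> x', y) - gen (x, y) - gen (x', y) \<in> tensor_rels V W"
      unfolding tensor_rels_def using x x' y by blast
    then show ?thesis using rels x x' y by (subst free_minus) (auto simp: diff_diff_eq keys_add_subset)
  qed
  have "gen (c \<odot>\<^bsub>V\<^esub> x, y) - Poly_Mapping.single (x, y) c \<in> tensor_rels V W"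
    unfolding tensor_rels_def using x y by blast
  then show "gen (c \<odot>\<^bsub>V\<^esub> x, y) \<ominus>\<^bsub>tensor_free V W\<^esub> c \<odot>\<^bsub>tensor_free V W\<^esub> gen (x, y) \<in> K"
    using rels x y by (subst free_minus) auto
qed simp

lemma quot_tensor_right: "x \<in> carrier V \<Longrightarrow> clinear W quot_tensor_space (quot_tensor x)"
proof (rule cspace.quot_clinearI[OF free_cspace K W])
  fix y y' c assume x: "x \<in> carrier V" and y: "y \<in> carrier W"
  show "gen (x, y \<oplus>\<^bsub>W\<^esub> y') \<ominus>\<^bsub>tensor_free V W\<^esub> (gen (x, y) \<oplus>\<^bsub>tensor_free V W\<^esub> gen (x, y')) \<in> K"
    if y': "y' \<in> carrier W"
  proof -
    have "gen (x, y \<oplus>\<^bsub>W\<^esub> y') - gen (x, y) - gen (x, y') \<in> tensor_rels V W"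
      unfolding tensor_rels_def using x y y' by blast
    then show ?thesis using rels x y y' by (subst free_minus) (auto simp: diff_diff_eq keys_add_subset)
  qed
  have "gen (x, c \<odot>\<^bsub>W\<^esub> y) - Poly_Mapping.single (x, y) c \<in> tensor_rels V W"
    unfolding tensor_rels_def using x y by blast
  then show "gen (x, c \<odot>\<^bsub>W\<^esub> y) \<ominus>\<^bsub>tensor_free V W\<^esub> c \<odot>\<^bsub>tensor_free V W\<^esub> gen (x, y) \<in> K"
    using rels x y by (subst free_minus) auto
qed simp

lemma quot_tensor_span: "carrier quot_tensor_space \<subseteq> cspan quot_tensor_space {quot_tensor x y |x y. x \<in> carrier V \<and> y \<in> carrier W}"
proof
  interpret T: cspace quot_tensor_space by (rule quot_tensor_cspace)
  let ?S = "{quot_tensor x y |x y. x \<in> carrier V \<and> y \<in> carrier W}"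
  have c: "?S \<subseteq> carrier quot_tensor_space" using quot_tensor_in by auto
  fix t assume "t \<in> carrier quot_tensor_space"
  then obtain p where p: "p \<in> carrier (tensor_free V W)" "t = K +>\<^bsub>tensor_free V W\<^esub> p"
    by (rule cspace.quot_cases[OF free_cspace K])
  have "K +>\<^bsub>tensor_free V W\<^esub> p \<in> T.span ?S"
  proof (rule free_induct[OF quot_tensor_linear T.span_sub[OF c] _ p(1)])
    fix s assume "s \<in> carrier V \<times> carrier W"
    then show "K +>\<^bsub>tensor_free V W\<^esub> gen s \<in> T.span ?S"
      by (intro T.span_superset[OF c]) auto
  qed
  then show "t \<in> T.span ?S" using p by simp
qed

end

lemma tensor_in: "x \<in> carrier V \<Longrightarrow> y \<in> carrier W \<Longrightarrow> tensor V W x y \<in> carrier (tensor_space V W)"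
  unfolding tensor_space_def tensor_def by (rule quot_tensor_in[OF tensor_ker_sub tensor_rels_ker])

lemma tensor_left: "y \<in> carrier W \<Longrightarrow> clinear V (tensor_space V W) (\<lambda>x. tensor V W x y)"
  unfolding tensor_space_def tensor_def
  by (rule quot_tensor_left[OF tensor_ker_sub tensor_rels_ker])

lemma tensor_right: "x \<in> carrier V \<Longrightarrow> clinear W (tensor_space V W) (tensor V W x)"
  unfolding tensor_space_def tensor_def
  by (rule quot_tensor_right[OF tensor_ker_sub tensor_rels_ker])

lemma tensor_span:
  "carrier (tensor_space V W) \<subseteq> cspan (tensor_space V W) {tensor V W x y |x y. x \<in> carrier V \<and> y \<in> carrier W}"
  unfolding tensor_space_def tensor_def
  by (rule quot_tensor_span[OF tensor_ker_sub tensor_rels_ker])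

lemma tensor_space_cases:
  assumes "t \<in> carrier (tensor_space V W)"
  obtains p where "p \<in> carrier (tensor_free V W)" "t = tensor_ker V W +>\<^bsub>tensor_free V W\<^esub> p"
  using assms unfolding tensor_space_def by (rule cspace.quot_cases[OF free_cspace tensor_ker_sub])

end

lemma tensor_map_linear:
  assumes "clinear V V' \<phi>" "clinear W W' \<theta>"
  shows "clinear (tensor_free V W) (tensor_free V' W') (lin_ext (\<lambda>(x, y). gen (\<phi> x, \<theta> y)))"
  using clinear.closed[OF assms(1)] clinear.closed[OF assms(2)]
  by (intro lin_ext_clinear) auto

text \<open>Functoriality of the tensor product: each kind of relation is sent to a relation of the
  same kind. It yields the well-definedness of the bracket on g' \<otimes> A, of the action of h''
  on it, and of left multiplication on an induced module.\<close>

lemma tensor_map_ker: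
  assumes "clinear V V' \<phi>" "clinear W W' \<theta>" "p \<in> tensor_ker V W"
  shows "lin_ext (\<lambda>(x, y). gen (\<phi> x, \<theta> y)) p \<in> tensor_ker V' W'"
proof -
  interpret \<phi>: clinear V V' \<phi> by fact
  interpret \<theta>: clinear W W' \<theta> by fact
  note V = \<phi>.V.cspace_axioms and W = \<theta>.V.cspace_axioms
  note V' = \<phi>.W.cspace_axioms and W' = \<theta>.W.cspace_axioms
  show ?thesis
  proof (rule clinear.span_vimage[OF tensor_map_linear[OF assms(1,2)] tensor_ker_sub[OF V' W']
        tensor_rels_in[OF V W] _ assms(3)[unfolded tensor_ker_def]])
    fix r assume r: "r \<in> tensor_rels V W"
    let ?f = "lin_ext (\<lambda>(x, y). gen (\<phi> x, \<theta> y))"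
    from r consider
        (1) x x' y where "r = gen (x \<oplus>\<^bsub>V\<^esub> x', y) - gen (x, y) - gen (x', y)"
          "x \<in> carrier V" "x' \<in> carrier V" "y \<in> carrier W"
      | (2) x y y' where "r = gen (x, y \<oplus>\<^bsub>W\<^esub> y') - gen (x, y) - gen (x, y')"
          "x \<in> carrier V" "y \<in> carrier W" "y' \<in> carrier W"
      | (3) c x y where "r = gen (c \<odot>\<^bsub>V\<^esub> x, y) - Poly_Mapping.single (x, y) c"
          "x \<in> carrier V" "y \<in> carrier W"
      | (4) c x y where "r = gen (x, c \<odot>\<^bsub>W\<^esub> y) - Poly_Mapping.single (x, y) c"
          "x \<in> carrier V" "y \<in> carrier W"
      unfolding tensor_rels_def by (elim UnE CollectE exE conjE) blast+
    then have "?f r \<in> tensor_rels V' W'"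
    proof cases
      case 1
      then have "?f r = gen (\<phi> x \<oplus>\<^bsub>V'\<^esub> \<phi> x', \<theta> y) - gen (\<phi> x, \<theta> y) - gen (\<phi> x', \<theta> y)"
        by (simp add: lin_ext_diff \<phi>.add)
      then show ?thesis unfolding tensor_rels_def using 1 \<phi>.closed \<theta>.closed by blast
    next
      case 2
      then have "?f r = gen (\<phi> x, \<theta> y \<oplus>\<^bsub>W'\<^esub> \<theta> y') - gen (\<phi> x, \<theta> y) - gen (\<phi> x, \<theta> y')"
        by (simp add: lin_ext_diff \<theta>.add)
      then show ?thesis unfolding tensor_rels_def using 2 \<phi>.closed \<theta>.closed by blast
    next
      case 3
      then have "?f r = gen (c \<odot>\<^bsub>V'\<^esub> \<phi> x, \<theta> y) - Poly_Mapping.single (\<phi> x, \<theta> y) c"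
        by (simp add: lin_ext_diff lin_ext_single \<phi>.smult)
      then show ?thesis unfolding tensor_rels_def using 3 \<phi>.closed \<theta>.closed by blast
    next
      case 4
      then have "?f r = gen (\<phi> x, c \<odot>\<^bsub>W'\<^esub> \<theta> y) - Poly_Mapping.single (\<phi> x, \<theta> y) c"
        by (simp add: lin_ext_diff lin_ext_single \<theta>.smult)
      then show ?thesis unfolding tensor_rels_def using 4 \<phi>.closed \<theta>.closed by blast
    qed
    then show "?f r \<in> tensor_ker V' W'" by (rule subsetD[OF tensor_rels_ker[OF V' W']])
  qed
qed

section \<open>Enveloping algebras and induced representations\<close>

abbreviation amult :: "('x list \<Rightarrow>\<^sub>0 complex) \<Rightarrow> ('x list \<Rightarrow>\<^sub>0 complex) \<Rightarrow> ('x list \<Rightarrow>\<^sub>0 complex)" where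
  "amult p q \<equiv> lin_ext (\<lambda>u. lin_ext (\<lambda>w. gen (u @ w)) q) p"

lemma free_assoc_simps [simp]:
  "carrier (free_assoc S) = {p. supp p \<subseteq> lists S}"
  "\<zero>\<^bsub>free_assoc S\<^esub> = 0" "\<one>\<^bsub>free_assoc S\<^esub> = gen []"
  "p \<oplus>\<^bsub>free_assoc S\<^esub> q = p + q" "p \<otimes>\<^bsub>free_assoc S\<^esub> q = amult p q"
  "c \<odot>\<^bsub>free_assoc S\<^esub> p = sc c p"
  by (simp_all add: free_assoc_def free_space_def)

lemma free_assoc_cspace: "cspace (free_assoc S)"
  by (rule cspace_cong[OF free_cspace[of "lists S"]]) (auto simp: free_assoc_def free_space_def)

lemma free_assoc_clinear: "clinear (free_assoc S) V f \<Longrightarrow> clinear (free_space (lists S)) V f"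
proof -
  assume "clinear (free_assoc S) V f"
  then interpret clinear "free_assoc S" V f .
  show ?thesis
    by (rule clinearI[OF free_cspace W.cspace_axioms]) (use closed add smult in auto)
qed

lemma amult_add_right: "amult p (q + r) = amult p q + amult p r"
  by (simp add: lin_ext_add lin_ext_add_fun)

lemma amult_sc_right: "amult p (sc c q) = sc c (amult p q)"
  by (simp add: lin_ext_sc lin_ext_sc_fun)

lemma amult_left: "clinear (free_space UNIV) (free_space UNIV) (\<lambda>p. amult p q)"
  by (rule lin_ext_clinear) simp

lemma amult_right: "clinear (free_space UNIV) (free_space UNIV) (\<lambda>q. amult p q)"
  by (rule clinearI[OF free_cspace free_cspace]) (simp_all add: amult_add_right amult_sc_right)

lemma free_UNIV_eq:
  assumes "clinear (free_space UNIV) (free_space UNIV) f" "clinear (free_space UNIV) (free_space UNIV) f'"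
    "\<And>s. f (gen s) = f' (gen s)"
  shows "f p = f' p"
  by (rule free_eq[OF assms(1,2)]) (use assms(3) in auto)

text \<open>Both sides are trilinear, so it suffices to compare them on words. The reduction treats
  one variable at a time, over all words so that no carrier conditions arise.\<close>

lemma amult_assoc: "amult (amult p q) r = amult p (amult q r)"
proof -
  have 1: "amult (amult (gen u) (gen w)) r = amult (gen u) (amult (gen w) r)" for u w
    by (rule free_UNIV_eq[where f="\<lambda>r. amult (amult (gen u) (gen w)) r"
          and f'="\<lambda>r. amult (gen u) (amult (gen w) r)", OF amult_right
          clinear_comp[OF amult_right[of "gen u"] amult_right[of "gen w"]]]) simp
  have 2: "amult (amult (gen u) q) r = amult (gen u) (amult q r)" for u
    by (rule free_UNIV_eq[where f="\<lambda>q. amult (amult (gen u) q) r"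
          and f'="\<lambda>q. amult (gen u) (amult q r)",
          OF clinear_comp[OF amult_left[of r] amult_right[of "gen u"]]
          clinear_comp[OF amult_right[of "gen u"] amult_left[of r]]]) (rule 1)
  show ?thesis
    by (rule free_UNIV_eq[where f="\<lambda>p. amult (amult p q) r" and f'="\<lambda>p. amult p (amult q r)",
          OF clinear_comp[OF amult_left[of r] amult_left[of q]] amult_left]) (rule 2)
qed

lemma lin_ext_gen_id: "lin_ext gen p = p"
  by (rule free_UNIV_eq[OF lin_ext_clinear cspace.clinear_id[OF free_cspace]]) simp_all

lemma amult_keys:
  assumes "supp p \<subseteq> lists S" "supp q \<subseteq> lists S"
  shows "supp (amult p q) \<subseteq> lists S"
proof (rule lin_ext_in[OF _ assms(1)])
  fix u assume "u \<in> lists S"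
  then show "supp (lin_ext (\<lambda>w. gen (u @ w)) q) \<subseteq> lists S"
    using assms(2) by (intro lin_ext_in[where S="lists S"]) auto
qed

lemma free_assoc_ring: "ring (free_assoc S)"
proof -
  interpret cspace "free_assoc S" by (rule free_assoc_cspace)
  show ?thesis
  proof (rule ringI)
    show "Group.monoid (free_assoc S)"
      by (rule monoidI) (simp_all add: amult_assoc amult_keys lin_ext_gen_id)
  qed (auto simp: abelian_group_axioms lin_ext_add lin_ext_add_fun)
qed

text \<open>Ideals are taken in the ring sense; stability under scalars comes from c x = (c 1)
  x.\<close>

lemma ideal_csub:
  fixes R :: "(complex, 'v, 'm) module_scheme"
  assumes R: "cspace R" and I: "ideal I R"
    and s: "\<And>c x. x \<in> carrier R \<Longrightarrow> c \<odot>\<^bsub>R\<^esub> x = (c \<odot>\<^bsub>R\<^esub> \<one>\<^bsub>R\<^esub>) \<otimes>\<^bsub>R\<^esub> x"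
  shows "csubspace I R"
proof -
  interpret cspace R by (rule R)
  interpret I: ideal I R by (rule I)
  show ?thesis
  proof (rule csubI)
    show "c \<odot>\<^bsub>R\<^esub> x \<in> I" if "x \<in> I" for c x
      using s[of x c] I.I_l_closed[OF that, of "c \<odot>\<^bsub>R\<^esub> \<one>\<^bsub>R\<^esub>"] that I.a_subset by auto
  qed (use I.a_subset in auto)
qed

text \<open>The bracket enters U(L) through relations, from which the module identities below are
  derived; closure of the bracket places these relations in the free algebra on
  \<open>carrier L\<close>.\<close>

locale env = cspace L for L :: "('x, 'm) lie_alg_scheme" (structure) +
  assumes bracket_mem: "\<lbrakk>x \<in> carrier L; y \<in> carrier L\<rbrakk> \<Longrightarrow> bracket L x y \<in> carrier L"
begin

abbreviation "FA \<equiv> free_assoc (carrier L)"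
abbreviation "U \<equiv> univ_env L"
abbreviation "cl \<equiv> univ_class L"

sublocale FA: cspace FA by (rule free_assoc_cspace)
sublocale FAr: ring FA by (rule free_assoc_ring)

lemma univ_rels_in: "univ_rels L \<subseteq> carrier FA"
proof
  fix r assume "r \<in> univ_rels L"
  then have "supp r \<subseteq> lists (carrier L)"
    unfolding univ_rels_def
    by (elim UnE CollectE exE conjE) (simp_all add: keys_diff_subset bracket_mem)
  then show "r \<in> carrier FA" by simp
qed

lemma univ_ideal: "ideal (univ_ideal L) FA"
  unfolding univ_ideal_def by (rule FAr.genideal_ideal[OF univ_rels_in])

lemma univ_rels_ideal: "r \<in> univ_rels L \<Longrightarrow> r \<in> univ_ideal L"
  unfolding univ_ideal_def using FAr.genideal_self[OF univ_rels_in] by blast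

lemma univ_ideal_sub: "csubspace (univ_ideal L) FA"
  by (rule ideal_csub[OF free_assoc_cspace univ_ideal]) (simp add: lin_ext_single lin_ext_gen_id)

sublocale U: cspace U
  unfolding univ_env_def by (rule FA.quot_cspace[OF univ_ideal_sub])

lemma cl_linear: "clinear FA U cl"
  unfolding univ_env_def univ_class_def by (rule FA.quot_clinear[OF univ_ideal_sub])

lemma cl_cases: assumes "u \<in> carrier U" obtains p where "p \<in> carrier FA" "u = cl p"
  using assms unfolding univ_env_def univ_class_def by (rule FA.quot_cases[OF univ_ideal_sub])

lemma cl_in: "p \<in> carrier FA \<Longrightarrow> cl p \<in> carrier U"
  by (rule clinear.closed[OF cl_linear])

lemma cl_mult: "p \<in> carrier FA \<Longrightarrow> q \<in> carrier FA \<Longrightarrow> cl p \<otimes>\<^bsub>U\<^esub> cl q = cl (amult p q)"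
  using ideal.rcoset_mult_add[OF univ_ideal, of p q]
  by (simp add: univ_env_def univ_class_def quot_space_def ring.extend_def FactRing_def)

lemma cl_one: "\<one>\<^bsub>U\<^esub> = cl (gen [])"
  by (simp add: univ_env_def univ_class_def quot_space_def ring.extend_def FactRing_def)

lemma cl_eq: "p \<in> carrier FA \<Longrightarrow> q \<in> carrier FA \<Longrightarrow> p - q \<in> univ_ideal L \<Longrightarrow> cl p = cl q"
proof -
  assume pq: "p \<in> carrier FA" "q \<in> carrier FA" "p - q \<in> univ_ideal L"
  have "p \<ominus>\<^bsub>FA\<^esub> q = p - q"
    using FA.neg_eq_scale[of q] pq by (simp add: a_minus_def sc_minus_one)
  then show ?thesis
    unfolding univ_class_def using FA.coset_eq_iff[OF univ_ideal_sub pq(1,2)] pq(3) by simp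
qed

text \<open>U(L) has the ring fields of the factor ring and adds only scalar multiplication, so the
  ring laws carry over field by field.\<close>

lemma U_ring_simps:
  "carrier U = carrier (FA Quot univ_ideal L)" "add U = add (FA Quot univ_ideal L)"
  "mult U = mult (FA Quot univ_ideal L)" "one U = one (FA Quot univ_ideal L)"
  by (simp_all add: univ_env_def quot_space_def ring.extend_def)

lemma U_ring_laws:
  "\<lbrakk>u \<in> carrier U; w \<in> carrier U\<rbrakk> \<Longrightarrow> u \<otimes>\<^bsub>U\<^esub> w \<in> carrier U"
  "\<lbrakk>u \<in> carrier U; w \<in> carrier U; t \<in> carrier U\<rbrakk> \<Longrightarrow> (u \<otimes>\<^bsub>U\<^esub> w) \<otimes>\<^bsub>U\<^esub> t = u \<otimes>\<^bsub>U\<^esub> (w \<otimes>\<^bsub>U\<^esub> t)"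
  "\<one>\<^bsub>U\<^esub> \<in> carrier U"
  "u \<in> carrier U \<Longrightarrow> \<one>\<^bsub>U\<^esub> \<otimes>\<^bsub>U\<^esub> u = u" "u \<in> carrier U \<Longrightarrow> u \<otimes>\<^bsub>U\<^esub> \<one>\<^bsub>U\<^esub> = u"
  "\<lbrakk>u \<in> carrier U; w \<in> carrier U; t \<in> carrier U\<rbrakk>
    \<Longrightarrow> (u \<oplus>\<^bsub>U\<^esub> w) \<otimes>\<^bsub>U\<^esub> t = u \<otimes>\<^bsub>U\<^esub> t \<oplus>\<^bsub>U\<^esub> w \<otimes>\<^bsub>U\<^esub> t"
  "\<lbrakk>u \<in> carrier U; w \<in> carrier U; t \<in> carrier U\<rbrakk>
    \<Longrightarrow> t \<otimes>\<^bsub>U\<^esub> (u \<oplus>\<^bsub>U\<^esub> w) = t \<otimes>\<^bsub>U\<^esub> u \<oplus>\<^bsub>U\<^esub> t \<otimes>\<^bsub>U\<^esub> w"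
  unfolding U_ring_simps
  using ideal.quotient_is_ring[OF univ_ideal]
  by (simp_all add: ring.ring_simprules monoid.r_one ring.is_monoid)

lemmas U_mult_in = U_ring_laws(1) and U_assoc = U_ring_laws(2) and U_one_in = U_ring_laws(3)
  and U_one = U_ring_laws(4,5)

lemma U_mult_left: "w \<in> carrier U \<Longrightarrow> clinear U U (\<lambda>u. u \<otimes>\<^bsub>U\<^esub> w)"
proof (rule clinearI)
  interpret c: clinear FA U cl by (rule cl_linear)
  assume w: "w \<in> carrier U"
  show "(u \<oplus>\<^bsub>U\<^esub> u') \<otimes>\<^bsub>U\<^esub> w = u \<otimes>\<^bsub>U\<^esub> w \<oplus>\<^bsub>U\<^esub> u' \<otimes>\<^bsub>U\<^esub> w"
    if u: "u \<in> carrier U" "u' \<in> carrier U" for u u'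
    by (intro U_ring_laws(6) u w)
  show "(a \<odot>\<^bsub>U\<^esub> u) \<otimes>\<^bsub>U\<^esub> w = a \<odot>\<^bsub>U\<^esub> (u \<otimes>\<^bsub>U\<^esub> w)" if u: "u \<in> carrier U" for a u
  proof -
    obtain p where p: "p \<in> carrier FA" "w = cl p" using w by (rule cl_cases)
    obtain q where q: "q \<in> carrier FA" "u = cl q" using u by (rule cl_cases)
    have m: "amult q p \<in> carrier FA" using p q by (simp_all add: amult_keys)
    show ?thesis
      unfolding p(2) q(2) c.smult[OF q(1), symmetric] cl_mult[OF q(1) p(1)] cl_mult[OF FA.scale_closed[OF q(1)] p(1)]
        c.smult[OF m, symmetric] by (simp add: lin_ext_sc)
  qed
qed (auto simp: U_mult_in U.cspace_axioms)

lemma U_mult_right: "w \<in> carrier U \<Longrightarrow> clinear U U (\<lambda>u. w \<otimes>\<^bsub>U\<^esub> u)"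
proof (rule clinearI)
  interpret c: clinear FA U cl by (rule cl_linear)
  assume w: "w \<in> carrier U"
  show "w \<otimes>\<^bsub>U\<^esub> (u \<oplus>\<^bsub>U\<^esub> u') = w \<otimes>\<^bsub>U\<^esub> u \<oplus>\<^bsub>U\<^esub> w \<otimes>\<^bsub>U\<^esub> u'"
    if u: "u \<in> carrier U" "u' \<in> carrier U" for u u'
    by (intro U_ring_laws(7) u w)
  show "w \<otimes>\<^bsub>U\<^esub> (a \<odot>\<^bsub>U\<^esub> u) = a \<odot>\<^bsub>U\<^esub> (w \<otimes>\<^bsub>U\<^esub> u)" if u: "u \<in> carrier U" for a u
  proof -
    obtain p where p: "p \<in> carrier FA" "w = cl p" using w by (rule cl_cases)
    obtain q where q: "q \<in> carrier FA" "u = cl q" using u by (rule cl_cases)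
    have m: "amult p q \<in> carrier FA" using p q by (simp_all add: amult_keys)
    show ?thesis
      unfolding p(2) q(2) c.smult[OF q(1), symmetric] cl_mult[OF p(1) q(1)] cl_mult[OF p(1) FA.scale_closed[OF q(1)]]
        c.smult[OF m, symmetric] by (simp add: amult_sc_right)
  qed
qed (auto simp: U_mult_in U.cspace_axioms)

abbreviation "\<iota> x \<equiv> cl (gen [x])"

lemma iota_in: "x \<in> carrier L \<Longrightarrow> \<iota> x \<in> carrier U"
  by (rule cl_in) simp

lemma iota_linear: "clinear L U \<iota>"
  unfolding univ_env_def univ_class_def
proof (rule FA.quot_clinearI[OF univ_ideal_sub cspace_axioms])
  fix x y c assume x: "x \<in> carrier L"
  have diff: "p \<ominus>\<^bsub>FA\<^esub> q = p - q" if "q \<in> carrier FA" for p q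
    using FA.neg_eq_scale[OF that] by (simp add: a_minus_def sc_minus_one)
  show "gen [x \<oplus> y] \<ominus>\<^bsub>FA\<^esub> (gen [x] \<oplus>\<^bsub>FA\<^esub> gen [y]) \<in> univ_ideal L" if y: "y \<in> carrier L"
  proof -
    have "gen [x \<oplus> y] - gen [x] - gen [y] \<in> univ_rels L"
      unfolding univ_rels_def using x y by blast
    then show ?thesis
      using univ_rels_ideal x y by (subst diff) (auto simp: keys_add_subset diff_diff_eq)
  qed
  have "gen [c \<odot> x] - Poly_Mapping.single [x] c \<in> univ_rels L"
    unfolding univ_rels_def using x by blast
  then show "gen [c \<odot> x] \<ominus>\<^bsub>FA\<^esub> c \<odot>\<^bsub>FA\<^esub> gen [x] \<in> univ_ideal L"
    using univ_rels_ideal x by (subst diff) auto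
qed simp

lemma iota_bracket:
  assumes "x \<in> carrier L" "y \<in> carrier L"
  shows "\<iota> x \<otimes>\<^bsub>U\<^esub> \<iota> y = \<iota> y \<otimes>\<^bsub>U\<^esub> \<iota> x \<oplus>\<^bsub>U\<^esub> \<iota> (bracket L x y)"
proof -
  interpret c: clinear FA U cl by (rule cl_linear)
  have b: "bracket L x y \<in> carrier L" using assms bracket_mem by blast
  have c: "gen [x] \<in> carrier FA" "gen [y] \<in> carrier FA" "gen [y, x] \<in> carrier FA"
    "gen [bracket L x y] \<in> carrier FA" using assms b by auto
  have "gen [x, y] - gen [y, x] - gen [bracket L x y] \<in> univ_rels L"
    unfolding univ_rels_def using assms by blast
  then have "cl (gen [x, y]) = cl (gen [y, x] + gen [bracket L x y])"
    using univ_rels_ideal FA.a_closed[OF c(3,4)] assms by (intro cl_eq) (auto simp: diff_diff_eq)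
  then show ?thesis using c.add[OF c(3,4)] c by (simp add: cl_mult)
qed

end

section \<open>Modules induced from a character\<close>

lemma complex_cspace: "cspace complex_space"
  by (rule cspace_intro) (auto simp: complex_space_def algebra_simps)

lemma complex_simps [simp]:
  "c \<in> carrier complex_space" "a \<oplus>\<^bsub>complex_space\<^esub> b = a + b" "a \<odot>\<^bsub>complex_space\<^esub> b = a * b"
  by (simp_all add: complex_space_def)

locale induced = env L for L :: "('x, 'm) lie_alg_scheme" (structure) +
  fixes B :: "'x set" and \<chi> :: "'x \<Rightarrow> complex"
  assumes B: "B \<subseteq> carrier L"
begin

abbreviation "F \<equiv> tensor_free U complex_space"
abbreviation "K \<equiv> induced_ker L B \<chi>"
abbreviation "M \<equiv> induced_rep L B \<chi>"
abbreviation "extra \<equiv> {gen (u \<otimes>\<^bsub>U\<^esub> cl p, c) - gen (u, char_eval \<chi> p * c) |u p c.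
          u \<in> carrier U \<and> p \<in> carrier (free_assoc B)}"

sublocale F: cspace F by (rule free_cspace)

lemma B_FA: "p \<in> carrier (free_assoc B) \<Longrightarrow> p \<in> carrier FA"
  using B by auto

lemma rels_in: "tensor_rels U complex_space \<union> extra \<subseteq> carrier F"
proof
  fix r assume "r \<in> tensor_rels U complex_space \<union> extra"
  then show "r \<in> carrier F"
  proof
    assume "r \<in> extra"
    then obtain u p c where "r = gen (u \<otimes>\<^bsub>U\<^esub> cl p, c) - gen (u, char_eval \<chi> p * c)"
      "u \<in> carrier U" "p \<in> carrier (free_assoc B)" by blast
    then show ?thesis using U_mult_in cl_in[OF B_FA] by (simp add: keys_diff_subset)
  qed (use tensor_rels_in[OF U.cspace_axioms complex_cspace] in blast)
qed

lemma K_sub: "csubspace K F"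
  unfolding induced_ker_def by (rule F.span_sub[OF rels_in])

lemma rels_K: "r \<in> tensor_rels U complex_space \<union> extra \<Longrightarrow> r \<in> K"
  unfolding induced_ker_def by (rule F.span_superset[OF rels_in])

lemma tensor_rels_K: "tensor_rels U complex_space \<subseteq> K"
  using rels_K by blast

lemma tensor_ker_K: "tensor_ker U complex_space \<subseteq> K"
  unfolding tensor_ker_def by (rule F.span_least[OF K_sub tensor_rels_K])

abbreviation "Q \<equiv> quot_space F K"
abbreviation "tens u c \<equiv> K +>\<^bsub>F\<^esub> gen (u, c)"

lemmas tens_left = quot_tensor_left[OF U.cspace_axioms complex_cspace K_sub tensor_rels_K]
lemmas tens_right = quot_tensor_right[OF U.cspace_axioms complex_cspace K_sub tensor_rels_K]
lemmas tens_span = quot_tensor_span[OF U.cspace_axioms complex_cspace K_sub tensor_rels_K]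
lemmas tens_in = quot_tensor_in[OF U.cspace_axioms complex_cspace K_sub tensor_rels_K]

lemma M_simps [simp]: "carrier M = carrier Q" "x \<oplus>\<^bsub>M\<^esub> y = x \<oplus>\<^bsub>Q\<^esub> y" "c \<odot>\<^bsub>M\<^esub> x = c \<odot>\<^bsub>Q\<^esub> x"
  "\<zero>\<^bsub>M\<^esub> = \<zero>\<^bsub>Q\<^esub>"
  by (simp_all add: induced_rep_def module.extend_def)

sublocale Q: cspace Q by (rule F.quot_cspace[OF K_sub])

sublocale M: cspace M
  by (rule cspace_cong[OF Q.cspace_axioms]) (simp_all add: induced_rep_def module.extend_def)

lemma clinear_MQ: "clinear V M f \<longleftrightarrow> clinear V Q f"
  by (auto simp: clinear_def clinear_axioms_def LinearCombinations.module_hom_def Q.cspace_axioms M.cspace_axioms)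

abbreviation "op x \<equiv> lin_ext (\<lambda>(u, c). gen (\<iota> x \<otimes>\<^bsub>U\<^esub> u, c))"

lemma op_linear: "x \<in> carrier L \<Longrightarrow> clinear F F (op x)"
  using tensor_map_linear[OF U_mult_right[OF iota_in] cspace.clinear_id[OF complex_cspace]] .

text \<open>Left multiplication by x commutes with right multiplication by U(B): by associativity an
  extra relation with left factor u becomes the one with left factor x u. The bilinearity relations
  are handled by functoriality.\<close>

lemma op_K:
  assumes x: "x \<in> carrier L" and p: "p \<in> K"
  shows "op x p \<in> K"
proof (rule clinear.span_vimage[OF op_linear[OF x] K_sub rels_in _ p[unfolded induced_ker_def]])
  fix r assume "r \<in> tensor_rels U complex_space \<union> extra"
  then show "op x r \<in> K"
  proof
    assume "r \<in> tensor_rels U complex_space"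
    then have "r \<in> tensor_ker U complex_space"
      by (rule subsetD[OF tensor_rels_ker[OF U.cspace_axioms complex_cspace]])
    then show ?thesis
      using tensor_map_ker[OF U_mult_right[OF iota_in[OF x]] cspace.clinear_id[OF complex_cspace]]
        tensor_ker_K by blast
  next
    assume "r \<in> extra"
    then obtain u p c where r: "r = gen (u \<otimes>\<^bsub>U\<^esub> cl p, c) - gen (u, char_eval \<chi> p * c)"
      "u \<in> carrier U" "p \<in> carrier (free_assoc B)" by blast
    then have "op x r = gen ((\<iota> x \<otimes>\<^bsub>U\<^esub> u) \<otimes>\<^bsub>U\<^esub> cl p, c) - gen (\<iota> x \<otimes>\<^bsub>U\<^esub> u, char_eval \<chi> p * c)"
      using x cl_in[OF B_FA] iota_in by (simp add: lin_ext_diff U_assoc)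
    moreover have "\<iota> x \<otimes>\<^bsub>U\<^esub> u \<in> carrier U" using r x U_mult_in iota_in by blast
    ultimately have "op x r \<in> extra" using r(3) by blast
    then show ?thesis using rels_K by blast
  qed
qed

lemma act_eq: "act M x = induced_map F K (op x)"
  by (simp add: induced_rep_def module.extend_def lie_rep.fields_def)

lemma act_tens:
  assumes "x \<in> carrier L" "u \<in> carrier U"
  shows "act M x (tens u c) = tens (\<iota> x \<otimes>\<^bsub>U\<^esub> u) c"
proof -
  interpret o: clinear F F "op x" by (rule op_linear[OF assms(1)])
  show ?thesis
    using F.induced_map_coset[OF K_sub _ o.closed o.add op_K[OF assms(1)], of "gen (u, c)"] assms
    unfolding act_eq by simp
qed

lemma act_lin: "x \<in> carrier L \<Longrightarrow> clinear Q Q (act M x)"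
  unfolding act_eq by (rule F.induced_map_clinear[OF K_sub op_linear op_K])

text \<open>On a generator u \<otimes> c the action is left multiplication on u, so the three
  identities are linearity of L \<rightarrow> U(L) and \<open>iota_bracket\<close> multiplied by u.
  One induction over the span treats all of them.\<close>

lemma act_identities:
  assumes "m \<in> carrier M"
  shows "\<lbrakk>x \<in> carrier L; y \<in> carrier L\<rbrakk> \<Longrightarrow> act M (x \<oplus> y) m = act M x m \<oplus>\<^bsub>M\<^esub> act M y m"
    "x \<in> carrier L \<Longrightarrow> act M (a \<odot> x) m = a \<odot>\<^bsub>M\<^esub> act M x m"
    "\<lbrakk>x \<in> carrier L; y \<in> carrier L\<rbrakk>
      \<Longrightarrow> act M x (act M y m) = act M y (act M x m) \<oplus>\<^bsub>M\<^esub> act M (bracket L x y) m"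
proof -
  let ?P = "\<lambda>m. (\<forall>x\<in>carrier L. \<forall>y\<in>carrier L. act M (x \<oplus> y) m = act M x m \<oplus>\<^bsub>Q\<^esub> act M y m
    \<and> act M (bracket L x y) m = act M x (act M y m) \<ominus>\<^bsub>Q\<^esub> act M y (act M x m))
    \<and> (\<forall>a. \<forall>x\<in>carrier L. act M (a \<odot> x) m = a \<odot>\<^bsub>Q\<^esub> act M x m)"
  let ?T = "{tens u c |u c. u \<in> carrier U \<and> c \<in> carrier complex_space}"
  have T: "?T \<subseteq> carrier Q" using tens_in by blast
  note lin = clinear.closed[OF act_lin] clinear.add[OF act_lin] clinear.smult[OF act_lin]
    clinear.zero[OF act_lin] bracket_mem
  have "m \<in> Q.span ?T" using assms tens_span by auto
  then have "?P m"
  proof (rule Q.span_induct_closure[OF _ T])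
    fix b assume "b \<in> ?T"
    then obtain u c where b: "b = tens u c" and u: "u \<in> carrier U" by blast
    note i = iota_in U_mult_in[OF iota_in u] U_mult_in[OF iota_in U_mult_in[OF iota_in u]]
    note tl = tens_left[OF complex_simps(1)[of c]]
    have "act M (bracket L x y) b = act M x (act M y b) \<ominus>\<^bsub>Q\<^esub> act M y (act M x b)"
      if xy: "x \<in> carrier L" "y \<in> carrier L" for x y
    proof -
      have e: "\<iota> x \<otimes>\<^bsub>U\<^esub> (\<iota> y \<otimes>\<^bsub>U\<^esub> u)
          = \<iota> y \<otimes>\<^bsub>U\<^esub> (\<iota> x \<otimes>\<^bsub>U\<^esub> u) \<oplus>\<^bsub>U\<^esub> \<iota> (bracket L x y) \<otimes>\<^bsub>U\<^esub> u"
        using xy i u bracket_mem iota_bracket[OF xy] by (simp add: U_assoc[symmetric] U_ring_laws(6) U_mult_in)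
      have "act M x (act M y b) = tens (\<iota> x \<otimes>\<^bsub>U\<^esub> (\<iota> y \<otimes>\<^bsub>U\<^esub> u)) c"
        unfolding b using xy i u by (simp add: act_tens)
      then have "act M x (act M y b) = act M (bracket L x y) b \<oplus>\<^bsub>Q\<^esub> act M y (act M x b)"
        unfolding e b using xy i u bracket_mem by (simp add: act_tens clinear.add[OF tl] clinear.closed[OF tl] Q.a_comm)
      moreover have "b \<in> carrier Q" using b u tens_in by simp
      ultimately show ?thesis using xy by (simp add: lin Q.add_minus_cancel)
    qed
    then show "?P b" unfolding b
      using i u by (simp add: act_tens clinear.add[OF iota_linear] clinear.smult[OF iota_linear]
        clinear.add[OF U_mult_left] clinear.smult[OF U_mult_left] clinear.add[OF tl] clinear.smult[OF tl])
  qed (simp_all add: lin Q.scale_add_right Q.scale_scale Q.scale_neg_right a_minus_def Q.minus_add Q.a_ac mult.commute)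
  then show "\<lbrakk>x \<in> carrier L; y \<in> carrier L\<rbrakk> \<Longrightarrow> act M (x \<oplus> y) m = act M x m \<oplus>\<^bsub>M\<^esub> act M y m"
    "x \<in> carrier L \<Longrightarrow> act M (a \<odot> x) m = a \<odot>\<^bsub>M\<^esub> act M x m"
    "\<lbrakk>x \<in> carrier L; y \<in> carrier L\<rbrakk>
      \<Longrightarrow> act M x (act M y m) = act M y (act M x m) \<oplus>\<^bsub>M\<^esub> act M (bracket L x y) m"
    using assms by (simp_all add: lin Q.minus_add_cancel_left)
qed

sublocale rep: lrep L M
proof
  show "bracket L x y \<in> carrier L" if "x \<in> carrier L" "y \<in> carrier L" for x y
    using that by (rule bracket_mem)
  show "act M x m \<in> carrier M" if "x \<in> carrier L" "m \<in> carrier M" for x m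
    using clinear.closed[OF act_lin[OF that(1)]] that by simp
  show "act M x (m \<oplus>\<^bsub>M\<^esub> n) = act M x m \<oplus>\<^bsub>M\<^esub> act M x n"
    if "x \<in> carrier L" "m \<in> carrier M" "n \<in> carrier M" for x m n
    using clinear.add[OF act_lin[OF that(1)]] that by simp
  show "act M x (c \<odot>\<^bsub>M\<^esub> m) = c \<odot>\<^bsub>M\<^esub> act M x m" if "x \<in> carrier L" "m \<in> carrier M" for x c m
    using clinear.smult[OF act_lin[OF that(1)]] that by simp
  show "act M (x \<oplus> y) m = act M x m \<oplus>\<^bsub>M\<^esub> act M y m"
    if "x \<in> carrier L" "y \<in> carrier L" "m \<in> carrier M" for x y m
    using act_identities(1)[OF that(3,1,2)] .
  show "act M (a \<odot> x) m = a \<odot>\<^bsub>M\<^esub> act M x m" if "x \<in> carrier L" "m \<in> carrier M" for a x m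
    using act_identities(2)[OF that(2,1)] .
  show "act M x (act M y m) = act M y (act M x m) \<oplus>\<^bsub>M\<^esub> act M (bracket L x y) m"
    if "x \<in> carrier L" "y \<in> carrier L" "m \<in> carrier M" for x y m
    using act_identities(3)[OF that(3,1,2)] .
qed

lemma vec_tens: "induced_vec L B \<chi> = tens \<one>\<^bsub>U\<^esub> 1"
  by (simp add: induced_vec_def)

lemma vec_in: "induced_vec L B \<chi> \<in> carrier M"
  using tens_in[OF U_one_in, of 1] by (simp add: vec_tens)

lemma act_vec: "z \<in> B \<Longrightarrow> act M z (induced_vec L B \<chi>) = \<chi> z \<odot>\<^bsub>M\<^esub> induced_vec L B \<chi>"
proof -
  assume z: "z \<in> B"
  then have zL: "z \<in> carrier L" using B by blast
  have "gen [z] \<in> carrier (free_assoc B)" using z by simp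
  \<comment> \<open>The relation (u b, c) = (u, b c) with u = 1 and b the class of the one-letter
    word z; it moves z across the tensor sign.\<close>
  then have "gen (\<one>\<^bsub>U\<^esub> \<otimes>\<^bsub>U\<^esub> \<iota> z, 1) - gen (\<one>\<^bsub>U\<^esub>, char_eval \<chi> (gen [z]) * 1) \<in> extra"
    using U_one_in by blast
  moreover have "char_eval \<chi> (gen [z]) = \<chi> z" by (simp add: char_eval_def)
  ultimately have "gen (\<iota> z, 1) - gen (\<one>\<^bsub>U\<^esub>, \<chi> z) \<in> K"
    using rels_K[of "gen (\<iota> z, 1) - gen (\<one>\<^bsub>U\<^esub>, \<chi> z)"] U_one(1)[OF iota_in[OF zL]] by auto
  then have "tens (\<iota> z) 1 = tens \<one>\<^bsub>U\<^esub> (\<chi> z)"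
    using quot_tensor_eq[OF U.cspace_axioms complex_cspace K_sub tensor_rels_K,
        of "gen (\<iota> z, 1)" "gen (\<one>\<^bsub>U\<^esub>, \<chi> z)"] iota_in[OF zL] U_one_in by simp
  then show ?thesis
    using act_tens[OF zL U_one_in, of 1] U_one(2)[OF iota_in[OF zL]]
      clinear.smult[OF tens_right[OF U_one_in], of 1 "\<chi> z"] by (simp add: vec_tens)
qed

text \<open>Applying x to w \<otimes> 1, for a word w, prefixes the letter x, so N contains all
  words tensored with 1, hence by linearity u \<otimes> 1 for every u, and then every u \<otimes> c
  as a scalar multiple.\<close>

lemma induced_cyclic:
  assumes N: "csubspace N M" and v: "induced_vec L B \<chi> \<in> N"
    and stable: "\<And>x m. x \<in> carrier L \<Longrightarrow> m \<in> N \<Longrightarrow> act M x m \<in> N"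
  shows "carrier M \<subseteq> N"
proof
  have "clinear U Q (\<lambda>u. tens u 1)" by (rule tens_left) simp
  note l = clinear_comp[OF this cl_linear]
  have lin: "clinear (free_space (lists (carrier L))) M (\<lambda>p. tens (cl p) 1)"
    unfolding clinear_MQ by (rule free_assoc_clinear[OF l])
  have words: "tens (cl (gen w)) 1 \<in> N" if "w \<in> lists (carrier L)" for w
    using that
  proof (induction w)
    case Nil
    then show ?case using v by (simp add: vec_tens cl_one)
  next
    case (Cons x w)
    then have "act M x (tens (cl (gen w)) 1) \<in> N" using stable by blast
    moreover have "act M x (tens (cl (gen w)) 1) = tens (cl (gen (x # w))) 1"
      using act_tens[OF Cons.hyps(1) cl_in, of "gen w" 1] cl_mult[of "gen [x]" "gen w"] Cons.hyps by simp
    ultimately show ?case by simp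
  qed
  have one: "tens u 1 \<in> N" if "u \<in> carrier U" for u
    using that
  proof (rule cl_cases)
    fix p assume p: "p \<in> carrier FA" "u = cl p"
    show "tens u 1 \<in> N"
      unfolding p(2) by (rule free_induct[OF lin N words]) (use p(1) in simp_all)
  qed
  fix m assume "m \<in> carrier M"
  then have m: "m \<in> Q.span {tens u c |u c. u \<in> carrier U \<and> c \<in> carrier complex_space}"
    using tens_span by auto
  have NQ: "csubspace N Q" using N by (simp add: Q.csub_iff M.csub_iff)
  show "m \<in> N"
  proof (rule Q.span_least_mem[OF NQ _ m], clarsimp)
    fix u c assume u: "u \<in> carrier U"
    have "tens u c = c \<odot>\<^bsub>Q\<^esub> tens u 1" using clinear.smult[OF tens_right[OF u], of 1 c] by simp
    then show "tens u c \<in> N" using Q.csub_smult[OF NQ one[OF u]] by simp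
  qed
qed

end

section \<open>Quotient representations\<close>

context lrep
begin

lemma submodule_iff: "lie_submodule L M N \<longleftrightarrow> csubspace N M \<and> (\<forall>x\<in>carrier L. \<forall>m\<in>N. act M x m \<in> N)"
  by (simp add: lie_submodule_def)

text \<open>The hull is the intersection of all submodules containing S. That
  \<open>carrier M\<close> is one of them keeps this intersection inside
  \<open>carrier M\<close>.\<close>

lemma submodule_hull: "S \<subseteq> carrier M \<Longrightarrow> lie_submodule L M (lie_submodule L M hull S)"
proof -
  assume S: "S \<subseteq> carrier M"
  have top: "lie_submodule L M (carrier M)" using M.csub_self act_in by (simp add: submodule_iff)
  have mem: "m \<in> lie_submodule L M hull S
    \<longleftrightarrow> (\<forall>N. csubspace N M \<and> (\<forall>x\<in>carrier L. \<forall>m\<in>N. act M x m \<in> N) \<and> S \<subseteq> N \<longrightarrow> m \<in> N)" for m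
    by (auto simp: hull_def submodule_iff)
  have sub: "lie_submodule L M hull S \<subseteq> carrier M" using S top by (rule hull_minimal)
  have "csubspace (lie_submodule L M hull S) M"
    by (rule M.csubI[OF sub]; unfold mem) (auto simp: M.csub_zero M.csub_add M.csub_smult)
  moreover have "act M x m \<in> lie_submodule L M hull S"
    if "x \<in> carrier L" "m \<in> lie_submodule L M hull S" for x m
    using that unfolding mem by blast
  ultimately show ?thesis by (simp add: submodule_iff)
qed

context
  fixes N assumes N: "lie_submodule L M N"
begin

lemma N_sub: "csubspace N M"
  using N by (simp add: submodule_iff)

lemma quot_rep_simps [simp]: "carrier (quot_rep M N) = carrier (quot_space M N)"
  "x \<oplus>\<^bsub>quot_rep M N\<^esub> y = x \<oplus>\<^bsub>quot_space M N\<^esub> y" "c \<odot>\<^bsub>quot_rep M N\<^esub> x = c \<odot>\<^bsub>quot_space M N\<^esub> x"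
  "\<zero>\<^bsub>quot_rep M N\<^esub> = \<zero>\<^bsub>quot_space M N\<^esub>"
  by (simp_all add: quot_rep_def module.extend_def)

lemma quot_rep_cspace: "cspace (quot_rep M N)"
  by (rule cspace_cong[OF M.quot_cspace[OF N_sub]]) (simp_all add: quot_rep_def module.extend_def)

lemma act_quot_rep: "act (quot_rep M N) x = induced_map M N (act M x)"
  by (simp add: quot_rep_def module.extend_def lie_rep.fields_def)

lemma quot_act: "x \<in> carrier L \<Longrightarrow> m \<in> carrier M \<Longrightarrow> act (quot_rep M N) x (N +>\<^bsub>M\<^esub> m) = N +>\<^bsub>M\<^esub> act M x m"
  unfolding act_quot_rep
  using M.induced_map_coset[OF N_sub, of m "act M x"] N act_in act_add by (simp add: submodule_iff)

lemmas quot_rules = M.quot_add[OF N_sub] M.quot_smult[OF N_sub] M.quot_in[OF N_sub]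

lemma quot_rep_lrep: "lrep L (quot_rep M N)"
proof -
  interpret R: cspace "quot_rep M N" by (rule quot_rep_cspace)
  show ?thesis
  proof
    have lin: "clinear (quot_space M N) (quot_space M N) (act (quot_rep M N) x)" if "x \<in> carrier L" for x
      unfolding act_quot_rep
      by (rule M.induced_map_clinear[OF N_sub act_linear[OF that]]) (use N that in \<open>simp add: submodule_iff\<close>)
    show "act (quot_rep M N) x m \<in> carrier (quot_rep M N)"
      if "x \<in> carrier L" "m \<in> carrier (quot_rep M N)" for x m
      using clinear.closed[OF lin] that by simp
    show "act (quot_rep M N) x (m \<oplus>\<^bsub>quot_rep M N\<^esub> n)
      = act (quot_rep M N) x m \<oplus>\<^bsub>quot_rep M N\<^esub> act (quot_rep M N) x n"
      if "x \<in> carrier L" "m \<in> carrier (quot_rep M N)" "n \<in> carrier (quot_rep M N)" for x m n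
      using clinear.add[OF lin] that by simp
    show "act (quot_rep M N) x (c \<odot>\<^bsub>quot_rep M N\<^esub> m) = c \<odot>\<^bsub>quot_rep M N\<^esub> act (quot_rep M N) x m"
      if "x \<in> carrier L" "m \<in> carrier (quot_rep M N)" for x c m
      using clinear.smult[OF lin] that by simp
    show "act (quot_rep M N) (x \<oplus>\<^bsub>L\<^esub> y) m
      = act (quot_rep M N) x m \<oplus>\<^bsub>quot_rep M N\<^esub> act (quot_rep M N) y m"
      if "x \<in> carrier L" "y \<in> carrier L" "m \<in> carrier (quot_rep M N)" for x y m
      using that(3) unfolding quot_rep_simps
      by (elim M.quot_cases[OF N_sub]) (simp add: quot_act that(1,2) act_in quot_rules act_add_left)
    show "act (quot_rep M N) (c \<odot>\<^bsub>L\<^esub> x) m = c \<odot>\<^bsub>quot_rep M N\<^esub> act (quot_rep M N) x m"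
      if "x \<in> carrier L" "m \<in> carrier (quot_rep M N)" for c x m
      using that(2) unfolding quot_rep_simps
      by (elim M.quot_cases[OF N_sub]) (simp add: quot_act that(1) act_in quot_rules act_smult_left)
    show "act (quot_rep M N) x (act (quot_rep M N) y m)
      = act (quot_rep M N) y (act (quot_rep M N) x m) \<oplus>\<^bsub>quot_rep M N\<^esub> act (quot_rep M N) (bracket L x y) m"
      if "x \<in> carrier L" "y \<in> carrier L" "m \<in> carrier (quot_rep M N)" for x y m
      using that(3) unfolding quot_rep_simps
      by (elim M.quot_cases[OF N_sub])
        (simp add: quot_act that(1,2) act_in bracket_in quot_rules act_bracket[OF that(1,2)])
  qed (rule bracket_in)
qed

text \<open>The preimage of W in M is a submodule containing v, so cyclicity of M applies to
  it.\<close>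

lemma quot_rep_cyclic:
  assumes cyc: "\<And>N. \<lbrakk>csubspace N M; v \<in> N; \<And>x m. x \<in> carrier L \<Longrightarrow> m \<in> N \<Longrightarrow> act M x m \<in> N\<rbrakk>
      \<Longrightarrow> carrier M \<subseteq> N"
    and v: "v \<in> carrier M"
    and W: "csubspace W (quot_rep M N)" and vW: "N +>\<^bsub>M\<^esub> v \<in> W"
    and stable: "\<And>x m. x \<in> carrier L \<Longrightarrow> m \<in> W \<Longrightarrow> act (quot_rep M N) x m \<in> W"
  shows "carrier (quot_rep M N) \<subseteq> W"
proof -
  interpret R: cspace "quot_rep M N" by (rule quot_rep_cspace)
  have lin: "clinear M (quot_rep M N) (\<lambda>x. N +>\<^bsub>M\<^esub> x)"
    by (rule clinearI) (simp_all add: M.cspace_axioms R.cspace_axioms quot_rules)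
  have "carrier M \<subseteq> {m \<in> carrier M. N +>\<^bsub>M\<^esub> m \<in> W}"
    by (rule cyc[OF clinear.vimage_sub[OF lin W]])
      (use v vW stable act_in quot_act in \<open>auto simp flip: quot_act\<close>)
  then show ?thesis by (auto elim!: M.quot_cases[OF N_sub])
qed

end

end

section \<open>Current algebras\<close>

lemma algebra_cspace: "algebra (class_ring :: complex ring) A \<Longrightarrow> cspace A"
  by (simp add: cspace_def vectorspace_def class_field algebra.module)

sublocale lie_algebra \<subseteq> sp: cspace L
  using vectorspace_axioms by (rule cspaceI)

context lie_algebra
begin

lemma derived_carrier: "{bracket L x y |x y. x \<in> carrier L \<and> y \<in> carrier L} \<subseteq> carrier L"
  using bracket_closed by auto

lemma derived_sub: "csubspace (derived L) L"
  unfolding derived_def by (rule sp.span_sub[OF derived_carrier])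

lemma derived_in: "x \<in> derived L \<Longrightarrow> x \<in> carrier L"
  using sp.csub_carrier[OF derived_sub] .

lemma bracket_derived: "x \<in> carrier L \<Longrightarrow> y \<in> carrier L \<Longrightarrow> bracket L x y \<in> derived L"
  unfolding derived_def by (rule sp.span_superset[OF derived_carrier]) blast

lemma bracket_left: "y \<in> carrier L \<Longrightarrow> clinear L L (\<lambda>x. bracket L x y)"
  by (rule clinearI) (simp_all add: sp.cspace_axioms bracket_closed bracket_add_left bracket_smult_left)

lemma bracket_right: "x \<in> carrier L \<Longrightarrow> clinear L L (bracket L x)"
  by (rule clinearI) (simp_all add: sp.cspace_axioms bracket_closed bracket_add_right bracket_smult_right)

lemma bracket_zero: "y \<in> carrier L \<Longrightarrow> bracket L \<zero> y = \<zero>" "x \<in> carrier L \<Longrightarrow> bracket L x \<zero> = \<zero>"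
  using clinear.zero[OF bracket_left] clinear.zero[OF bracket_right] by blast+

lemma bracket_antisym:
  assumes "x \<in> carrier L" "y \<in> carrier L"
  shows "bracket L x y = \<ominus> bracket L y x"
proof -
  have c: "bracket L x y \<in> carrier L" "bracket L y x \<in> carrier L" using assms bracket_closed by auto
  have "bracket L (x \<oplus> y) (x \<oplus> y) = bracket L x y \<oplus> bracket L y x"
  proof -
    have "bracket L (x \<oplus> y) (x \<oplus> y)
      = (bracket L x x \<oplus> bracket L y x) \<oplus> (bracket L x y \<oplus> bracket L y y)"
      using assms by (simp add: bracket_add_left bracket_add_right bracket_closed )
    then show ?thesis using assms c by (simp add: bracket_self a_comm)
  qed
  then have "bracket L x y \<oplus> bracket L y x = \<zero>" using bracket_self[of "x \<oplus> y"] assms by simp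
  then show ?thesis using c minus_equality by auto
qed

lemma jacobi_derivation:
  assumes "x \<in> carrier L" "y \<in> carrier L" "z \<in> carrier L"
  shows "bracket L x (bracket L y z) = bracket L (bracket L x y) z \<oplus> bracket L y (bracket L x z)"
proof -
  let ?a = "bracket L x (bracket L y z)" and ?b = "bracket L y (bracket L x z)"
    and ?c = "bracket L (bracket L x y) z"
  have c: "?a \<in> carrier L" "?b \<in> carrier L" "?c \<in> carrier L" using assms bracket_closed by auto
  have "bracket L y (bracket L z x) = \<ominus> ?b"
    unfolding bracket_antisym[OF assms(3,1)]
    using clinear.neg[OF bracket_right] assms bracket_closed by simp
  moreover have "bracket L z (bracket L x y) = \<ominus> ?c"
    by (rule bracket_antisym[OF assms(3) bracket_closed[OF assms(1,2)]])
  ultimately have "?a \<oplus> \<ominus> ?b \<oplus> \<ominus> ?c = \<zero>" using jacobi[OF assms] by simp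
  then have "?a \<ominus> (?c \<oplus> ?b) = \<zero>" using c by (simp add: a_minus_def minus_add a_ac)
  then show ?thesis using sp.eq_of_minus_zero c by blast
qed

end

locale current = lie_algebra g for g :: "('g, 'm) lie_alg_scheme" (structure) +
  fixes A :: "(complex, 'a, 'n) module_scheme" and h'' :: "'g set"
  assumes alg: "algebra (class_ring :: complex ring) A" and h''_sub: "csubspace h'' g"
begin

sublocale A: algebra "class_ring :: complex ring" A by (rule alg)

sublocale Av: cspace A
  by (rule algebra_cspace[OF alg])

abbreviation "D \<equiv> derived_alg g"
abbreviation "TF \<equiv> tensor_free D A"
abbreviation "TK \<equiv> tensor_ker D A"
abbreviation "CS \<equiv> current_space g A"
abbreviation "L \<equiv> g_tilde g A h''"
abbreviation "T \<equiv> pure g A"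

lemma h''_in: "d \<in> h'' \<Longrightarrow> d \<in> carrier g"
  using sp.csub_carrier[OF h''_sub] .

sublocale D: cspace D
  by (rule cspaceI[OF subspace_is_vs[OF derived_sub]])

lemma D_bracket_left: "y \<in> carrier g \<Longrightarrow> clinear D D (\<lambda>x. bracket g x y)"
  by (rule clinearI) (simp_all add: D.cspace_axioms bracket_derived derived_in bracket_add_left bracket_smult_left)

lemma D_bracket_right: "x \<in> carrier g \<Longrightarrow> clinear D D (bracket g x)"
  by (rule clinearI) (simp_all add: D.cspace_axioms bracket_derived derived_in bracket_add_right bracket_smult_right)

lemma A_mult_left: "b \<in> carrier A \<Longrightarrow> clinear A A (\<lambda>a. a \<otimes>\<^bsub>A\<^esub> b)"
  by (rule clinearI) (use A.smult_assoc2 in \<open>auto simp: Av.cspace_axioms A.l_distr\<close>)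

lemma A_mult_right: "a \<in> carrier A \<Longrightarrow> clinear A A (\<lambda>b. a \<otimes>\<^bsub>A\<^esub> b)"
  using A_mult_left[of a]
  by (auto simp: clinear_def clinear_axioms_def LinearCombinations.module_hom_def A.m_comm)

lemmas tensor_lin_left = tensor_left[OF D.cspace_axioms Av.cspace_axioms, folded current_space_def]
lemmas tensor_lin_right = tensor_right[OF D.cspace_axioms Av.cspace_axioms, folded current_space_def]
lemmas current_span = tensor_span[OF D.cspace_axioms Av.cspace_axioms, folded current_space_def]
lemmas current_cases = tensor_space_cases[OF D.cspace_axioms Av.cspace_axioms, folded current_space_def]
lemmas TK_sub = tensor_ker_sub[OF D.cspace_axioms Av.cspace_axioms]

lemma tensor_in_current: "x \<in> (derived g) \<Longrightarrow> a \<in> carrier A \<Longrightarrow> tensor D A x a \<in> carrier CS"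
  using tensor_in[OF D.cspace_axioms Av.cspace_axioms, of x a] by (simp add: current_space_def)

sublocale CS: cspace CS
  unfolding current_space_def by (rule tensor_cspace[OF D.cspace_axioms Av.cspace_axioms])

sublocale TF: cspace TF by (rule free_cspace)

abbreviation "Bil p q \<equiv>
  lin_ext (\<lambda>s. lin_ext (\<lambda>t. gen (bracket g (fst s) (fst t), snd s \<otimes>\<^bsub>A\<^esub> snd t)) q) p"

lemma Bil_in:
  assumes "p \<in> carrier TF" "q \<in> carrier TF"
  shows "Bil p q \<in> carrier TF"
proof -
  have "supp (lin_ext (\<lambda>t. gen (bracket g (fst s) (fst t), snd s \<otimes>\<^bsub>A\<^esub> snd t)) q)
      \<subseteq> carrier D \<times> carrier A" if "s \<in> carrier D \<times> carrier A" for s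
    by (rule lin_ext_in[where S="carrier D \<times> carrier A"])
      (use that assms in \<open>auto simp: bracket_derived derived_in\<close>)
  then show ?thesis
    using lin_ext_in[where S="carrier D \<times> carrier A" and T="carrier D \<times> carrier A"] assms by simp
qed

lemma Bil_left: "q \<in> carrier TF \<Longrightarrow> clinear TF TF (\<lambda>p. Bil p q)"
  by (rule clinearI[OF TF.cspace_axioms TF.cspace_axioms Bil_in])
    (simp_all add: lin_ext_add lin_ext_sc)

lemma Bil_right: "p \<in> carrier TF \<Longrightarrow> clinear TF TF (\<lambda>q. Bil p q)"
  by (rule clinearI[OF TF.cspace_axioms TF.cspace_axioms Bil_in])
    (simp_all add: lin_ext_add lin_ext_sc lin_ext_add_fun lin_ext_sc_fun)

text \<open>For q a single pair (y, b) the map is the tensor product of x \<mapsto> [x, y] and a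
  \<mapsto> a b, so it preserves the kernel by functoriality; linearity in q does the rest.\<close>

lemma Bil_ker_left:
  assumes "p \<in> TK" "q \<in> carrier TF"
  shows "Bil p q \<in> TK"
proof (rule free_induct[OF Bil_right TK_sub _ assms(2)])
  show "p \<in> carrier TF" using assms(1) TF.csub_carrier[OF TK_sub] by blast
  fix t assume t: "t \<in> carrier D \<times> carrier A"
  have "lin_ext (\<lambda>(x, a). gen (bracket g x (fst t), a \<otimes>\<^bsub>A\<^esub> snd t)) p \<in> TK"
    by (rule tensor_map_ker[OF D_bracket_left A_mult_left assms(1)]) (use t derived_in in auto)
  then show "Bil p (gen t) \<in> TK" by (simp add: case_prod_unfold)
qed

lemma Bil_ker_right:
  assumes "p \<in> carrier TF" "q \<in> TK"
  shows "Bil p q \<in> TK"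
proof (rule free_induct[OF Bil_left TK_sub _ assms(1)])
  show "q \<in> carrier TF" using assms(2) TF.csub_carrier[OF TK_sub] by blast
  fix s assume s: "s \<in> carrier D \<times> carrier A"
  have "lin_ext (\<lambda>(y, b). gen (bracket g (fst s) y, snd s \<otimes>\<^bsub>A\<^esub> b)) q \<in> TK"
    by (rule tensor_map_ker[OF D_bracket_right A_mult_right assms(2)]) (use s derived_in in auto)
  then show "Bil (gen s) q \<in> TK" by (simp add: case_prod_unfold)
qed

abbreviation "co p \<equiv> TK +>\<^bsub>TF\<^esub> p"

lemma co_in: "p \<in> carrier TF \<Longrightarrow> co p \<in> carrier CS"
  unfolding current_space_def tensor_space_def by (rule TF.quot_in[OF TK_sub])

text \<open>Expanding Bil (a + p) (b + q) with a and b in the kernel, every term except Bil p q lies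
  in the kernel.\<close>

lemma current_bracket_coset:
  assumes p: "p \<in> carrier TF" and q: "q \<in> carrier TF"
  shows "current_bracket g A (co p) (co q) = co (Bil p q)"
proof -
  have mem: "z \<in> current_bracket g A (co p) (co q)
    \<longleftrightarrow> (\<exists>k\<in>TK. \<exists>p'\<in>co p. \<exists>q'\<in>co q. z = k + Bil p' q')" for z
    unfolding current_bracket_def set_add_def' case_prod_unfold by auto
  note lp = clinear.add[OF Bil_left] and lq = clinear.add[OF Bil_right]
  show ?thesis
  proof (intro equalityI subsetI)
    fix z assume "z \<in> current_bracket g A (co p) (co q)"
    then obtain k p' q' where z: "k \<in> TK" "p' \<in> co p" "q' \<in> co q" "z = k + Bil p' q'"
      unfolding mem by blast
    obtain a where a: "a \<in> TK" "p' = a + p" using z(2) TF.coset_mem[OF TK_sub] by auto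
    obtain b where b: "b \<in> TK" "q' = b + q" using z(3) TF.coset_mem[OF TK_sub] by auto
    have ab: "a \<in> carrier TF" "b \<in> carrier TF" using a b TF.csub_carrier[OF TK_sub] by auto
    have q': "q' \<in> carrier TF" using TF.a_closed[OF ab(2) q] b by simp
    have "Bil p' q' = Bil a q' + Bil p q'" using lp[OF q' ab(1) p] a by simp
    also have "Bil p q' = Bil p b + Bil p q" using lq[OF p ab(2) q] b by simp
    finally have "z = (k + (Bil a q' + Bil p b)) \<oplus>\<^bsub>TF\<^esub> Bil p q" using z by (simp add: add.assoc)
    moreover have "k + (Bil a q' + Bil p b) \<in> TK"
      using z(1) Bil_ker_left[OF a(1) q'] Bil_ker_right[OF p b(1)] by (intro free_csub_add[OF TK_sub])
    ultimately show "z \<in> co (Bil p q)" unfolding TF.coset_mem[OF TK_sub] by blast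
  next
    fix z assume "z \<in> co (Bil p q)"
    then obtain k where "k \<in> TK" "z = k + Bil p q" unfolding TF.coset_mem[OF TK_sub] by auto
    moreover have "p \<in> co p" "q \<in> co q"
      using abelian_subgroup.a_rcos_self[OF TF.csub_abelian_subgroup[OF TK_sub]] p q by blast+
    ultimately show "z \<in> current_bracket g A (co p) (co q)" unfolding mem by blast
  qed
qed

lemma current_bracket_in:
  assumes "P \<in> carrier CS" "Q \<in> carrier CS"
  shows "current_bracket g A P Q \<in> carrier CS"
proof -
  obtain p where p: "p \<in> carrier TF" "P = co p" using assms(1) by (rule current_cases)
  obtain q where q: "q \<in> carrier TF" "Q = co q" using assms(2) by (rule current_cases)
  show ?thesis unfolding p(2) q(2) current_bracket_coset[OF p(1) q(1)]
    by (rule co_in[OF Bil_in[OF p(1) q(1)]])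
qed

lemma current_bracket_tensor:
  assumes "x \<in> (derived g)" "y \<in> (derived g)" "a \<in> carrier A" "b \<in> carrier A"
  shows "current_bracket g A (tensor D A x a) (tensor D A y b) = tensor D A (bracket g x y) (a \<otimes>\<^bsub>A\<^esub> b)"
  using current_bracket_coset[of "gen (x, a)" "gen (y, b)"] assms by (simp add: tensor_def)

lemma current_deriv_coset:
  assumes d: "d \<in> carrier g" and p: "p \<in> carrier TF"
  shows "current_deriv g A d (co p) = co (lin_ext (\<lambda>(x, a). gen (bracket g d x, a)) p)"
proof -
  note id = Av.clinear_id
  interpret l: clinear TF TF "lin_ext (\<lambda>(x, a). gen (bracket g d x, a))"
    by (rule tensor_map_linear[OF D_bracket_right[OF d] id])
  show ?thesis
    unfolding current_deriv_def
    by (rule TF.induced_map_coset[OF TK_sub p l.closed l.add])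
      (use tensor_map_ker[OF D_bracket_right[OF d] id] in simp_all)
qed

lemma current_deriv_in:
  assumes "d \<in> carrier g" "P \<in> carrier CS"
  shows "current_deriv g A d P \<in> carrier CS"
proof -
  obtain p where p: "p \<in> carrier TF" "P = co p" using assms(2) by (rule current_cases)
  show ?thesis unfolding p(2) current_deriv_coset[OF assms(1) p(1)]
    by (rule co_in[OF clinear.closed[OF tensor_map_linear[OF D_bracket_right[OF assms(1)] Av.clinear_id] p(1)]])
qed

lemma current_deriv_tensor:
  assumes "d \<in> carrier g" "x \<in> (derived g)" "a \<in> carrier A"
  shows "current_deriv g A d (tensor D A x a) = tensor D A (bracket g d x) a"
  using current_deriv_coset[of d "gen (x, a)"] assms by (simp add: tensor_def)

lemma L_simps [simp]:
  "carrier L = carrier CS \<times> h''" "\<zero>\<^bsub>L\<^esub> = (\<zero>\<^bsub>CS\<^esub>, \<zero>)"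
  "(P, d) \<oplus>\<^bsub>L\<^esub> (Q, d') = (P \<oplus>\<^bsub>CS\<^esub> Q, d \<oplus> d')" "c \<odot>\<^bsub>L\<^esub> (P, d) = (c \<odot>\<^bsub>CS\<^esub> P, c \<odot> d)"
  by (simp_all add: g_tilde_def module.extend_def direct_sum_def)

lemma L_bracket: "bracket L (P, d) (Q, d') = (current_bracket g A P Q \<oplus>\<^bsub>CS\<^esub> current_deriv g A d Q
           \<ominus>\<^bsub>CS\<^esub> current_deriv g A d' P, \<zero>)"
  by (simp add: g_tilde_def module.extend_def lie_alg.fields_def)

lemma L_cspace: "cspace L"
proof -
  have "cvectorspace (g\<lparr>carrier := h''\<rparr>)" by (rule subspace_is_vs[OF h''_sub])
  then have "cspace (direct_sum CS (g\<lparr>carrier := h''\<rparr>))"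
    by (intro cspaceI direct_sum_is_vs cspace_vs[OF CS.cspace_axioms])
  then show ?thesis
    by (rule cspace_cong) (simp_all add: g_tilde_def module.extend_def)
qed

sublocale L: env L
proof (intro env.intro env_axioms.intro L_cspace)
  fix X Y assume "X \<in> carrier L" "Y \<in> carrier L"
  moreover obtain P d where "X = (P, d)" by (rule prod.exhaust)
  moreover obtain Q d' where "Y = (Q, d')" by (rule prod.exhaust)
  ultimately show "bracket L X Y \<in> carrier L"
    using sp.csub_zero[OF h''_sub]
    by (simp add: L_bracket current_bracket_in current_deriv_in h''_in)
qed

end

section \<open>Triangular decomposition of Kac-Moody algebras\<close>

context kac_moody
begin

abbreviation "l \<equiv> dim_row C"

text \<open>Q_+ encoded by multisets of indices of simple roots. Linear independence of the simple
  roots makes the passage to weights faithful, see \<open>wt_inj\<close>.\<close>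

definition "degrees = {n :: nat multiset. set_mset n \<subseteq> {..<l}}"

definition wt :: "nat multiset \<Rightarrow> 'g \<Rightarrow> complex" where
  "wt n = (\<lambda>t. \<Sum>i<l. of_nat (count n i) * \<alpha> i t)"

lemma wt_add: "wt (m + n) t = wt m t + wt n t"
  by (simp add: wt_def algebra_simps sum.distrib)

lemma wt_empty: "wt {#} t = 0"
  by (simp add: wt_def)

lemma wt_single: "i < l \<Longrightarrow> wt {#i#} t = \<alpha> i t"
proof -
  assume "i < l"
  have "of_nat (count {#i#} j) * \<alpha> j t = (if j = i then \<alpha> j t else 0)" for j by simp
  then show "wt {#i#} t = \<alpha> i t" using \<open>i < l\<close> by (simp add: wt_def)
qed

lemma wt_add_mset: "i < l \<Longrightarrow> wt (add_mset i n) t = \<alpha> i t + wt n t"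
  using wt_add[of "{#i#}" n t] by (simp add: wt_single)

lemma wt_inj:
  assumes "m \<in> degrees" "n \<in> degrees" "\<And>t. t \<in> h \<Longrightarrow> wt m t = wt n t"
  shows "m = n"
proof (rule multiset_eqI)
  fix i
  show "count m i = count n i"
  proof (cases "i < l")
    case True
    have "\<forall>t\<in>h. (\<Sum>i<l. (of_nat (count m i) - of_nat (count n i)) * \<alpha> i t) = 0"
      using assms(3) by (simp add: wt_def algebra_simps sum_subtractf)
    from root_indep[OF this True] show ?thesis by simp
  next
    case False
    then have "i \<notin># m" "i \<notin># n" using assms(1,2) by (auto simp: degrees_def)
    then show ?thesis by (simp add: not_in_iff)
  qed
qed

lemma wt_nonzero: "n \<in> degrees \<Longrightarrow> n \<noteq> {#} \<Longrightarrow> \<exists>t\<in>h. wt n t \<noteq> 0"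
  using wt_inj[of n "{#}"] by (auto simp: degrees_def wt_empty)

lemma h_in: "t \<in> h \<Longrightarrow> t \<in> carrier g"
  using sp.csub_carrier[OF cartan_subspace] .

text \<open>Pairs of an element of \<open>N\<^sup>+\<close> and the corresponding element of \<open>N\<^sup>-\<close>, obtained from each other
  by exchanging \<open>e i\<close> and \<open>f i\<close>. Keeping both together makes the passage between positive and
  negative root spaces possible without constructing the Chevalley involution.\<close>

inductive chev :: "nat multiset \<Rightarrow> 'g \<Rightarrow> 'g \<Rightarrow> bool" where
  gen: "i < l \<Longrightarrow> chev {#i#} (e i) (f i)"
| step: "\<lbrakk>i < l; chev n x y\<rbrakk> \<Longrightarrow> chev (add_mset i n) (bracket g (e i) x) (bracket g (f i) y)"
| zero: "n \<in> degrees \<Longrightarrow> chev n \<zero> \<zero>"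
| add: "\<lbrakk>chev n x y; chev n x' y'\<rbrakk> \<Longrightarrow> chev n (x \<oplus> x') (y \<oplus> y')"
| smult: "chev n x y \<Longrightarrow> chev n (c \<odot> x) (c \<odot> y)"

lemma chev_degrees: "chev n x y \<Longrightarrow> n \<in> degrees"
  by (induction rule: chev.induct) (auto simp: degrees_def)

lemma chev_in: "chev n x y \<Longrightarrow> x \<in> carrier g \<and> y \<in> carrier g"
  by (induction rule: chev.induct) (auto simp: e_in f_in bracket_closed)

lemma chev_minus: "chev n x y \<Longrightarrow> chev n x' y' \<Longrightarrow> chev n (x \<ominus> x') (y \<ominus> y')"
  using chev.add[OF _ chev.smult[of n x' y' "-1"], of x y] chev_in[of n x' y']
  by (simp add: a_minus_def sp.neg_eq_scale)

lemma chev_empty: "chev n x y \<Longrightarrow> n = {#} \<Longrightarrow> x = \<zero> \<and> y = \<zero>"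
  by (induction rule: chev.induct) auto

lemma bracket_e_cartan: "i < l \<Longrightarrow> t \<in> h \<Longrightarrow> bracket g (e i) t = (- (\<alpha> i t)) \<odot> e i"
  using bracket_antisym[OF e_in h_in] bracket_cartan_e by (simp add: sp.scale_neg_left e_in)

lemma bracket_f_cartan: "i < l \<Longrightarrow> t \<in> h \<Longrightarrow> bracket g (f i) t = \<alpha> i t \<odot> f i"
  using bracket_antisym[OF f_in h_in] bracket_cartan_f by (simp add: sp.scale_neg_left f_in)

lemma chev_derived: "chev n x y \<Longrightarrow> x \<in> derived g \<and> y \<in> derived g"
proof (induction rule: chev.induct)
  case (gen i)
  have a: "\<alpha> i (\<alpha>v i) = 2" using root_coroot[OF gen gen] gcm gen by (simp add: gen_cartan_matrix_def)
  have "bracket g (\<alpha>v i) (e i) \<in> derived g" "bracket g (\<alpha>v i) (f i) \<in> derived g"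
    using gen coroot_in h_in e_in f_in bracket_derived by auto
  then have "2 \<odot> e i \<in> derived g" "(- 2) \<odot> f i \<in> derived g"
    using gen bracket_cartan_e[OF coroot_in] bracket_cartan_f[OF coroot_in] a by auto
  \<comment> \<open>The factors 1/2 and -1/2 invert the eigenvalues 2 and -2 of the coroot on
    \<open>e i\<close> and \<open>f i\<close>.\<close>
  from sp.csub_smult[OF derived_sub this(1), of "1/2"] sp.csub_smult[OF derived_sub this(2), of "-1/2"]
  show ?case using gen e_in f_in by (simp add: sp.scale_scale)
next
  case (step i n x y)
  then show ?case using bracket_derived[OF e_in[OF step(1)]] bracket_derived[OF f_in[OF step(1)]] chev_in by blast
qed (simp_all add: sp.csub_zero[OF derived_sub] sp.csub_add[OF derived_sub] sp.csub_smult[OF derived_sub])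

lemma weight_bracket:
  assumes "t \<in> carrier g" "x \<in> carrier g" "y \<in> carrier g"
    "bracket g t x = a \<odot> x" "bracket g t y = b \<odot> y"
  shows "bracket g t (bracket g x y) = (a + b) \<odot> bracket g x y"
  using jacobi_derivation[OF assms(1-3)] assms
  by (simp add: bracket_smult_left bracket_smult_right bracket_closed sp.scale_add_left)

lemma chev_weight: "chev n x y \<Longrightarrow> t \<in> h \<Longrightarrow>
    bracket g t x = wt n t \<odot> x \<and> bracket g t y = (- wt n t) \<odot> y"
proof (induction rule: chev.induct)
  case (gen i)
  then show ?case by (simp add: wt_single bracket_cartan_e bracket_cartan_f)
next
  case (step i n x y)
  then show ?case
    using weight_bracket[OF h_in e_in, of t i x "\<alpha> i t" "wt n t"]
      weight_bracket[OF h_in f_in, of t i y "- \<alpha> i t" "- wt n t"]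
    by (simp add: chev_in[OF step(2)] bracket_cartan_e bracket_cartan_f wt_add_mset)
next
  case (zero n)
  then show ?case by (simp add: bracket_zero h_in)
next
  case (add n x y x' y')
  then show ?case using chev_in[OF add(1)] chev_in[OF add(2)]
    by (simp add: bracket_add_right h_in sp.scale_add_right)
next
  case (smult n x y c)
  then show ?case using chev_in[OF smult(1)]
    by (simp add: bracket_smult_right h_in sp.scale_scale mult.commute)
qed

text \<open>Induction on the left argument through [[e, x], x'] = [e, [x, x']] - [x, [e, x']] and
  the same identity with f. The last term uses the hypothesis for [e, x'] in place of x', so the
  right argument stays arbitrary.\<close>

lemma chev_bracket: "chev m x y \<Longrightarrow> chev n x' y' \<Longrightarrow> chev (m + n) (bracket g x x') (bracket g y y')"
proof (induction arbitrary: n x' y' rule: chev.induct)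
  case (gen i)
  then show ?case using chev.step[of i n x' y'] by simp
next
  case (step i m x y)
  note c = chev_in[OF step(2)] chev_in[OF step.prems] e_in[OF step(1)] f_in[OF step(1)]
  have 1: "chev (add_mset i (m + n)) (bracket g (e i) (bracket g x x')) (bracket g (f i) (bracket g y y'))"
    by (rule chev.step[OF step(1) step.IH[OF step.prems]])
  have 2: "chev (m + add_mset i n) (bracket g x (bracket g (e i) x')) (bracket g y (bracket g (f i) y'))"
    by (rule step.IH[OF chev.step[OF step(1) step.prems]])
  have "bracket g (bracket g (e i) x) x' = bracket g (e i) (bracket g x x') \<ominus> bracket g x (bracket g (e i) x')"
    "bracket g (bracket g (f i) y) y' = bracket g (f i) (bracket g y y') \<ominus> bracket g y (bracket g (f i) y')"
    using c jacobi_derivation[of "e i" x x'] jacobi_derivation[of "f i" y y']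
    by (simp_all add: bracket_closed sp.add_minus_cancel)
  then show ?case using chev_minus[of "add_mset i (m + n)"] 1 2 by simp
next
  case (zero m)
  have "m + n \<in> degrees" using zero chev_degrees[OF zero(2)] by (auto simp: degrees_def)
  then show ?case using chev_in[OF zero(2)] chev.zero by (simp add: bracket_zero)
next
  case (add m x y x1 y1)
  then show ?case
    using chev_in[OF add(1)] chev_in[OF add(2)] chev_in[OF add.prems] chev.add[OF add.IH[OF add.prems]]
    by (simp add: bracket_add_left)
next
  case (smult m x y c)
  then show ?case
    using chev_in[OF smult(1)] chev_in[OF smult.prems] chev.smult[OF smult.IH[OF smult.prems]]
    by (simp add: bracket_smult_left)
qed

text \<open>Right-nested brackets of the \<open>f i\<close>. The value at the empty word is zero
  because the piece of empty degree is zero.\<close>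

fun f_word :: "nat list \<Rightarrow> 'g" where
  "f_word [] = \<zero>"
| "f_word [i] = f i"
| "f_word (i # w) = bracket g (f i) (f_word w)"

lemma chev_word: "set w \<subseteq> {..<l} \<Longrightarrow> \<exists>x. chev (mset w) x (f_word w)"
proof (induction w rule: f_word.induct)
  case 1
  then show ?case using chev.zero[of "{#}"] by (auto simp: degrees_def)
next
  case (2 i)
  then show ?case using chev.gen by auto
next
  case (3 i j w)
  then show ?case using chev.step[of i] by auto
qed

lemma f_word_in: "n \<in> degrees \<Longrightarrow> f_word ` {w. mset w = n} \<subseteq> carrier g"
  using chev_word chev_in by (fastforce simp: degrees_def)

lemma chev_span_words: "chev n x y \<Longrightarrow> y \<in> span (f_word ` {w. mset w = n})"
proof (induction rule: chev.induct)
  case (gen i)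
  have "f i = f_word [i]" "mset [i] = {#i#}" by simp_all
  then have w: "f i \<in> f_word ` {w. mset w = {#i#}}" by blast
  have "{#i#} \<in> degrees" using gen by (simp add: degrees_def)
  from sp.span_superset[OF f_word_in[OF this] w] show ?case .
next
  case (step i n x y)
  have n: "n \<in> degrees" "add_mset i n \<in> degrees" using chev_degrees[OF step(2)] step(1) by (auto simp: degrees_def)
  note S = sp.span_sub[OF f_word_in[OF n(2)]]
  show ?case
  proof (rule clinear.span_vimage[OF bracket_right[OF f_in[OF step(1)]] S f_word_in[OF n(1)] _ step.IH])
    fix b assume "b \<in> f_word ` {w. mset w = n}"
    then obtain w where w: "b = f_word w" "mset w = n" by auto
    show "bracket g (f i) b \<in> span (f_word ` {w. mset w = add_mset i n})"
    proof (cases w)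
      case Nil
      then show ?thesis using w sp.csub_zero[OF S] by (simp add: bracket_zero f_in step(1))
    next
      case (Cons j v)
      then have "bracket g (f i) b = f_word (i # w)" "mset (i # w) = add_mset i n" using w by simp_all
      then have "bracket g (f i) b \<in> f_word ` {w. mset w = add_mset i n}" by blast
      then show ?thesis by (rule sp.span_superset[OF f_word_in[OF n(2)]])
    qed
  qed
next
  case (zero n)
  then show ?case using sp.csub_zero[OF sp.span_sub[OF f_word_in]] by blast
next
  case (add n x y x' y')
  then show ?case using sp.csub_add[OF sp.span_sub[OF f_word_in]] chev_degrees by blast
next
  case (smult n x y c)
  then show ?case using sp.csub_smult[OF sp.span_sub[OF f_word_in]] chev_degrees by blast
qed

text \<open>The piece of degree -n of the subalgebra generated by the \<open>f i\<close>. It is cut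
  out by \<open>chev\<close> rather than by weights, so each element comes with a partner in N^+ and
  finiteness can be read off words.\<close>

definition neg_part :: "nat multiset \<Rightarrow> 'g set" where
  "neg_part n = {y. \<exists>x. chev n x y}"

lemma neg_part_sub: "n \<in> degrees \<Longrightarrow> csubspace (neg_part n) g"
  by (rule sp.csubI) (auto simp: neg_part_def dest: chev_in intro: chev.zero chev.add chev.smult)

text \<open>Only finitely many words have content n.\<close>

lemma neg_part_fin:
  assumes "n \<in> degrees"
  shows "\<exists>E. finite E \<and> E \<subseteq> neg_part n \<and> neg_part n \<subseteq> span E"
proof (intro exI conjI)
  have "{w. mset w = n} \<subseteq> {w. set w \<subseteq> set_mset n \<and> length w = size n}" by auto
  then have "finite {w. mset w = n}"
    by (rule finite_subset) (simp add: finite_lists_length_eq)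
  then show "finite (f_word ` {w. mset w = n})" by simp
  show "f_word ` {w. mset w = n} \<subseteq> neg_part n"
  proof
    fix y assume "y \<in> f_word ` {w. mset w = n}"
    then obtain w where w: "mset w = n" "y = f_word w" by blast
    then have "set w \<subseteq> {..<l}" using assms unfolding degrees_def by auto
    from chev_word[OF this] show "y \<in> neg_part n" unfolding neg_part_def w(2) w(1)[symmetric] by blast
  qed
  show "neg_part n \<subseteq> span (f_word ` {w. mset w = n})"
    using chev_span_words by (auto simp: neg_part_def)
qed

section \<open>The graph of the Chevalley involution\<close>

lemma stable_ideal:
  assumes S: "csubspace S g"
    and "\<And>t a. t \<in> h \<Longrightarrow> a \<in> S \<Longrightarrow> bracket g t a \<in> S"
    and "\<And>i a. i < l \<Longrightarrow> a \<in> S \<Longrightarrow> bracket g (e i) a \<in> S"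
    and "\<And>i a. i < l \<Longrightarrow> a \<in> S \<Longrightarrow> bracket g (f i) a \<in> S"
  shows "lie_ideal g S"
proof -
  \<comment> \<open>By the Jacobi identity the elements whose bracket preserves S form a subalgebra,
    so it is enough that it contains the generators of g.\<close>
  let ?Z = "{x \<in> carrier g. \<forall>a\<in>S. bracket g x a \<in> S}"
  note SC = sp.csub_carrier[OF S]
  have "csubspace ?Z g"
    by (rule sp.csubI) (auto simp: bracket_zero SC sp.csub_zero[OF S] bracket_add_left sp.csub_add[OF S]
      bracket_smult_left sp.csub_smult[OF S])
  moreover have "bracket g x y \<in> ?Z" if x: "x \<in> ?Z" and y: "y \<in> ?Z" for x y
  proof -
    have "bracket g (bracket g x y) a \<in> S" if a: "a \<in> S" for a
    proof -
      have "bracket g (bracket g x y) a = bracket g x (bracket g y a) \<ominus> bracket g y (bracket g x a)"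
        using jacobi_derivation[of x y a] x y SC[OF a] by (simp add: bracket_closed sp.add_minus_cancel)
      then show ?thesis using x y a sp.csub_minus[OF S] by simp
    qed
    then show ?thesis using x y bracket_closed by simp
  qed
  ultimately have "lie_subalgebra g ?Z" unfolding lie_subalgebra_def by blast
  moreover have "h \<union> e ` {..<l} \<union> f ` {..<l} \<subseteq> ?Z"
    using assms(2-) h_in e_in f_in by auto
  ultimately have "?Z = carrier g" by (rule generated)
  then show ?thesis using S unfolding lie_ideal_def by blast
qed

text \<open>The part of the graph over h + N^+. The sign on h is forced: exchanging
  \<open>e i\<close> and \<open>f i\<close> turns [e i, f i] into its negative.\<close>

inductive half :: "'g \<Rightarrow> 'g \<Rightarrow> bool" where
  chev: "chev n x y \<Longrightarrow> half x y"
| cartan: "t \<in> h \<Longrightarrow> half t (\<ominus> t)"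
| add: "\<lbrakk>half a b; half a' b'\<rbrakk> \<Longrightarrow> half (a \<oplus> a') (b \<oplus> b')"

lemma half_in: "half a b \<Longrightarrow> a \<in> carrier g \<and> b \<in> carrier g"
  by (induction rule: half.induct) (auto dest: chev_in h_in)

lemma half_zero: "half \<zero> \<zero>"
  using half.cartan[OF sp.csub_zero[OF cartan_subspace]] by simp

lemma half_smult: "half a b \<Longrightarrow> half (c \<odot> a) (c \<odot> b)"
proof (induction rule: half.induct)
  case (cartan t)
  then show ?case using half.cartan[OF sp.csub_smult[OF cartan_subspace cartan], of c]
    by (simp add: sp.scale_neg_right h_in)
next
  case (add a b a' b')
  then show ?case using half_in half.add by (simp add: sp.scale_add_right)
qed (auto intro: half.chev chev.smult)

text \<open>The pairs in \<open>tri\<close> are the span of those in \<open>chev\<close>, their transposes and the \<open>(t, -t)\<close>. They form the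
  subalgebra of \<open>g \<times> g\<close> generated by the pairs \<open>(e i, f i)\<close>, \<open>(f i, e i)\<close> and \<open>(t, -t)\<close>, i.e. the graph
  of the Chevalley involution: the kernel of the first projection is an ideal of \<open>g\<close> meeting \<open>h\<close>
  trivially.\<close>

definition tri :: "'g \<Rightarrow> 'g \<Rightarrow> bool" where
  "tri a b \<longleftrightarrow> (\<exists>a1 b1 a2 b2. half a1 b1 \<and> half b2 a2 \<and> a = a1 \<oplus> a2 \<and> b = b1 \<oplus> b2)"

lemma tri_in: "tri a b \<Longrightarrow> a \<in> carrier g \<and> b \<in> carrier g"
  unfolding tri_def using half_in by auto

lemma tri_sym: "tri a b \<Longrightarrow> tri b a"
proof -
  assume "tri a b"
  then obtain a1 b1 a2 b2 where t: "half a1 b1" "half b2 a2" "a = a1 \<oplus> a2" "b = b1 \<oplus> b2"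
    unfolding tri_def by blast
  then have "a = a2 \<oplus> a1" "b = b2 \<oplus> b1" using half_in by (auto simp: a_comm)
  then show "tri b a" unfolding tri_def using t by blast
qed

lemma half_tri: "half a b \<Longrightarrow> tri a b"
  unfolding tri_def using half_zero half_in[of a b]
  by (intro exI[of _ a] exI[of _ b] exI[of _ "\<zero>"]) simp

lemma tri_add: "tri a b \<Longrightarrow> tri a' b' \<Longrightarrow> tri (a \<oplus> a') (b \<oplus> b')"
proof -
  assume "tri a b" "tri a' b'"
  then obtain a1 b1 a2 b2 a1' b1' a2' b2' where t: "half a1 b1" "half b2 a2" "a = a1 \<oplus> a2" "b = b1 \<oplus> b2"
    "half a1' b1'" "half b2' a2'" "a' = a1' \<oplus> a2'" "b' = b1' \<oplus> b2'"
    unfolding tri_def by blast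
  note c = half_in[OF t(1)] half_in[OF t(2)] half_in[OF t(5)] half_in[OF t(6)]
  have "a \<oplus> a' = (a1 \<oplus> a1') \<oplus> (a2 \<oplus> a2')" "b \<oplus> b' = (b1 \<oplus> b1') \<oplus> (b2 \<oplus> b2')"
    using t c by (simp_all add: a_ac)
  then show ?thesis unfolding tri_def using half.add[OF t(1,5)] half.add[OF t(2,6)] by blast
qed

lemma tri_smult: "tri a b \<Longrightarrow> tri (c \<odot> a) (c \<odot> b)"
proof -
  assume "tri a b"
  then obtain a1 b1 a2 b2 where t: "half a1 b1" "half b2 a2" "a = a1 \<oplus> a2" "b = b1 \<oplus> b2"
    unfolding tri_def by blast
  have "c \<odot> a = c \<odot> a1 \<oplus> c \<odot> a2" "c \<odot> b = c \<odot> b1 \<oplus> c \<odot> b2"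
    using t half_in[OF t(1)] half_in[OF t(2)] by (simp_all add: sp.scale_add_right)
  then show ?thesis unfolding tri_def using half_smult[OF t(1)] half_smult[OF t(2)] by blast
qed

lemma half_step: "half a b \<Longrightarrow> i < l \<Longrightarrow> half (bracket g (e i) a) (bracket g (f i) b)"
proof (induction rule: half.induct)
  case (chev n x y)
  then show ?case by (intro half.chev[OF chev.step])
next
  case (cartan t)
  have "bracket g (f i) (\<ominus> t) = (- (\<alpha> i t)) \<odot> f i"
    using cartan bracket_f_cartan clinear.neg[OF bracket_right[OF f_in]] h_in f_in by (simp add: sp.scale_neg_left)
  then show ?case
    using cartan bracket_e_cartan half.chev[OF chev.smult[OF chev.gen], of i "- (\<alpha> i t)"] by simp
next
  case (add a b a' b')
  then show ?case using half_in[OF add(1)] half_in[OF add(2)] e_in f_in half.add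
    by (simp add: bracket_add_right)
qed

text \<open>The partner of t is -t, which accounts for the sign in the second component.\<close>

lemma half_cartan: "half a b \<Longrightarrow> t \<in> h \<Longrightarrow> half (bracket g t a) (\<ominus> bracket g t b)"
proof (induction rule: half.induct)
  case (chev n x y)
  then show ?case using chev_weight[OF chev(1,2)] chev_in[OF chev(1)]
      half.chev[OF chev.smult[OF chev(1), of "wt n t"]]
    by (simp add: sp.scale_neg_left)
next
  case (cartan s)
  then show ?case
    using clinear.neg[OF bracket_right[OF h_in]] h_in half_zero by (simp add: bracket_cartan)
next
  case (add a b a' b')
  have "\<ominus> bracket g t (b \<oplus> b') = (\<ominus> bracket g t b) \<oplus> (\<ominus> bracket g t b')"
    using add half_in[OF add(1)] half_in[OF add(2)] h_in by (simp add: bracket_add_right bracket_closed minus_add)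
  then show ?case using add half_in[OF add(1)] half_in[OF add(2)] h_in half.add
    by (simp add: bracket_add_right)
qed

text \<open>Lowering a simple generator lands in h, so the result is stated with
  \<open>half\<close>. In the step, [f i, [e j, x]] = [[f i, e j], x] + [e j, [f i, x]], and
  likewise with e and f exchanged. For i = j the first terms are multiples of x and y by the same
  scalar: the sign of [f i, e i] and the sign of the weight of y compensate.\<close>

lemma chev_lower: "chev n x y \<Longrightarrow> i < l \<Longrightarrow> half (bracket g (f i) x) (bracket g (e i) y)"
proof (induction rule: chev.induct)
  case (gen j)
  have fe: "bracket g (f i) (e j) = (if i = j then \<ominus> \<alpha>v i else \<zero>)"
    using bracket_antisym[OF f_in e_in, of i j] bracket_e_f[of j i] gen by simp
  show ?case
  proof (cases "i = j")
    case True
    have "half (\<ominus> \<alpha>v i) (\<ominus> (\<ominus> \<alpha>v i))"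
      using gen coroot_in sp.csub_neg[OF cartan_subspace] by (intro half.cartan) blast
    then show ?thesis using True fe gen bracket_e_f h_in coroot_in by simp
  qed (use fe gen bracket_e_f half_zero in simp)
next
  case (step j n x y)
  note c = chev_in[OF step(2)] e_in[OF step(1)] f_in[OF step(1)] e_in[OF step.prems] f_in[OF step.prems]
  have cart: "half (bracket g (bracket g (f i) (e j)) x) (bracket g (bracket g (e i) (f j)) y)"
  proof (cases "i = j")
    case True
    have t: "\<alpha>v i \<in> h" using coroot_in step by blast
    have "bracket g (bracket g (f i) (e j)) x = (- wt n (\<alpha>v i)) \<odot> x"
      using bracket_antisym[OF f_in e_in, of i i] bracket_e_f[of i i] True step.prems c
        clinear.neg[OF bracket_left] h_in[OF t] chev_weight[OF step(2) t] by (simp add: sp.scale_neg_left)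
    moreover have "bracket g (bracket g (e i) (f j)) y = (- wt n (\<alpha>v i)) \<odot> y"
      using bracket_e_f[of i i] True step.prems chev_weight[OF step(2) t] by simp
    ultimately show ?thesis using half.chev[OF chev.smult[OF step(2)]] by simp
  next
    case False
    then show ?thesis
      using bracket_antisym[OF f_in e_in, of i j] bracket_e_f[of j i] bracket_e_f[of i j] step c half_zero
      by (simp add: bracket_zero)
  qed
  have "half (bracket g (e j) (bracket g (f i) x)) (bracket g (f j) (bracket g (e i) y))"
    by (rule half_step[OF step.IH[OF step.prems] step(1)])
  from half.add[OF cart this] show ?case
    using c jacobi_derivation[of "f i" "e j" x] jacobi_derivation[of "e i" "f j" y] by simp
next
  case (zero n)
  then show ?case using half_zero by (simp add: bracket_zero e_in f_in)
next
  case (add n x y x' y')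
  then show ?case using half.add chev_in[OF add(1)] chev_in[OF add(2)]
    by (simp add: bracket_add_right e_in f_in)
next
  case (smult n x y c)
  then show ?case using half_smult chev_in[OF smult(1)] by (simp add: bracket_smult_right e_in f_in)
qed

text \<open>For t in h the bracket [f i, t] is a multiple of \<open>f i\<close>, which lies on the
  transposed side; hence \<open>tri\<close> in the conclusion.\<close>

lemma half_lower: "half a b \<Longrightarrow> i < l \<Longrightarrow> tri (bracket g (f i) a) (bracket g (e i) b)"
proof (induction rule: half.induct)
  case (chev n x y)
  then show ?case by (intro half_tri chev_lower)
next
  case (cartan t)
  have "bracket g (e i) (\<ominus> t) = \<alpha> i t \<odot> e i"
    using cartan bracket_e_cartan clinear.neg[OF bracket_right[OF e_in]] h_in e_in by (simp add: sp.scale_neg_left)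
  moreover have "tri (\<alpha> i t \<odot> f i) (\<alpha> i t \<odot> e i)"
    by (rule tri_sym[OF half_tri[OF half.chev[OF chev.smult[OF chev.gen[OF cartan(2)]]]]])
  ultimately show ?case using cartan bracket_f_cartan by simp
next
  case (add a b a' b')
  then show ?case using half_in[OF add(1)] half_in[OF add(2)] e_in f_in tri_add
    by (simp add: bracket_add_right)
qed

lemma tri_raise: "tri a b \<Longrightarrow> i < l \<Longrightarrow> tri (bracket g (e i) a) (bracket g (f i) b)"
proof -
  assume i: "i < l" and "tri a b"
  then obtain a1 b1 a2 b2 where t: "half a1 b1" "half b2 a2" "a = a1 \<oplus> a2" "b = b1 \<oplus> b2"
    unfolding tri_def by blast
  have "tri (bracket g (e i) a1) (bracket g (f i) b1)" by (rule half_tri[OF half_step[OF t(1) i]])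
  moreover have "tri (bracket g (e i) a2) (bracket g (f i) b2)" by (rule tri_sym[OF half_lower[OF t(2) i]])
  ultimately show ?thesis
    using tri_add t half_in[OF t(1)] half_in[OF t(2)] e_in[OF i] f_in[OF i] by (simp add: bracket_add_right)
qed

lemma tri_lower: "tri a b \<Longrightarrow> i < l \<Longrightarrow> tri (bracket g (f i) a) (bracket g (e i) b)"
  using tri_sym tri_raise by blast

lemma tri_cartan: "tri a b \<Longrightarrow> t \<in> h \<Longrightarrow> tri (bracket g t a) (\<ominus> bracket g t b)"
proof -
  assume t': "t \<in> h" and "tri a b"
  then obtain a1 b1 a2 b2 where t: "half a1 b1" "half b2 a2" "a = a1 \<oplus> a2" "b = b1 \<oplus> b2"
    unfolding tri_def by blast
  note c = half_in[OF t(1)] half_in[OF t(2)] h_in[OF t']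
  have 1: "tri (bracket g t a1) (\<ominus> bracket g t b1)" by (rule half_tri[OF half_cartan[OF t(1) t']])
  have "tri (bracket g t b2) (\<ominus> bracket g t a2)" by (rule half_tri[OF half_cartan[OF t(2) t']])
  from tri_smult[OF tri_sym[OF this], of "-1"] have "tri (bracket g t a2) (\<ominus> bracket g t b2)"
    using c by (simp add: sp.neg_eq_scale[symmetric] bracket_closed)
  from tri_add[OF 1 this] show ?thesis
    using t c by (simp add: bracket_add_right bracket_closed minus_add)
qed

text \<open>The first components are stable under brackets with the generators, hence form an ideal,
  hence a subalgebra; as it contains the generators, it is all of g.\<close>

lemma tri_total: "a \<in> carrier g \<Longrightarrow> \<exists>b. tri a b"
proof -
  assume a: "a \<in> carrier g"
  let ?S = "{a. \<exists>b. tri a b}"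
  have S: "csubspace ?S g"
    by (rule sp.csubI) (use tri_in tri_add tri_smult half_tri[OF half_zero] in blast)+
  have id: "lie_ideal g ?S"
    by (rule stable_ideal[OF S]) (use tri_cartan tri_raise tri_lower in blast)+
  have "lie_subalgebra g ?S"
    using S id sp.csub_carrier[OF S] unfolding lie_subalgebra_def lie_ideal_def by blast
  moreover have "h \<union> e ` {..<l} \<union> f ` {..<l} \<subseteq> ?S"
    using half_tri[OF half.cartan] half_tri[OF half.chev[OF chev.gen]] tri_sym by blast
  ultimately have "?S = carrier g" by (rule generated)
  then show ?thesis using a by blast
qed

section \<open>Triangular decomposition and the symmetry between positive and negative roots\<close>

definition root_vectors :: "'g set" where
  "root_vectors = {x. \<exists>n y. n \<noteq> {#} \<and> (chev n x y \<or> chev n y x)}"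

lemma root_vectors_in: "root_vectors \<subseteq> carrier g"
  unfolding root_vectors_def using chev_in by blast

lemma root_vectors_derived: "root_vectors \<subseteq> derived g"
  unfolding root_vectors_def using chev_derived by blast

text \<open>The opposite Cartan components tie the two decompositions together: if the Cartan part
  of a vanishes, so does that of b.\<close>

abbreviation "decomposed a b \<equiv> \<exists>t\<in>h. \<exists>w\<in>span root_vectors. \<exists>w'\<in>span root_vectors.
  a = t \<oplus> w \<and> b = \<ominus> t \<oplus> w'"

lemma decomposed_sym: "decomposed a b \<Longrightarrow> decomposed b a"
proof -
  assume "decomposed a b"
  then obtain t w v where t: "t \<in> h" "w \<in> span root_vectors" "v \<in> span root_vectors"
    "a = t \<oplus> w" "b = \<ominus> t \<oplus> v" by blast
  then have "a = \<ominus> (\<ominus> t) \<oplus> w" using h_in by simp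
  then show ?thesis using t sp.csub_neg[OF cartan_subspace t(1)] by blast
qed

lemma decomposed_add: "decomposed a b \<Longrightarrow> decomposed a' b' \<Longrightarrow> decomposed (a \<oplus> a') (b \<oplus> b')"
proof -
  note S = sp.span_sub[OF root_vectors_in]
  assume "decomposed a b" "decomposed a' b'"
  then obtain t w v s u z where 1: "t \<in> h" "w \<in> span root_vectors" "v \<in> span root_vectors"
    "a = t \<oplus> w" "b = \<ominus> t \<oplus> v" and 2: "s \<in> h" "u \<in> span root_vectors" "z \<in> span root_vectors"
    "a' = s \<oplus> u" "b' = \<ominus> s \<oplus> z" by blast
  note c = h_in[OF 1(1)] h_in[OF 2(1)] sp.csub_carrier[OF S 1(2)] sp.csub_carrier[OF S 1(3)]
    sp.csub_carrier[OF S 2(2)] sp.csub_carrier[OF S 2(3)]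
  have "a \<oplus> a' = (t \<oplus> s) \<oplus> (w \<oplus> u)" "b \<oplus> b' = \<ominus> (t \<oplus> s) \<oplus> (v \<oplus> z)"
    using c 1(4,5) 2(4,5) by (simp_all add: a_ac minus_add)
  then show ?thesis
    using sp.csub_add[OF cartan_subspace 1(1) 2(1)] sp.csub_add[OF S 1(2) 2(2)] sp.csub_add[OF S 1(3) 2(3)]
    by blast
qed

lemma half_decomposed: "half a b \<Longrightarrow> decomposed a b"
proof (induction rule: half.induct)
  case (chev n x y)
  note S = sp.span_sub[OF root_vectors_in]
  have "x \<in> span root_vectors \<and> y \<in> span root_vectors"
  proof (cases "n = {#}")
    case True
    then show ?thesis using chev_empty[OF chev] sp.csub_zero[OF S] by simp
  next
    case False
    then have "x \<in> root_vectors" "y \<in> root_vectors" using chev unfolding root_vectors_def by blast+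
    then show ?thesis using sp.span_superset[OF root_vectors_in] by blast
  qed
  then show ?case using chev_in[OF chev] sp.csub_zero[OF cartan_subspace]
    by (intro bexI[of _ "\<zero>"] bexI[of _ x] bexI[of _ y]) simp_all
next
  case (cartan t)
  then show ?case using sp.csub_zero[OF sp.span_sub[OF root_vectors_in]] h_in
    by (intro bexI[of _ t] bexI[of _ "\<zero>"]) simp_all
next
  case (add a b a' b')
  then show ?case by (intro decomposed_add)
qed

lemma tri_decomp: "tri a b \<Longrightarrow> decomposed a b"
  unfolding tri_def using decomposed_add[OF half_decomposed decomposed_sym[OF half_decomposed]] by blast

text \<open>Elements of h have weight 0, while root vectors have the nonzero weights
  \<open>wt n\<close> and \<open>- wt n\<close>. The weight decomposition therefore puts t into the
  span of the empty set.\<close>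

lemma cartan_root_vectors: "t \<in> h \<Longrightarrow> t \<in> span root_vectors \<Longrightarrow> t = \<zero>"
proof -
  assume t: "t \<in> h" "t \<in> span root_vectors"
  let ?U = "\<lambda>(n, b). if b then {x. \<exists>y. chev n x y} else {y. \<exists>x. chev n x y}"
  let ?wt = "\<lambda>(n, b) s. if b then wt n s else - wt n s"
  let ?S = "(degrees - {{#}}) \<times> UNIV"
  have U: "root_vectors \<subseteq> (\<Union>i\<in>?S. ?U i)"
  proof
    fix x assume "x \<in> root_vectors"
    then obtain n y where n: "n \<noteq> {#}" "chev n x y \<or> chev n y x" unfolding root_vectors_def by blast
    then have d: "n \<in> degrees" using chev_degrees by blast
    from n(2) show "x \<in> (\<Union>i\<in>?S. ?U i)"
    proof
      assume "chev n x y"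
      then have "x \<in> ?U (n, True)" by auto
      then show ?thesis using n d by blast
    next
      assume "chev n y x"
      then have "x \<in> ?U (n, False)" by auto
      then show ?thesis using n d by blast
    qed
  qed
  have "t \<in> span (\<Union>i\<in>{i \<in> ?S. \<forall>s\<in>h. ?wt i s = 0}. ?U i)"
  proof (rule sp.weight_decomposition[where D="bracket g" and h=h and wt="?wt" and \<mu>="\<lambda>_. 0"])
    show "clinear g g (bracket g x)" if "x \<in> h" for x using bracket_right h_in that by blast
    show "?U i \<subseteq> carrier g" for i using chev_in by (auto split: if_splits prod.splits)
    show "bracket g s u = ?wt i s \<odot> u" if "s \<in> h" "u \<in> ?U i" for i s u
      using that chev_weight by (auto split: if_splits prod.splits)
    show "t \<in> span (\<Union>i\<in>?S. ?U i)" using span_is_monotone[OF U] t(2) by blast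
    show "bracket g s t = 0 \<odot> t" if "s \<in> h" for s
      using bracket_cartan[OF that t(1)] h_in[OF t(1)] by simp
  qed
  moreover have "\<not> (\<forall>s\<in>h. ?wt i s = 0)" if i: "i \<in> ?S" for i
  proof -
    obtain n b where nb: "i = (n, b)" by (rule prod.exhaust)
    then obtain s where "s \<in> h" "wt n s \<noteq> 0" using wt_nonzero[of n] i by auto
    then show ?thesis using nb by (intro notI) (auto split: if_splits dest!: bspec[of _ _ s])
  qed
  then have "{i \<in> ?S. \<forall>s\<in>h. ?wt i s = 0} = {}" by blast
  ultimately have "t \<in> span {}" by (simp only: UN_empty)
  then show ?thesis using sp.span_least_mem[OF sp.csub_zero_space] by blast
qed

text \<open>For a in h with partner 0, the decomposition of 0 gives t = -w in h and in the span of
  root vectors, so t = 0. Then a = w' lies in both spaces as well and vanishes.\<close>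

lemma tri_zero_left: "tri \<zero> y \<Longrightarrow> y = \<zero>"
proof -
  let ?J = "{y. tri \<zero> y}"
  assume y: "tri \<zero> y"
  note S = sp.span_sub[OF root_vectors_in]
  have J: "csubspace ?J g"
  proof (rule sp.csubI)
    show "a \<oplus> b \<in> ?J" if "a \<in> ?J" "b \<in> ?J" for a b using that tri_add[of "\<zero>" a "\<zero>" b] by simp
    show "c \<odot> a \<in> ?J" if "a \<in> ?J" for a c using that tri_smult[of "\<zero>" a c] by simp
  qed (use tri_in half_tri[OF half_zero] in auto)
  have "lie_ideal g ?J"
  proof (rule stable_ideal[OF J])
    show "bracket g t a \<in> ?J" if t: "t \<in> h" and a: "a \<in> ?J" for t a
    proof -
      have "tri (bracket g t \<zero>) (\<ominus> bracket g t a)" using tri_cartan t a by blast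
      from tri_smult[OF this, of "-1"] show ?thesis
        using h_in[OF t] sp.csub_carrier[OF J a]
        by (simp add: bracket_zero sp.neg_eq_scale[symmetric] bracket_closed)
    qed
    \<comment> \<open>On second components the generators are exchanged: \<open>e i\<close> acts
      there through \<open>tri_lower\<close>.\<close>
    show "bracket g (e i) a \<in> ?J" if "i < l" "a \<in> ?J" for i a
      using tri_lower[of "\<zero>" a i] that by (simp add: bracket_zero f_in)
    show "bracket g (f i) a \<in> ?J" if "i < l" "a \<in> ?J" for i a
      using tri_raise[of "\<zero>" a i] that by (simp add: bracket_zero e_in)
  qed
  moreover have "?J \<inter> h = {\<zero>}"
  proof -
    have "a = \<zero>" if a: "tri \<zero> a" "a \<in> h" for a
    proof -
      obtain t w w' where t: "t \<in> h" "w \<in> span root_vectors" "w' \<in> span root_vectors"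
        "\<zero> = t \<oplus> w" "a = \<ominus> t \<oplus> w'" using tri_decomp[OF a(1)] by blast
      note c = h_in[OF t(1)] sp.csub_carrier[OF S t(2)] sp.csub_carrier[OF S t(3)]
      have "w \<oplus> t = \<zero>" using t(4) c by (simp add: a_comm)
      then have w: "\<ominus> t = w" using c by (intro minus_equality)
      have "\<ominus> t = \<zero>"
        by (rule cartan_root_vectors) (use t(1,2) sp.csub_neg[OF cartan_subspace] w in auto)
      then have "\<ominus> (\<ominus> t) = \<zero>" by simp
      then have "t = \<zero>" using c by simp
      then have "a = w'" using t(5) c by simp
      then show ?thesis using cartan_root_vectors a(2) t(3) by blast
    qed
    then show ?thesis using half_tri[OF half_zero] sp.csub_zero[OF cartan_subspace] by blast
  qed
  ultimately have "?J = {\<zero>}" by (rule ideal_trivial)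
  then show ?thesis using y by blast
qed

text \<open>The involution is well defined, so a pair (0, y) forces y = 0. This transfers a nonzero
  vector from a negative root space to the opposite positive one.\<close>

lemma chev_nonzero: "chev n x y \<Longrightarrow> y \<noteq> \<zero> \<Longrightarrow> x \<noteq> \<zero>"
  using tri_zero_left half_tri half.chev by blast

lemma chev_root:
  assumes "chev n x y" "n \<noteq> {#}" "x \<noteq> \<zero>"
  shows "wt n \<in> pos_roots g h l \<alpha>"
proof -
  have "wt n \<in> Q_plus l \<alpha>" unfolding Q_plus_def wt_def by blast
  moreover have "wt n \<noteq> 0" using wt_nonzero[OF chev_degrees[OF assms(1)] assms(2)] by auto
  moreover have "x \<in> root_space g h (wt n)"
    unfolding root_space_def using chev_in[OF assms(1)] chev_weight[OF assms(1)] by simp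
  ultimately show ?thesis unfolding pos_roots_def using assms(3) by auto
qed

lemma chev_nilp_plus: "chev n x y \<Longrightarrow> n \<noteq> {#} \<Longrightarrow> x \<in> nilp_plus g h l \<alpha>"
proof -
  assume c: "chev n x y" "n \<noteq> {#}"
  have R: "(\<Union>\<beta>\<in>pos_roots g h l \<alpha>. root_space g h \<beta>) \<subseteq> carrier g" by (auto simp: root_space_def)
  show ?thesis
  proof (cases "x = \<zero>")
    case True
    then show ?thesis unfolding nilp_plus_def using sp.csub_zero[OF sp.span_sub[OF R]] by simp
  next
    case False
    have "x \<in> root_space g h (wt n)"
      unfolding root_space_def using chev_in[OF c(1)] chev_weight[OF c(1)] by simp
    then show ?thesis unfolding nilp_plus_def
      using chev_root[OF c False] by (intro sp.span_superset[OF R]) blast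
  qed
qed

lemma neg_part_root:
  assumes "y \<in> neg_part n" "n \<noteq> {#}" "y \<noteq> \<zero>"
  shows "wt n \<in> pos_roots g h l \<alpha>" "y \<in> root_space g h (- wt n)"
proof -
  obtain x where c: "chev n x y" using assms(1) unfolding neg_part_def by blast
  show "wt n \<in> pos_roots g h l \<alpha>" using chev_root[OF c assms(2) chev_nonzero[OF c assms(3)]] .
  show "y \<in> root_space g h (- wt n)"
    unfolding root_space_def using chev_in[OF c] chev_weight[OF c] by simp
qed

text \<open>Root vectors already lie in g', so subtracting the root part of x leaves a Cartan part
  in g' \<inter> h.\<close>

lemma derived_span: "derived g \<subseteq> span (cartan' g h \<union> root_vectors)"
proof
  fix x assume x: "x \<in> derived g"
  have cc: "cartan' g h \<union> root_vectors \<subseteq> carrier g"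
    using root_vectors_in h_in by (auto simp: cartan'_def)
  note S = sp.span_sub[OF cc]
  obtain b where "tri x b" using tri_total derived_in[OF x] by blast
  then obtain t w where t: "t \<in> h" "w \<in> span root_vectors" "x = t \<oplus> w" using tri_decomp by blast
  have w: "w \<in> derived g" using sp.span_least_mem[OF derived_sub root_vectors_derived t(2)] .
  have "t = x \<ominus> w" using t(3) h_in[OF t(1)] derived_in[OF w] by (simp add: sp.add_minus_cancel)
  then have "t \<in> cartan' g h" using sp.csub_minus[OF derived_sub x w] t(1) by (simp add: cartan'_def)
  then have "t \<in> span (cartan' g h \<union> root_vectors)" by (intro sp.span_superset[OF cc]) blast
  moreover have "w \<in> span (cartan' g h \<union> root_vectors)"
    using span_is_monotone[of root_vectors "cartan' g h \<union> root_vectors"] t(2) by blast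
  ultimately show "x \<in> span (cartan' g h \<union> root_vectors)" using sp.csub_add[OF S] t(3) by blast
qed

end

section \<open>Highest weight modules\<close>

locale km_current = kac_moody g h C e f \<alpha>v \<alpha> + current g A h''
  for g :: "('g, 'm) lie_alg_scheme" (structure) and h :: "'g set" and C :: "int mat"
    and e f \<alpha>v :: "nat \<Rightarrow> 'g" and \<alpha> :: "nat \<Rightarrow> 'g \<Rightarrow> complex"
    and A :: "(complex, 'a, 'n) module_scheme" and h'' :: "'g set" +
  fixes \<psi> :: "('g, 'a) current \<times> 'g \<Rightarrow> complex" and Is :: "('g \<Rightarrow> complex) \<Rightarrow> 'a set"
  assumes complement: "cartan_complement g h h''"
    and cofinite: "\<beta> \<in> pos_roots g h (dim_row C) \<alpha> \<Longrightarrow> cofinite_ideal A (Is \<beta>)"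
begin

abbreviation "B \<equiv> borel_tilde g A h h'' l \<alpha>"
abbreviation "\<chi> \<equiv> borel_char g A h h'' l \<alpha> \<psi>"
abbreviation "M \<equiv> verma g A h h'' l \<alpha> \<psi>"
abbreviation "hv \<equiv> verma_hwv g A h h'' l \<alpha> \<psi>"
abbreviation "N \<equiv> verma_submodule g A h h'' l \<alpha> \<psi> Is"
abbreviation "R \<equiv> verma_quotient g A h h'' l \<alpha> \<psi> Is"
abbreviation "hemb \<equiv> cartan_emb g A h h''"

text \<open>Roots are functions on the whole type; since they vanish outside h, a nonzero value must
  occur on h.\<close>

lemma pos_root_nonzero: "\<beta> \<in> pos_roots g h l \<alpha> \<Longrightarrow> \<exists>t\<in>h. \<beta> t \<noteq> 0"
proof -
  assume "\<beta> \<in> pos_roots g h l \<alpha>"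
  then obtain n where n: "\<beta> = (\<lambda>x. \<Sum>i<l. of_nat (n i) * \<alpha> i x)" and "\<beta> \<noteq> 0"
    unfolding pos_roots_def Q_plus_def by blast
  then obtain t where t: "\<beta> t \<noteq> 0" by (auto simp: fun_eq_iff)
  have "\<beta> t = 0" if "t \<notin> h"
    unfolding n using root_in that by (intro sum.neutral) (auto simp: cartan_dual_def)
  then show ?thesis using t by blast
qed

lemma weight_vector_derived:
  assumes "t \<in> h" "c \<noteq> 0" "x \<in> carrier g" "bracket g t x = c \<odot> x"
  shows "x \<in> derived g"
proof -
  have "x = (1 / c) \<odot> bracket g t x" using assms by (simp add: sp.scale_scale)
  then show ?thesis
    using sp.csub_smult[OF derived_sub bracket_derived[OF h_in[OF assms(1)] assms(3)]] by metis
qed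

lemma root_space_derived:
  assumes "\<beta> \<in> pos_roots g h l \<alpha>"
  shows "root_space g h \<beta> \<subseteq> derived g" "root_space g h (- \<beta>) \<subseteq> derived g"
proof -
  obtain t where t: "t \<in> h" "\<beta> t \<noteq> 0" using pos_root_nonzero[OF assms] by blast
  show "root_space g h \<beta> \<subseteq> derived g"
    using weight_vector_derived[OF t] t(1) by (auto simp: root_space_def)
  show "root_space g h (- \<beta>) \<subseteq> derived g"
    using weight_vector_derived[OF t(1), of "- \<beta> t"] t by (auto simp: root_space_def)
qed

lemma nilp_plus_derived: "nilp_plus g h l \<alpha> \<subseteq> derived g"
  unfolding nilp_plus_def using root_space_derived(1) by (intro sp.span_least[OF derived_sub]) blast

section \<open>The Borel subalgebra and the embedded Cartan subalgebra\<close>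

lemma current_sub_in:
  assumes "S \<subseteq> derived g"
  shows "csubspace (current_sub g A S (carrier A)) CS"
    "\<lbrakk>x \<in> S; a \<in> carrier A\<rbrakk> \<Longrightarrow> tensor D A x a \<in> current_sub g A S (carrier A)"
proof -
  have c: "{tensor D A x a |x a. x \<in> S \<and> a \<in> carrier A} \<subseteq> carrier CS"
    using assms tensor_in_current by blast
  show "csubspace (current_sub g A S (carrier A)) CS"
    unfolding current_sub_def by (rule CS.span_sub[OF c])
  show "tensor D A x a \<in> current_sub g A S (carrier A)" if "x \<in> S" "a \<in> carrier A"
    unfolding current_sub_def by (rule CS.span_superset[OF c]) (use that in blast)
qed

lemma cartan'_derived: "cartan' g h \<subseteq> derived g"
  by (auto simp: cartan'_def)

lemma zero_nilp: "\<zero>\<^bsub>L\<^esub> \<in> nilp_plus_tilde g A h l \<alpha>"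
  using CS.csub_zero[OF current_sub_in(1)[OF nilp_plus_derived]] by (simp add: nilp_plus_tilde_def)

lemma zero_h_tilde: "\<zero>\<^bsub>L\<^esub> \<in> h_tilde g A h h''"
  using CS.csub_zero[OF current_sub_in(1)[OF cartan'_derived]] sp.csub_zero[OF h''_sub]
  by (simp add: h_tilde_def)

lemma nilp_in: "nilp_plus_tilde g A h l \<alpha> \<subseteq> carrier L"
  using CS.csub_carrier[OF current_sub_in(1)[OF nilp_plus_derived]] sp.csub_zero[OF h''_sub]
  by (auto simp: nilp_plus_tilde_def)

lemma h_tilde_in: "h_tilde g A h h'' \<subseteq> carrier L"
  using CS.csub_carrier[OF current_sub_in(1)[OF cartan'_derived]] by (auto simp: h_tilde_def)

lemma B_mem: "z \<in> B \<longleftrightarrow> (\<exists>n\<in>nilp_plus_tilde g A h l \<alpha>. \<exists>t\<in>h_tilde g A h h''. z = n \<oplus>\<^bsub>L\<^esub> t)"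
  unfolding borel_tilde_def set_add_def' by blast

lemma nilp_B: "z \<in> nilp_plus_tilde g A h l \<alpha> \<Longrightarrow> z \<in> B"
proof -
  assume z: "z \<in> nilp_plus_tilde g A h l \<alpha>"
  then have "z = z \<oplus>\<^bsub>L\<^esub> \<zero>\<^bsub>L\<^esub>" using L.r_zero[of z] nilp_in by auto
  then show "z \<in> B" unfolding B_mem using z zero_h_tilde by blast
qed

lemma h_tilde_B: "z \<in> h_tilde g A h h'' \<Longrightarrow> z \<in> B"
proof -
  assume z: "z \<in> h_tilde g A h h''"
  then have "z = \<zero>\<^bsub>L\<^esub> \<oplus>\<^bsub>L\<^esub> z" using L.l_zero[of z] h_tilde_in by auto
  then show "z \<in> B" unfolding B_mem using z zero_nilp by blast
qed

lemma B_in: "B \<subseteq> carrier L"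
  unfolding B_mem subset_iff using nilp_in h_tilde_in L.a_closed by blast

sublocale ind: induced L B \<chi>
  by (intro induced.intro induced_axioms.intro L.env_axioms B_in)

lemma T_in: "x \<in> derived g \<Longrightarrow> a \<in> carrier A \<Longrightarrow> T x a \<in> carrier L"
  using tensor_in_current sp.csub_zero[OF h''_sub] by (simp add: pure_def)

lemma CS_L_linear: "clinear CS L (\<lambda>P. (P, \<zero>))"
  by (rule clinearI[OF CS.cspace_axioms L.cspace_axioms]) (simp_all add: sp.csub_zero[OF h''_sub])

lemma T_left: "a \<in> carrier A \<Longrightarrow> clinear D L (\<lambda>x. T x a)"
  unfolding pure_def by (rule clinear_comp[OF CS_L_linear tensor_lin_left])

lemma T_right: "x \<in> derived g \<Longrightarrow> clinear A L (T x)"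
proof -
  assume "x \<in> derived g"
  then have "clinear A CS (tensor D A x)" by (intro tensor_lin_right) simp
  from clinear_comp[OF CS_L_linear this] show ?thesis unfolding pure_def .
qed

lemma tensor_zero: "a \<in> carrier A \<Longrightarrow> tensor D A \<zero> a = \<zero>\<^bsub>CS\<^esub>"
  using clinear.zero[OF tensor_lin_left, of a] by simp

lemma deriv_zero: "x \<in> derived g \<Longrightarrow> a \<in> carrier A \<Longrightarrow> current_deriv g A \<zero> (tensor D A x a) = \<zero>\<^bsub>CS\<^esub>"
  using current_deriv_tensor[of "\<zero>" x a] derived_in by (simp add: bracket_zero tensor_zero)

lemma T_bracket:
  assumes "x \<in> derived g" "y \<in> derived g" "a \<in> carrier A" "b \<in> carrier A"
  shows "bracket L (T x a) (T y b) = T (bracket g x y) (a \<otimes>\<^bsub>A\<^esub> b)"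
proof -
  have "tensor D A (bracket g x y) (a \<otimes>\<^bsub>A\<^esub> b) \<in> carrier CS"
    using assms by (intro tensor_in_current bracket_derived derived_in A.m_closed)
  then show ?thesis
    using assms by (simp add: pure_def L_bracket deriv_zero current_bracket_tensor CS.minus_zero_right)
qed

text \<open>Two decompositions of t differ by an element z - z' = d' - d of h' \<inter> h'' = 0, so
  the description in \<open>cartan_emb\<close> has a unique solution.\<close>

lemma emb_eq:
  assumes "t \<in> h"
  obtains z d where "z \<in> cartan' g h" "d \<in> h''" "t = z \<oplus> d" "hemb t = (tensor D A z \<one>\<^bsub>A\<^esub>, d)"
proof -
  have cs: "cartan' g h \<inter> h'' = {\<zero>}" "cartan' g h <+> h'' = h"
    using complement unfolding cartan_complement_def by auto
  have c': "csubspace (cartan' g h) g"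
    unfolding cartan'_def by (rule sp.csub_Int[OF derived_sub cartan_subspace])
  obtain z d where zd: "z \<in> cartan' g h" "d \<in> h''" "t = z \<oplus> d"
    using assms cs(2) unfolding set_add_def' by blast
  have uniq: "z' = z \<and> d' = d" if z': "z' \<in> cartan' g h" "d' \<in> h''" "t = z' \<oplus> d'" for z' d'
  proof -
    note c = sp.csub_carrier[OF c' zd(1)] h''_in[OF zd(2)] sp.csub_carrier[OF c' z'(1)] h''_in[OF z'(2)]
    have "z \<ominus> z' = (z \<oplus> d) \<ominus> (z' \<oplus> d)" using c by (simp add: sp.minus_add_add)
    also have "\<dots> = (z' \<oplus> d') \<ominus> (z' \<oplus> d)" using zd(3) z'(3) by simp
    also have "\<dots> = d' \<ominus> d" using c sp.minus_add_add[of d' d z'] by (simp add: a_comm)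
    finally have eq: "z \<ominus> z' = d' \<ominus> d" .
    then have "z \<ominus> z' \<in> cartan' g h \<inter> h''"
      using sp.csub_minus[OF c' zd(1) z'(1)] sp.csub_minus[OF h''_sub z'(2) zd(2)] by simp
    then have 0: "z \<ominus> z' = \<zero>" using cs(1) by blast
    then have "d' \<ominus> d = \<zero>" using eq by simp
    then show ?thesis using 0 sp.eq_of_minus_zero c by blast
  qed
  have "hemb t = (tensor D A z \<one>\<^bsub>A\<^esub>, d)"
    unfolding cartan_emb_def by (rule the_equality) (use zd uniq in blast)+
  then show ?thesis using that zd by blast
qed

lemma emb_h_tilde: "t \<in> h \<Longrightarrow> hemb t \<in> h_tilde g A h h''"
proof -
  assume "t \<in> h"
  then obtain z d where "z \<in> cartan' g h" "d \<in> h''" "hemb t = (tensor D A z \<one>\<^bsub>A\<^esub>, d)"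
    by (rule emb_eq)
  then show ?thesis
    using current_sub_in(2)[OF cartan'_derived] by (simp add: h_tilde_def)
qed

text \<open>With t = z + d, the part z \<otimes> 1 contributes [z, y] \<otimes> a through the
  current bracket, and d contributes [d, y] \<otimes> a as a derivation.\<close>

lemma emb_bracket:
  assumes t: "t \<in> h" and y: "y \<in> derived g" and a: "a \<in> carrier A"
  shows "bracket L (hemb t) (T y a) = T (bracket g t y) a"
proof -
  obtain z d where zd: "z \<in> cartan' g h" "d \<in> h''" "t = z \<oplus> d" "hemb t = (tensor D A z \<one>\<^bsub>A\<^esub>, d)"
    using t by (rule emb_eq)
  have z: "z \<in> derived g" using zd(1) cartan'_derived by blast
  note c = derived_in[OF z] derived_in[OF y] h''_in[OF zd(2)]
  have zy: "bracket g z y \<in> carrier D" "bracket g d y \<in> carrier D" using c bracket_derived by simp_all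
  have "bracket L (hemb t) (T y a)
    = (tensor D A (bracket g z y) (\<one>\<^bsub>A\<^esub> \<otimes>\<^bsub>A\<^esub> a) \<oplus>\<^bsub>CS\<^esub> tensor D A (bracket g d y) a \<ominus>\<^bsub>CS\<^esub> \<zero>\<^bsub>CS\<^esub>, \<zero>)"
    using zd(4) z y a c
    by (simp add: pure_def L_bracket bracket_zero tensor_zero current_bracket_tensor current_deriv_tensor)
  also have "\<dots> = (tensor D A (bracket g z y) a \<oplus>\<^bsub>CS\<^esub> tensor D A (bracket g d y) a, \<zero>)"
    using a tensor_in_current[OF _ a] zy by (simp add: CS.minus_zero_right)
  also have "\<dots> = T (bracket g z y \<oplus> bracket g d y) a"
    using clinear.add[OF tensor_lin_left[OF a] zy] by (simp add: pure_def)
  finally show ?thesis using c zd(3) by (simp add: bracket_add_left)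
qed

lemma ideal_A_sub: "ideal J A \<Longrightarrow> csubspace J A"
proof (rule ideal_csub[OF Av.cspace_axioms])
  fix c x assume "x \<in> carrier A"
  then show "c \<odot>\<^bsub>A\<^esub> x = (c \<odot>\<^bsub>A\<^esub> \<one>\<^bsub>A\<^esub>) \<otimes>\<^bsub>A\<^esub> x" using A.smult_assoc2[of c "\<one>\<^bsub>A\<^esub>" x] by simp
qed

section \<open>The quotient of the Verma module as a cyclic representation\<close>

abbreviation "gens \<equiv> {act M (T X a) hv |\<beta> X a.
        \<beta> \<in> pos_roots g h l \<alpha> \<and> X \<in> root_space g h (- \<beta>) \<and> a \<in> Is \<beta>}"

lemma M_eq: "M = ind.M" "hv = induced_vec L B \<chi>"
  by (simp_all add: verma_def verma_hwv_def)

lemma gens_in: "gens \<subseteq> carrier ind.M"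
proof
  fix m assume "m \<in> gens"
  then obtain \<beta> X a where b: "m = act M (T X a) hv" "\<beta> \<in> pos_roots g h l \<alpha>"
    "X \<in> root_space g h (- \<beta>)" "a \<in> Is \<beta>" by blast
  have "a \<in> carrier A"
    using Av.csub_carrier[OF ideal_A_sub] cofinite[OF b(2)] b(4) by (auto simp: cofinite_ideal_def)
  moreover have "X \<in> derived g" using root_space_derived(2)[OF b(2)] b(3) by blast
  ultimately show "m \<in> carrier ind.M"
    using ind.rep.act_in[OF T_in ind.vec_in] b(1) unfolding M_eq by simp
qed

lemma N_eq: "N = lie_submodule L ind.M hull gens"
  by (simp add: verma_submodule_def M_eq)

lemma N_submodule: "lie_submodule L ind.M N"
  unfolding N_eq by (rule ind.rep.submodule_hull[OF gens_in])

lemma R_eq: "R = quot_rep ind.M N"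
  by (simp add: verma_quotient_def M_eq)

sublocale R: lrep L R
  unfolding R_eq by (rule ind.rep.quot_rep_lrep[OF N_submodule])

abbreviation "v \<equiv> N +>\<^bsub>ind.M\<^esub> hv"

lemma hv_in: "hv \<in> carrier ind.M"
  unfolding M_eq by (rule ind.vec_in)

lemma v_in: "v \<in> carrier R"
  unfolding R_eq ind.rep.quot_rep_simps[OF N_submodule]
  by (rule ind.M.quot_in[OF ind.rep.N_sub[OF N_submodule] hv_in])

lemma act_v: "x \<in> carrier L \<Longrightarrow> act R x v = N +>\<^bsub>ind.M\<^esub> act ind.M x hv"
  unfolding R_eq by (rule ind.rep.quot_act[OF N_submodule _ hv_in])

lemma B_v: "z \<in> B \<Longrightarrow> act R z v = \<chi> z \<odot>\<^bsub>R\<^esub> v"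
  using act_v[of z] ind.act_vec[of z] B_in
    ind.M.quot_smult[OF ind.rep.N_sub[OF N_submodule] hv_in, of "\<chi> z"]
  unfolding R_eq ind.rep.quot_rep_simps[OF N_submodule] M_eq by auto

lemma R_zero: "\<zero>\<^bsub>R\<^esub> = N"
  unfolding R_eq ind.rep.quot_rep_simps[OF N_submodule]
  by (rule ind.M.quot_zero[OF ind.rep.N_sub[OF N_submodule]])

lemma R_cyclic:
  assumes "csubspace W R" "v \<in> W" "\<And>x m. x \<in> carrier L \<Longrightarrow> m \<in> W \<Longrightarrow> act R x m \<in> W"
  shows "carrier R \<subseteq> W"
  using assms unfolding R_eq M_eq
  by (intro ind.rep.quot_rep_cyclic[OF N_submodule ind.induced_cyclic ind.vec_in]) auto

text \<open>Where \<open>wt n\<close> is not a positive root the ideal is all of A. This is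
  consistent because, for nonempty n, \<open>neg_part n\<close> is then zero.\<close>

definition Js :: "nat multiset \<Rightarrow> 'a set" where
  "Js n = (if wt n \<in> pos_roots g h l \<alpha> then Is (wt n) else carrier A)"

lemma Js_ideal: "ideal (Js n) A"
  using cofinite A.oneideal by (auto simp: Js_def cofinite_ideal_def)

lemma Js_cofinite: "\<exists>E. finite E \<and> E \<subseteq> carrier A \<and> cspan A (E \<union> Js n) = carrier A"
proof (cases "wt n \<in> pos_roots g h l \<alpha>")
  case True
  then have "ideal (Js n) A" "cfin_dim (quot_space A (Js n))"
    using cofinite[OF True] by (auto simp: Js_def cofinite_ideal_def)
  then show ?thesis by (elim Av.cofinite_subspace[OF ideal_A_sub]) blast+
next
  case False
  have "cspan A (carrier A) = carrier A"
    using Av.span_superset[of "carrier A"] Av.span_in_carrier[of "carrier A"] by auto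
  then show ?thesis using False by (intro exI[of _ "{}"]) (simp add: Js_def)
qed

text \<open>For nonzero x the symmetry of roots makes \<open>wt n\<close> a positive root, so that
  the vector before passing to the quotient is one of the generators of the submodule.\<close>

lemma Js_v:
  assumes "n \<noteq> {#}" "x \<in> neg_part n" "a \<in> Js n"
  shows "act R (T x a) v = \<zero>\<^bsub>R\<^esub>"
proof -
  have a: "a \<in> carrier A" using Av.csub_carrier[OF ideal_A_sub[OF Js_ideal] assms(3)] .
  have x: "x \<in> derived g" using assms(2) chev_derived by (auto simp: neg_part_def)
  show ?thesis
  proof (cases "x = \<zero>")
    case True
    have "T x a = \<zero>\<^bsub>L\<^esub>" using clinear.zero[OF T_left[OF a]] True by simp
    then show ?thesis using clinear.zero[OF R.act_linear_left[OF v_in]] by simp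
  next
    case False
    have "a \<in> Is (wt n)" using assms(3) neg_part_root(1)[OF assms(2,1) False] by (simp add: Js_def)
    then have "act M (T x a) hv \<in> gens" using neg_part_root[OF assms(2,1) False] by blast
    then have "act ind.M (T x a) hv \<in> N" unfolding N_eq M_eq by (rule hull_inc)
    then show ?thesis
      using act_v[OF T_in[OF x a]] R_zero
        ind.M.coset_eq_self_iff[OF ind.rep.N_sub[OF N_submodule] ind.rep.act_in[OF T_in[OF x a] hv_in]]
      by simp
  qed
qed

section \<open>Verification of the axioms of a graded cyclic module\<close>

lemma neg_part_derived: "neg_part n \<subseteq> derived g"
  using chev_derived by (auto simp: neg_part_def)

lemma neg_T_in: "x \<in> neg_part n \<Longrightarrow> a \<in> carrier A \<Longrightarrow> T x a \<in> carrier L"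
  using neg_part_derived T_in by blast

abbreviation "generators \<equiv> B \<union> {T x a |x a n. n \<in> degrees - {{#}} \<and> x \<in> neg_part n \<and> a \<in> carrier A}"

text \<open>By linearity in x and \<open>derived_span\<close> only three kinds of x remain: elements
  of h' and positive root vectors give elements of the Borel subalgebra, negative ones give
  letters.\<close>

lemma T_span: "x \<in> derived g \<Longrightarrow> a \<in> carrier A \<Longrightarrow>
    T x a \<in> L.span generators"
proof -
  assume x: "x \<in> derived g" and a: "a \<in> carrier A"
  have G: "generators \<subseteq> carrier L" using B_in neg_T_in by blast
  have sub: "cartan' g h \<union> root_vectors \<subseteq> carrier D" using cartan'_derived root_vectors_derived by simp
  have xs: "x \<in> D.span (cartan' g h \<union> root_vectors)"
    using derived_span x span_li_not_depend(1)[of "cartan' g h \<union> root_vectors" "derived g"] derived_sub sub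
    by (auto simp: VectorSpace.subspace_def)
  show "T x a \<in> L.span generators"
  proof (rule clinear.span_vimage[OF T_left[OF a] L.span_sub[OF G] sub _ xs])
    fix b assume "b \<in> cartan' g h \<union> root_vectors"
    then show "T b a \<in> L.span generators"
    proof
      assume "b \<in> cartan' g h"
      then have "T b a \<in> h_tilde g A h h''"
        using current_sub_in(2)[OF cartan'_derived _ a] sp.csub_zero[OF h''_sub]
        by (simp add: h_tilde_def pure_def)
      then show ?thesis using h_tilde_B L.span_superset[OF G] by blast
    next
      assume "b \<in> root_vectors"
      then obtain n y where n: "n \<noteq> {#}" "chev n b y \<or> chev n y b" unfolding root_vectors_def by blast
      from n(2) show ?thesis
      proof
        assume "chev n b y"
        then have "T b a \<in> nilp_plus_tilde g A h l \<alpha>"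
          using current_sub_in(2)[OF nilp_plus_derived chev_nilp_plus[OF _ n(1)] a]
          by (simp add: nilp_plus_tilde_def pure_def)
        then show ?thesis using nilp_B L.span_superset[OF G] by blast
      next
        assume c: "chev n y b"
        then have "n \<in> degrees - {{#}}" "b \<in> neg_part n" using n chev_degrees by (auto simp: neg_part_def)
        then have "T b a \<in> generators" using a by blast
        then show ?thesis by (rule L.span_superset[OF G])
      qed
    qed
  qed
qed

lemma L_span:
  "carrier L \<subseteq> L.span generators"
proof
  have G: "generators \<subseteq> carrier L" using B_in neg_T_in by blast
  fix z assume z: "z \<in> carrier L"
  obtain P d where Pd: "z = (P, d)" by (rule prod.exhaust)
  then have P: "P \<in> carrier CS" and d: "d \<in> h''" using z by simp_all
  have "(P, \<zero>) \<in> L.span generators"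
  proof (rule clinear.span_vimage[OF CS_L_linear L.span_sub[OF G]])
    show "P \<in> CS.span {tensor D A x y |x y. x \<in> carrier D \<and> y \<in> carrier A}"
      using current_span P by blast
    show "{tensor D A x y |x y. x \<in> carrier D \<and> y \<in> carrier A} \<subseteq> carrier CS"
      using tensor_in_current by auto
    fix b assume "b \<in> {tensor D A x y |x y. x \<in> carrier D \<and> y \<in> carrier A}"
    then show "(b, \<zero>) \<in> L.span generators" using T_span by (auto simp: pure_def)
  qed
  moreover have "(\<zero>\<^bsub>CS\<^esub>, d) \<in> h_tilde g A h h''"
    using CS.csub_zero[OF current_sub_in(1)[OF cartan'_derived]] d by (simp add: h_tilde_def)
  then have "(\<zero>\<^bsub>CS\<^esub>, d) \<in> L.span generators" using h_tilde_B L.span_superset[OF G] by blast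
  ultimately have "(P, \<zero>) \<oplus>\<^bsub>L\<^esub> (\<zero>\<^bsub>CS\<^esub>, d) \<in> L.span generators" by (rule L.csub_add[OF L.span_sub[OF G]])
  then show "z \<in> L.span generators" using P h''_in[OF d] Pd by simp
qed

lemma clinear_restrict: "clinear V W F \<Longrightarrow> csubspace S V \<Longrightarrow> clinear (V\<lparr>carrier := S\<rparr>) W F"
proof -
  assume F: "clinear V W F" and S: "csubspace S V"
  interpret F: clinear V W F by (rule F)
  show ?thesis
    by (rule clinearI[OF cspaceI[OF F.V.subspace_is_vs[OF S]] F.W.cspace_axioms])
      (simp_all add: F.V.csub_carrier[OF S] F.closed F.add F.smult)
qed

lemma hemb_in: "t \<in> h \<Longrightarrow> hemb t \<in> carrier L"
  using emb_h_tilde h_tilde_in by blast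

text \<open>The parameter \<open>lam\<close> becomes t \<mapsto> \<open>\<chi> (hemb t)\<close>, the
  scalar by which the embedded Cartan element acts on v.\<close>

lemma graded: "graded_cyclic L R g A degrees neg_part T Js v B h hemb (\<lambda>t. \<chi> (hemb t)) wt"
proof (intro graded_cyclic.intro graded_cyclic_axioms.intro)
  show "m + n \<in> degrees \<longleftrightarrow> m \<in> degrees \<and> n \<in> degrees" for m n by (auto simp: degrees_def)
  show "T x a \<in> carrier L" if "x \<in> neg_part n" "a \<in> carrier A" for n x a
    using that neg_part_derived T_in by blast
  show "clinear (g\<lparr>carrier := neg_part n\<rparr>) L (\<lambda>x. T x a)" if "n \<in> degrees" "a \<in> carrier A" for n a
  proof -
    \<comment> \<open>\<open>T_left\<close> is linear on g'. Restricting g or g' to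
      \<open>neg_part n\<close> gives the same record, since the carrier is overwritten.\<close>
    have "csubspace (neg_part n) D"
      using neg_part_sub[OF that(1)] neg_part_derived by (simp add: D.csub_iff sp.csub_iff)
    from clinear_restrict[OF T_left[OF that(2)] this] show ?thesis by simp
  qed
  show "clinear A L (T x)" if "x \<in> neg_part n" for n x using that neg_part_derived T_right by blast
  show "\<exists>z\<in>neg_part (m + n). bracket L (T x a) (T y b) = T z (a \<otimes>\<^bsub>A\<^esub> b)"
    if "x \<in> neg_part m" "y \<in> neg_part n" "a \<in> carrier A" "b \<in> carrier A" for m n x y a b
  proof -
    have "bracket g x y \<in> neg_part (m + n)" 
      using that(1,2) unfolding neg_part_def by (blast intro: chev_bracket)
    then show ?thesis using T_bracket[of x y a b] that neg_part_derived by blast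
  qed
  show "carrier R \<subseteq> W"
    if "csubspace W R" "v \<in> W" "\<And>x m. x \<in> carrier L \<Longrightarrow> m \<in> W \<Longrightarrow> act R x m \<in> W" for W
    using R_cyclic that by blast
  show "\<exists>c. act R z v = c \<odot>\<^bsub>R\<^esub> v" if "z \<in> B" for z using B_v[OF that] by blast
  show "csubspace (Js n) A" for n by (rule ideal_A_sub[OF Js_ideal])
  show "a \<otimes>\<^bsub>A\<^esub> b \<in> Js n" if "a \<in> Js n" "b \<in> carrier A" for n a b
    using ideal.I_r_closed[OF Js_ideal that] .
  show "act R (T x a) v = \<zero>\<^bsub>R\<^esub>" if "n \<in> degrees - {{#}}" "x \<in> neg_part n" "a \<in> Js n" for n x a
    using Js_v that by blast
  show "hemb t \<in> carrier L" if "t \<in> h" for t using hemb_in[OF that] .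
  show "act R (hemb t) v = \<chi> (hemb t) \<odot>\<^bsub>R\<^esub> v" if "t \<in> h" for t
    using B_v[OF h_tilde_B[OF emb_h_tilde[OF that]]] .
  show "bracket L (hemb t) (T y a) = (- wt n t) \<odot>\<^bsub>L\<^esub> T y a"
    if "t \<in> h" "y \<in> neg_part n" "a \<in> carrier A" for t n y a
  proof -
    have y: "y \<in> derived g" using that(2) neg_part_derived by blast
    have "bracket g t y = (- wt n t) \<odot> y" using that chev_weight by (auto simp: neg_part_def)
    then show ?thesis
      using emb_bracket[OF that(1) y that(3)] clinear.smult[OF T_left[OF that(3)], of y "- wt n t"] y by simp
  qed
  show "{#} \<in> degrees" by (simp add: degrees_def)
qed (rule R.lrep_axioms sp.cspace_axioms Av.cspace_axioms neg_part_fin neg_part_sub A.m_closed v_in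
  B_in L_span Js_cofinite wt_add wt_empty wt_inj; assumption)+

text \<open>The graded argument bounds the weight space by the span of a finite set of the module,
  which need not lie in it; \<open>cfin_dim_subspaceI\<close> turns this into finite
  dimension.\<close>

theorem weight_space_fin_dim: "cfin_dim (R\<lparr>carrier := weight_space R hemb h \<mu>\<rparr>)"
proof -
  have W: "csubspace (weight_space R hemb h \<mu>) R"
    unfolding weight_space_def
    by (rule R.M.csubI)
      (simp_all add: subset_iff R.act_zero[OF hemb_in] R.act_add[OF hemb_in] R.act_smult[OF hemb_in] R.M.scale_add_right R.M.scale_scale mult.commute)
  obtain E where "finite E" "E \<subseteq> carrier R" "weight_space R hemb h \<mu> \<subseteq> R.M.span E"
    using graded_cyclic.weight_space_fin[OF graded, of \<mu>] unfolding weight_space_def by blast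
  then show ?thesis using R.M.cfin_dim_subspaceI W by blast
qed

end

theorem proposition3p3:
  fixes g :: "'g lie_alg" and h h'' :: "'g set" and C :: "int mat"
    and e f \<alpha>v :: "nat \<Rightarrow> 'g" and \<alpha> :: "nat \<Rightarrow> 'g \<Rightarrow> complex"
    and A :: "(complex, 'a) module" and I :: "'a set"
    and \<psi> :: "('g, 'a) current \<times> 'g \<Rightarrow> complex" and lam :: "'g \<Rightarrow> complex"
    and Is :: "('g \<Rightarrow> complex) \<Rightarrow> 'a set" and \<mu> :: "'g \<Rightarrow> complex"
    and l :: nat
  assumes "l = dim_row C"
    and "kac_moody g h C e f \<alpha>v \<alpha>"
    and "cartan_complement g h h''"
    and "algebra (class_ring :: complex ring) A"
    and "fin_gen_algebra A"
    and "cofinite_ideal A I"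
    and "\<psi> \<in> linear_forms ((g_tilde g A h'')\<lparr>carrier := h_tilde g A h h''\<rparr>)"
    and "\<forall>t\<in>current_sub g A (cartan' g h) I. \<psi> (t, \<zero>\<^bsub>g\<^esub>) = 0"
    and "lam \<in> cartan_dual g h"
    and "\<forall>x\<in>h. \<psi> (cartan_emb g A h h'' x) = lam x"
    and "dominant_integral l \<alpha>v lam"
    and "\<forall>\<beta>\<in>pos_roots g h l \<alpha>. cofinite_ideal A (Is \<beta>) \<and> Is \<beta> \<subseteq> I"
    and "\<forall>\<beta>\<in>pos_roots g h l \<alpha>. \<forall>\<gamma>\<in>pos_roots g h l \<alpha>.
           \<gamma> - \<beta> \<in> Q_plus l \<alpha> \<longrightarrow> Is \<gamma> \<subseteq> Is \<beta>"
    and "\<forall>\<beta>\<in>pos_roots g h l \<alpha>. \<forall>\<gamma>\<in>pos_roots g h l \<alpha>.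
           \<beta> + \<gamma> \<in> pos_roots g h l \<alpha> \<longrightarrow> ideal_prod A (Is \<beta>) (Is \<gamma>) \<subseteq> Is (\<beta> + \<gamma>)"
    and "\<mu> \<in> cartan_dual g h"
  shows "cfin_dim ((verma_quotient g A h h'' l \<alpha> \<psi> Is)
    \<lparr>carrier := weight_space (verma_quotient g A h h'' l \<alpha> \<psi> Is) (cartan_emb g A h h'') h \<mu>\<rparr>)"
proof -
  interpret kac_moody g h C e f \<alpha>v \<alpha> by fact
  interpret km_current g h C e f \<alpha>v \<alpha> A h'' \<psi> Is
    using assms(1-4,12) lie_algebra_axioms kac_moody_axioms
    by (intro km_current.intro current.intro current_axioms.intro km_current_axioms.intro)
      (auto simp: cartan_complement_def)
  show ?thesis using weight_space_fin_dim unfolding assms(1) .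
qed

end
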